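(* Let $K\in\mathbb{N}$, $\varepsilon\in(0,1/2)$, $D>0$. Let $(X,g)$ be any spatially compact Cauchy slab with $\mathrm{vol}_g(X)=1$. Then there is $Y\in\mathrm{CS}$ with $\mathrm{vol}(Y)=1$, $\partial^\pm X=\partial^\pm Y$, $d^-(X,Y)>D$ and $TV(C_K(X),C_K(Y))<\varepsilon$.
   Context: A spacetime is a connected time-oriented Lorentzian manifold; $\le$ is its causal relation, $J^\pm$ and $I^\pm$ denote causal and chronological future/past, and $\mathrm{vol}_g$ is the volume measure of $g$. A Cauchy slab is a Lorentzian spacetime $(X,g)$ such that there is an isometric embedding $f:(X,g)\to(N,h)$ into a globally hyperbolic spacetime $(N,h)$ with $f(X)=I^+(S_-)\cap I^-(S_+)$ for two connected spacelike Cauchy hypersurfaces $S_-$ and $S_+\subset I^+(S_-)$ of $(N,h)$. It is spatially compact iff the closure of $f(X)$ is compact (equivalently, $S_+$ is compact). $\mathrm{CS}$ is the set of time-oriented isometry classes of spatially compact Cauchy slabs of volume $1$. Boundaries: $\partial^+X$ and $\partial^-X$ are the future and past boundary of the slab, i.e. the hypersurfaces $S_+$ and $S_-$. The condition $\partial^\pm X=\partial^\pm Y$ means that $X$ and $Y$ can be realized, with the same manifold $N$ and the same hypersurfaces $S_-,S_+\subset N$, as the slabs $I^+(S_-)\cap I^-(S_+)$ for two (possibly different) globally hyperbolic metrics on $N$. Lorentzian distance: for globally hyperbolic $(Y,k)$, $\tau_k:Y\times Y\to[0,\infty)$ is $\tau_k(x,y):=\sup\{\ell_k(c): c \text{ a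 causal curve from } x \text{ to } y\}$ for $x\le y$ (with $\ell_k$ the Lorentzian curve length), and $\tau_k(x,y):=0$ otherwise. Distance $d^-$: for Cauchy slabs $(M,g)$, $(N,h)$, $d^-(M,N):=\inf\{\mathrm{dist}(\rho):\rho\in\mathrm{Corr}(M,N)\}$, where $\mathrm{Corr}(M,N)$ is the set of $\rho\subset M\times N$ with $\mathrm{pr}_1(\rho)=M$ and $\mathrm{pr}_2(\rho)=N$, and $\mathrm{dist}(\rho):=\sup\{|\tau_g(m_1,m_2)-\tau_h(n_1,n_2)|:(m_1,n_1),(m_2,n_2)\in\rho\}$. The measure $C_K(X)$: let $\mathbb{N}_K^*:=\{1,\dots,K\}$ and let $Q_K$ be the (finite) set of all subsets of $\mathbb{N}_K^*\times\mathbb{N}_K^*$. For $X\in\mathrm{CS}$ let $\mu_K$ be the $K$-fold product of $\mathrm{vol}_g$ on $X^K$. Then $C_K(X)$ is the probability measure on $Q_K$ given by $C_K(X)(\{q\}):=\mu_K(\{a\in X^K: a^*(\le)=q\})$, where $a^*(\le):=\{(i,j): a(i)\le a(j)\}$. Total variation: for probability measures $\mu,\nu$ on $Q_K$, $TV(\mu,\nu):=\sup_{A\subset Q_K}|\mu(A)-\nu(A)|$. *)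

theory Defs
  imports "HOL-Analysis.Analysis"
begin

section \<open>Smooth manifolds\<close>

primrec Ck_on :: "nat \<Rightarrow> 'a::euclidean_space set \<Rightarrow> ('a \<Rightarrow> 'b::real_normed_vector) \<Rightarrow> bool"
  where
    "Ck_on 0 S f \<longleftrightarrow> continuous_on S f"
  | "Ck_on (Suc k) S f \<longleftrightarrow>
       (\<forall>x\<in>S. f differentiable (at x)) \<and>
       (\<forall>v. Ck_on k S (\<lambda>x. frechet_derivative f (at x) v))"

text \<open>Only used for open \<open>S\<close>.\<close>

definition smooth_on :: "'a::euclidean_space set \<Rightarrow> ('a \<Rightarrow> 'b::real_normed_vector) \<Rightarrow> bool"
  where "smooth_on S f \<longleftrightarrow> (\<forall>k. Ck_on k S f)"

text \<open>A chart is a pair of its domain and its coordinate map; the values of the coordinate map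
  outside the domain carry no meaning.\<close>

type_synonym ('p, 'n) chart = "'p set \<times> ('p \<Rightarrow> real ^ 'n)"

definition chart_inv :: "('p, 'n) chart \<Rightarrow> real ^ 'n \<Rightarrow> 'p"
  where "chart_inv c = inv_into (fst c) (snd c)"

definition coord_rep :: "('p, 'n) chart \<Rightarrow> ('q, 'm) chart \<Rightarrow> ('p \<Rightarrow> 'q) \<Rightarrow> real ^ 'n \<Rightarrow> real ^ 'm"
  where "coord_rep c d f = snd d \<circ> f \<circ> chart_inv c"

definition tangent_map ::
    "('p, 'n::finite) chart \<Rightarrow> ('q, 'm::finite) chart \<Rightarrow> ('p \<Rightarrow> 'q) \<Rightarrow> 'p \<Rightarrow> real ^ 'n \<Rightarrow> real ^ 'm"
  where "tangent_map c d f p = frechet_derivative (coord_rep c d f) (at (snd c p))"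

text \<open>Tensor fields are families of local representatives, one for each chart of the atlas:
  \<open>metric M c p\<close> is the Gram matrix of the metric at \<open>p\<close> in the coordinates of \<open>c\<close>, and
  \<open>tdir M c p\<close> is the coordinate vector of a timelike vector field which represents the time
  orientation. The atlas need not be maximal.

  Points are taken from a fixed type \<open>'p\<close>, the underlying set of a manifold being a subset of it.
  A nonempty connected manifold of positive dimension has the cardinality of the continuum, so as
  soon as \<open>'p\<close> carries one such manifold it carries a copy of every such manifold. In particular
  existential statements over manifolds on the type \<open>'p\<close> below are not restrictive.\<close>

record ('p, 'n::finite) manifold =
  mtop :: "'p topology"
  atlas :: "('p, 'n) chart set"

record ('p, 'n::finite) spacetime = "('p, 'n) manifold" +
  metric :: "('p, 'n) chart \<Rightarrow> 'p \<Rightarrow> real ^ 'n ^ 'n"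
  tdir :: "('p, 'n) chart \<Rightarrow> 'p \<Rightarrow> real ^ 'n"

abbreviation points :: "('p, 'n::finite, 'z) manifold_scheme \<Rightarrow> 'p set"
  where "points M \<equiv> topspace (mtop M)"

definition smooth_map ::
    "('p, 'n::finite, 'y) manifold_scheme \<Rightarrow> ('q, 'm::finite, 'z) manifold_scheme \<Rightarrow> ('p \<Rightarrow> 'q) \<Rightarrow> bool"
  where "smooth_map M N f \<longleftrightarrow>
    continuous_map (mtop M) (mtop N) f \<and>
    (\<forall>c\<in>atlas M. \<forall>d\<in>atlas N. smooth_on (snd c ` (fst c \<inter> f -` fst d)) (coord_rep c d f))"

text \<open>The last conjunct says that all transition maps are smooth.\<close>

definition smooth_manifold :: "('p, 'n::finite, 'z) manifold_scheme \<Rightarrow> bool"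
  where "smooth_manifold M \<longleftrightarrow>
    Hausdorff_space (mtop M) \<and> second_countable (mtop M) \<and>
    (\<forall>(U, \<phi>)\<in>atlas M. openin (mtop M) U \<and> open (\<phi> ` U) \<and>
       homeomorphic_map (subtopology (mtop M) U) (top_of_set (\<phi> ` U)) \<phi>) \<and>
    (\<Union>(U, \<phi>)\<in>atlas M. U) = points M \<and>
    smooth_map M M id"

section \<open>Spacetimes\<close>

definition lorentz_matrix :: "real ^ 'n ^ 'n \<Rightarrow> bool"
  where "lorentz_matrix G \<longleftrightarrow>
    (\<exists>(P :: real ^ 'n ^ 'n) i0. invertible P \<and>
       transpose P ** G ** P = (\<chi> i j. if i = j then (if i = i0 then - 1 else 1) else 0))"

definition ginner ::
    "('p, 'n::finite) spacetime \<Rightarrow> ('p, 'n) chart \<Rightarrow> 'p \<Rightarrow> real ^ 'n \<Rightarrow> real ^ 'n \<Rightarrow> real"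
  where "ginner M c p v w = v \<bullet> (metric M c p *v w)"

definition preserves_metric ::
    "('p, 'n::finite) spacetime \<Rightarrow> ('q, 'n) spacetime \<Rightarrow> ('p \<Rightarrow> 'q) \<Rightarrow> bool"
  where "preserves_metric M N f \<longleftrightarrow>
    (\<forall>c\<in>atlas M. \<forall>d\<in>atlas N. \<forall>p \<in> fst c \<inter> f -` fst d. \<forall>v w.
       ginner N d (f p) (tangent_map c d f p v) (tangent_map c d f p w) = ginner M c p v w)"

text \<open>The transformation laws under a change of chart are expressed through the identity map. As
  usual a Lorentzian manifold has dimension at least 2.\<close>

definition spacetime :: "('p, 'n::finite) spacetime \<Rightarrow> bool"
  where "spacetime M \<longleftrightarrow>
    smooth_manifold M \<and> connected_space (mtop M) \<and> points M \<noteq> {} \<and> 2 \<le> CARD('n) \<and>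
    (\<forall>c\<in>atlas M. \<forall>p\<in>fst c. lorentz_matrix (metric M c p)) \<and>
    (\<forall>c\<in>atlas M. \<forall>i j. smooth_on (snd c ` fst c) (\<lambda>x. metric M c (chart_inv c x) $ i $ j)) \<and>
    preserves_metric M M id \<and>
    (\<forall>c\<in>atlas M. \<forall>p\<in>fst c. ginner M c p (tdir M c p) (tdir M c p) < 0) \<and>
    (\<forall>c\<in>atlas M. continuous_on (snd c ` fst c) (\<lambda>x. tdir M c (chart_inv c x))) \<and>
    (\<forall>c\<in>atlas M. \<forall>d\<in>atlas M. \<forall>p \<in> fst c \<inter> fst d.
       tangent_map c d id p (tdir M c p) = tdir M d p)"

text \<open>With signature \<open>(-, +, \<dots>, +)\<close>, a causal vector is in the same time cone as the
  vector \<open>tdir M c p\<close> iff its inner product with that vector is negative.\<close>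

definition future_causal :: "('p, 'n::finite) spacetime \<Rightarrow> ('p, 'n) chart \<Rightarrow> 'p \<Rightarrow> real ^ 'n \<Rightarrow> bool"
  where "future_causal M c p v \<longleftrightarrow>
    v \<noteq> 0 \<and> ginner M c p v v \<le> 0 \<and> ginner M c p v (tdir M c p) < 0"

definition future_timelike :: "('p, 'n::finite) spacetime \<Rightarrow> ('p, 'n) chart \<Rightarrow> 'p \<Rightarrow> real ^ 'n \<Rightarrow> bool"
  where "future_timelike M c p v \<longleftrightarrow>
    ginner M c p v v < 0 \<and> ginner M c p v (tdir M c p) < 0"

section \<open>Curves\<close>

definition C1_arc ::
    "('p, 'n::finite) spacetime \<Rightarrow> (('p, 'n) chart \<Rightarrow> 'p \<Rightarrow> real ^ 'n \<Rightarrow> bool) \<Rightarrow>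
     real \<Rightarrow> real \<Rightarrow> (real \<Rightarrow> 'p) \<Rightarrow> bool"
  where "C1_arc M C a b \<gamma> \<longleftrightarrow>
    (\<forall>c\<in>atlas M.
       (\<forall>t\<in>{a..b} \<inter> \<gamma> -` fst c. (snd c \<circ> \<gamma>) differentiable (at t within {a..b}) \<and>
          C c (\<gamma> t) (vector_derivative (snd c \<circ> \<gamma>) (at t within {a..b}))) \<and>
       continuous_on ({a..b} \<inter> \<gamma> -` fst c)
         (\<lambda>t. vector_derivative (snd c \<circ> \<gamma>) (at t within {a..b})))"

text \<open>Continuous, piecewise \<open>C\<^sup>1\<close> curves on an interval \<open>J\<close> whose (one-sided) velocities satisfy the
  condition \<open>C\<close>. The set \<open>B\<close> of break points may be infinite if \<open>J\<close> is not compact.\<close>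

definition pw_curve ::
    "('p, 'n::finite) spacetime \<Rightarrow> (('p, 'n) chart \<Rightarrow> 'p \<Rightarrow> real ^ 'n \<Rightarrow> bool) \<Rightarrow>
     real set \<Rightarrow> (real \<Rightarrow> 'p) \<Rightarrow> bool"
  where "pw_curve M C J \<gamma> \<longleftrightarrow>
    is_interval J \<and> continuous_map (top_of_set J) (mtop M) \<gamma> \<and>
    (\<exists>B. \<forall>a\<in>J. \<forall>b\<in>J. finite (B \<inter> {a..b}) \<and>
       (a < b \<and> B \<inter> {a<..<b} = {} \<longrightarrow> C1_arc M C a b \<gamma>))"

definition curve_from_to ::
    "('p, 'n::finite) spacetime \<Rightarrow> (('p, 'n) chart \<Rightarrow> 'p \<Rightarrow> real ^ 'n \<Rightarrow> bool) \<Rightarrow>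
     'p \<Rightarrow> 'p \<Rightarrow> real \<Rightarrow> real \<Rightarrow> (real \<Rightarrow> 'p) \<Rightarrow> bool"
  where "curve_from_to M C p q a b \<gamma> \<longleftrightarrow> a < b \<and> pw_curve M C {a..b} \<gamma> \<and> \<gamma> a = p \<and> \<gamma> b = q"

definition causal_le :: "('p, 'n::finite) spacetime \<Rightarrow> 'p \<Rightarrow> 'p \<Rightarrow> bool"
  where "causal_le M p q \<longleftrightarrow>
    p \<in> points M \<and> q \<in> points M \<and> (p = q \<or> (\<exists>a b \<gamma>. curve_from_to M (future_causal M) p q a b \<gamma>))"

definition chron_less :: "('p, 'n::finite) spacetime \<Rightarrow> 'p \<Rightarrow> 'p \<Rightarrow> bool"
  where "chron_less M p q \<longleftrightarrow> (\<exists>a b \<gamma>. curve_from_to M (future_timelike M) p q a b \<gamma>)"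

definition J_plus :: "('p, 'n::finite) spacetime \<Rightarrow> 'p set \<Rightarrow> 'p set"
  where "J_plus M S = {q. \<exists>p\<in>S. causal_le M p q}"

definition J_minus :: "('p, 'n::finite) spacetime \<Rightarrow> 'p set \<Rightarrow> 'p set"
  where "J_minus M S = {p. \<exists>q\<in>S. causal_le M p q}"

definition I_plus :: "('p, 'n::finite) spacetime \<Rightarrow> 'p set \<Rightarrow> 'p set"
  where "I_plus M S = {q. \<exists>p\<in>S. chron_less M p q}"

definition I_minus :: "('p, 'n::finite) spacetime \<Rightarrow> 'p set \<Rightarrow> 'p set"
  where "I_minus M S = {p. \<exists>q\<in>S. chron_less M p q}"

section \<open>Lorentzian distance\<close>

text \<open>The chart chosen in \<open>speed\<close> is irrelevant, and so are its values at the finitely many break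
  points.\<close>

definition speed :: "('p, 'n::finite) spacetime \<Rightarrow> (real \<Rightarrow> 'p) \<Rightarrow> real \<Rightarrow> real"
  where "speed M \<gamma> t =
    (let c = (SOME c. c \<in> atlas M \<and> \<gamma> t \<in> fst c);
         v = vector_derivative (snd c \<circ> \<gamma>) (at t)
     in sqrt (- ginner M c (\<gamma> t) v v))"

definition lorentz_length :: "('p, 'n::finite) spacetime \<Rightarrow> real \<Rightarrow> real \<Rightarrow> (real \<Rightarrow> 'p) \<Rightarrow> real"
  where "lorentz_length M a b \<gamma> = integral {a..b} (speed M \<gamma>)"

text \<open>The curves of \<open>curve_from_to\<close> are regular, so the supremum for \<open>x = y\<close> does not include the
  constant curve; but the supremum of the empty set in \<^typ>\<open>ennreal\<close> is \<open>0\<close>.\<close>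

definition lorentz_dist :: "('p, 'n::finite) spacetime \<Rightarrow> 'p \<Rightarrow> 'p \<Rightarrow> ennreal"
  where "lorentz_dist M x y =
    (if causal_le M x y
     then Sup {ennreal (lorentz_length M a b \<gamma>) | a b \<gamma>. curve_from_to M (future_causal M) x y a b \<gamma>}
     else 0)"

section \<open>Global hyperbolicity and Cauchy slabs\<close>

definition strongly_causal :: "('p, 'n::finite) spacetime \<Rightarrow> bool"
  where "strongly_causal M \<longleftrightarrow>
    (\<forall>p U. openin (mtop M) U \<and> p \<in> U \<longrightarrow>
       (\<exists>V. openin (mtop M) V \<and> p \<in> V \<and> V \<subseteq> U \<and>
          (\<forall>x\<in>V. \<forall>y\<in>V. \<forall>a b \<gamma>.
             curve_from_to M (future_causal M) x y a b \<gamma> \<longrightarrow> \<gamma> ` {a..b} \<subseteq> U)))"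

definition globally_hyperbolic :: "('p, 'n::finite) spacetime \<Rightarrow> bool"
  where "globally_hyperbolic M \<longleftrightarrow>
    spacetime M \<and> strongly_causal M \<and>
    (\<forall>p\<in>points M. \<forall>q\<in>points M. compactin (mtop M) (J_plus M {p} \<inter> J_minus M {q}))"

text \<open>\<open>\<le>\<close> rather than \<open><\<close>: if \<open>J\<close> contains an end point then \<open>\<gamma>\<close> has a limit there.\<close>

definition inextendible :: "('p, 'n::finite) spacetime \<Rightarrow> real set \<Rightarrow> (real \<Rightarrow> 'p) \<Rightarrow> bool"
  where "inextendible M J \<gamma> \<longleftrightarrow>
    \<not> (\<exists>p\<in>points M. \<forall>U. openin (mtop M) U \<and> p \<in> U \<longrightarrow> (\<exists>s\<in>J. \<forall>t\<in>J. s \<le> t \<longrightarrow> \<gamma> t \<in> U)) \<and>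
    \<not> (\<exists>p\<in>points M. \<forall>U. openin (mtop M) U \<and> p \<in> U \<longrightarrow> (\<exists>s\<in>J. \<forall>t\<in>J. t \<le> s \<longrightarrow> \<gamma> t \<in> U))"

text \<open>Every past-directed timelike curve is the reversal of a future-directed one.\<close>

definition cauchy_hypersurface :: "('p, 'n::finite) spacetime \<Rightarrow> 'p set \<Rightarrow> bool"
  where "cauchy_hypersurface M S \<longleftrightarrow>
    S \<subseteq> points M \<and>
    (\<forall>J \<gamma>. interior J \<noteq> {} \<and> pw_curve M (future_timelike M) J \<gamma> \<and> inextendible M J \<gamma> \<longrightarrow>
       (\<exists>!t. t \<in> J \<and> \<gamma> t \<in> S))"

text \<open>A smooth embedded hypersurface is given locally as the zero set of a function \<open>F\<close> with
  nonvanishing differential, and its tangent space is the kernel of that differential.\<close>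

definition spacelike_hypersurface :: "('p, 'n::finite) spacetime \<Rightarrow> 'p set \<Rightarrow> bool"
  where "spacelike_hypersurface M S \<longleftrightarrow>
    S \<subseteq> points M \<and>
    (\<forall>p\<in>S. \<exists>c\<in>atlas M. p \<in> fst c \<and>
       (\<exists>W (F :: real ^ 'n \<Rightarrow> real). open W \<and> snd c p \<in> W \<and> W \<subseteq> snd c ` fst c \<and> smooth_on W F \<and>
          (\<forall>x\<in>W. chart_inv c x \<in> S \<longleftrightarrow> F x = 0) \<and>
          (\<forall>x\<in>W. F x = 0 \<longrightarrow>
             (\<exists>v. frechet_derivative F (at x) v \<noteq> 0) \<and>
             (\<forall>v. v \<noteq> 0 \<and> frechet_derivative F (at x) v = 0 \<longrightarrow>
                ginner M c (chart_inv c x) v v > 0))))"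

definition isometric_embedding ::
    "('p, 'n::finite) spacetime \<Rightarrow> ('q, 'n) spacetime \<Rightarrow> ('p \<Rightarrow> 'q) \<Rightarrow> bool"
  where "isometric_embedding M N f \<longleftrightarrow>
    embedding_map (mtop M) (mtop N) f \<and> smooth_map M N f \<and> preserves_metric M N f \<and>
    (\<forall>c\<in>atlas M. \<forall>d\<in>atlas N. \<forall>p \<in> fst c \<inter> f -` fst d.
       future_timelike N d (f p) (tangent_map c d f p (tdir M c p)))"

definition is_slab_in ::
    "('p, 'n::finite) spacetime \<Rightarrow> ('p, 'n) spacetime \<Rightarrow> ('p \<Rightarrow> 'p) \<Rightarrow> 'p set \<Rightarrow> 'p set \<Rightarrow> bool"
  where "is_slab_in X N f Sm Sp \<longleftrightarrow>
    spacetime X \<and> globally_hyperbolic N \<and>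
    connectedin (mtop N) Sm \<and> spacelike_hypersurface N Sm \<and> cauchy_hypersurface N Sm \<and>
    connectedin (mtop N) Sp \<and> spacelike_hypersurface N Sp \<and> cauchy_hypersurface N Sp \<and>
    Sp \<subseteq> I_plus N Sm \<and>
    isometric_embedding X N f \<and> f ` points X = I_plus N Sm \<inter> I_minus N Sp"

definition cauchy_slab :: "('p, 'n::finite) spacetime \<Rightarrow> bool"
  where "cauchy_slab X \<longleftrightarrow> (\<exists>N f Sm Sp. is_slab_in X N f Sm Sp)"

definition spatially_compact_slab :: "('p, 'n::finite) spacetime \<Rightarrow> bool"
  where "spatially_compact_slab X \<longleftrightarrow>
    (\<exists>N f Sm Sp. is_slab_in X N f Sm Sp \<and> compactin (mtop N) (mtop N closure_of (f ` points X)))"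

text \<open>\<open>\<partial>\<^sup>\<plusminus>X = \<partial>\<^sup>\<plusminus>Y\<close>: a common smooth manifold with common hypersurfaces, but possibly different
  metrics and time orientations.\<close>

definition same_boundaries :: "('p, 'n::finite) spacetime \<Rightarrow> ('p, 'n) spacetime \<Rightarrow> bool"
  where "same_boundaries X Y \<longleftrightarrow>
    (\<exists>N N' f f' Sm Sp. mtop N' = mtop N \<and> atlas N' = atlas N \<and>
       is_slab_in X N f Sm Sp \<and> is_slab_in Y N' f' Sm Sp)"

section \<open>Volume\<close>

definition is_volume_measure :: "('p, 'n::finite) spacetime \<Rightarrow> 'p measure \<Rightarrow> bool"
  where "is_volume_measure M \<mu> \<longleftrightarrow>
    space \<mu> = points M \<and> sets \<mu> = sigma_sets (points M) (Collect (openin (mtop M))) \<and>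
    (\<forall>c\<in>atlas M. \<forall>A\<in>sets \<mu>. A \<subseteq> fst c \<longrightarrow>
       emeasure \<mu> A =
         (\<integral>\<^sup>+x\<in>snd c ` A. ennreal (sqrt \<bar>det (metric M c (chart_inv c x))\<bar>) \<partial>lborel))"

definition volume_measure :: "('p, 'n::finite) spacetime \<Rightarrow> 'p measure"
  where "volume_measure M = (THE \<mu>. is_volume_measure M \<mu>)"

definition total_volume :: "('p, 'n::finite) spacetime \<Rightarrow> ennreal"
  where "total_volume M = emeasure (volume_measure M) (points M)"

text \<open>Isometry classes are represented by their elements.\<close>

definition CS :: "('p, 'n::finite) spacetime set"
  where "CS = {X. spatially_compact_slab X \<and> total_volume X = 1}"

section \<open>The distance between slabs and the order measures\<close>

definition Corr :: "'a set \<Rightarrow> 'b set \<Rightarrow> ('a \<times> 'b) set set"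
  where "Corr A B = {\<rho>. \<rho> \<subseteq> A \<times> B \<and> fst ` \<rho> = A \<and> snd ` \<rho> = B}"

definition distortion ::
    "('p, 'n::finite) spacetime \<Rightarrow> ('q, 'm::finite) spacetime \<Rightarrow> ('p \<times> 'q) set \<Rightarrow> ereal"
  where "distortion M N \<rho> =
    (SUP ((m1, n1), (m2, n2)) \<in> \<rho> \<times> \<rho>.
       \<bar>enn2ereal (lorentz_dist M m1 m2) - enn2ereal (lorentz_dist N n1 n2)\<bar>)"

definition d_minus :: "('p, 'n::finite) spacetime \<Rightarrow> ('q, 'm::finite) spacetime \<Rightarrow> ereal"
  where "d_minus M N = (INF \<rho> \<in> Corr (points M) (points N). distortion M N \<rho>)"

definition order_pattern :: "nat \<Rightarrow> ('p, 'n::finite) spacetime \<Rightarrow> (nat \<Rightarrow> 'p) \<Rightarrow> (nat \<times> nat) set"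
  where "order_pattern K X a = {(i, j) \<in> {1..K} \<times> {1..K}. causal_le X (a i) (a j)}"

definition order_measure :: "nat \<Rightarrow> ('p, 'n::finite) spacetime \<Rightarrow> (nat \<times> nat) set measure"
  where "order_measure K X =
    (let \<mu> = PiM {1..K} (\<lambda>_. volume_measure X)
     in point_measure (Pow ({1..K} \<times> {1..K}))
          (\<lambda>q. emeasure \<mu> {a \<in> space \<mu>. order_pattern K X a = q}))"

definition total_variation :: "'a measure \<Rightarrow> 'a measure \<Rightarrow> real"
  where "total_variation \<mu> \<nu> = (SUP A \<in> sets \<mu>. \<bar>measure \<mu> A - measure \<nu> A\<bar>)"

end

theory Submission
  imports Defs "HOL-Probability.Probability"
begin

text \<open>\<open>Y\<close> is \<open>X\<close> with a conformally changed metric. A conformal change preserves the causal relation,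
  hence global hyperbolicity, Cauchy hypersurfaces and the slab, and only changes volumes and
  lengths. The conformal factor is large near a short timelike curve and is a constant close to \<open>1\<close>
  elsewhere. A curve is a null set, so the factor can be made as large as desired along it at the
  expense of little volume. The Lorentzian distance of \<open>X\<close> is bounded because \<open>X\<close> is relatively
  compact in a strongly causal spacetime, so that a sufficiently long curve in \<open>Y\<close> makes
  \<open>d\<^sup>-(X, Y)\<close> large. The volume density of \<open>Y\<close> with respect to \<open>X\<close> is at least \<open>1 - \<delta>\<close>, so the
  \<open>K\<close>-fold product measures differ by at most \<open>1 - (1 - \<delta>)\<^sup>K\<close> on every measurable set.\<close>

section \<open>Smooth functions on Euclidean space\<close>

text \<open>The order of choices matters. A correspondence may pair points of X and Y arbitrarily,
  so \<open>d_minus\<close> is forced up only by two points of Y whose distance exceeds every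
  distance of X by more than D. Hence a bound m for \<open>lorentz_dist X\<close> comes first; it
  dictates the length m + D + 1 of the curve, which fixes the height of the conformal factor. Only
  then is the support of the bump shrunk until the added volume, and with it the correction by the
  normalization, is small. The bound m rests on a local estimate: near a point, the speed of a
  causal curve is at most the derivative of a linear function of the coordinates along it, so a
  causal curve inside a small set is short. Strong causality keeps every piece between two visits of
  a smaller set inside that set. For the order measures it is decisive that the causal relations of
  X and Y are equal as relations: a set of samples with a given pattern is the same set for both,
  and only its product measure changes.\<close>

lemma frechet_derivative_eqI:
  "(f has_derivative D) (at x) \<Longrightarrow> frechet_derivative f (at x) v = D v"
  by (simp flip: frechet_derivative_at)

lemma frechet_derivative_worksI:
  "f differentiable F \<Longrightarrow> (f has_derivative frechet_derivative f F) F"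
  by (simp flip: frechet_derivative_works)

lemma frechet_derivative_cong_open:
  assumes "open S" "x \<in> S" "\<And>y. y \<in> S \<Longrightarrow> f y = g y"
  shows "frechet_derivative f (at x) = frechet_derivative g (at x)"
proof -
  have "(f has_derivative D) (at x) \<longleftrightarrow> (g has_derivative D) (at x)" for D
    using assms has_derivative_transform_within_open[of f D x UNIV S g]
      has_derivative_transform_within_open[of g D x UNIV S f] by auto
  then show ?thesis
    by (simp add: frechet_derivative_def)
qed

lemma differentiable_cong_open:
  assumes "open S" "x \<in> S" "\<And>y. y \<in> S \<Longrightarrow> f y = g y" "f differentiable (at x)"
  shows "g differentiable (at x)"
  using assms has_derivative_transform_within_open[of f _ x UNIV S g]
  unfolding differentiable_def by auto

section \<open>Closure properties of C^k functions\<close>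

lemma Ck_on_cong:
  assumes "open S" "\<And>y. y \<in> S \<Longrightarrow> f y = g y" "Ck_on k S f"
  shows "Ck_on k S g"
  using assms
proof (induction k arbitrary: f g)
  case 0
  then show ?case by (simp cong: continuous_on_cong)
next
  case (Suc k)
  have "Ck_on k S (\<lambda>x. frechet_derivative g (at x) v)" for v
  proof (rule Suc.IH[OF Suc.prems(1)])
    show "Ck_on k S (\<lambda>x. frechet_derivative f (at x) v)"
      using Suc.prems(3) by simp
    show "frechet_derivative f (at y) v = frechet_derivative g (at y) v" if "y \<in> S" for y
      using frechet_derivative_cong_open[OF Suc.prems(1) that, of f g] Suc.prems(2) by simp
  qed
  then show ?case
    using differentiable_cong_open[OF Suc.prems(1), of _ f g] Suc.prems(2,3) by auto
qed

lemma Ck_on_subset: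
  assumes "Ck_on k S f" "T \<subseteq> S"
  shows "Ck_on k T f"
  using assms by (induction k arbitrary: f) (auto intro: continuous_on_subset)

lemma Ck_on_local:
  assumes "\<And>x. x \<in> S \<Longrightarrow> \<exists>W. open W \<and> x \<in> W \<and> Ck_on k W f"
  shows "Ck_on k S f"
  using assms
proof (induction k arbitrary: f)
  case 0
  then have "isCont f x" if "x \<in> S" for x
    using that by (metis Ck_on.simps(1) continuous_on_eq_continuous_at)
  then show ?case by (simp add: continuous_at_imp_continuous_on)
next
  case (Suc k)
  have "\<exists>W. open W \<and> x \<in> W \<and> Ck_on k W (\<lambda>x. frechet_derivative f (at x) v)" if "x \<in> S" for x v
    using Suc.prems[OF that] by auto
  then have "Ck_on k S (\<lambda>x. frechet_derivative f (at x) v)" for v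
    by (intro Suc.IH)
  moreover have "f differentiable (at x)" if "x \<in> S" for x
    using Suc.prems[OF that] by auto
  ultimately show ?case by simp
qed

lemma Ck_on_Suc_imp:
  assumes "Ck_on (Suc k) S f"
  shows "Ck_on k S f"
  using assms
proof (induction k arbitrary: f)
  case 0
  then show ?case
    by (auto intro!: continuous_at_imp_continuous_on differentiable_imp_continuous_within)
next
  case (Suc k)
  then show ?case by (metis Ck_on.simps(2))
qed

lemma Ck_on_const: "Ck_on k S (\<lambda>x. c)"
  by (induction k arbitrary: c) auto

lemma Ck_on_bounded_linear:
  assumes "bounded_linear L" "open S" "Ck_on k S f"
  shows "Ck_on k S (\<lambda>x. L (f x))"
  using assms
proof (induction k arbitrary: f)
  case 0
  then show ?case by (auto intro: bounded_linear.continuous_on)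
next
  case (Suc k)
  have D: "((\<lambda>x. L (f x)) has_derivative (\<lambda>v. L (frechet_derivative f (at x) v))) (at x)"
    if "x \<in> S" for x
    using Suc.prems(3) that
    by (intro bounded_linear.has_derivative[OF Suc.prems(1), of f] frechet_derivative_worksI) simp
  have "Ck_on k S (\<lambda>x. frechet_derivative (\<lambda>x. L (f x)) (at x) v)" for v
  proof (rule Ck_on_cong[OF Suc.prems(2)])
    show "Ck_on k S (\<lambda>x. L (frechet_derivative f (at x) v))"
      using Suc by simp
  qed (simp add: frechet_derivative_eqI[OF D])
  then show ?case
    using D by (auto simp: differentiable_def)
qed

lemma Ck_on_ident: "Ck_on k S (\<lambda>x. x)"
proof (cases k)
  case (Suc m)
  have "frechet_derivative (\<lambda>x. x) (at x) v = v" for x v :: 'a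
    by (rule frechet_derivative_eqI) (rule has_derivative_ident)
  then show ?thesis using Suc by (simp add: Ck_on_const)
qed (simp add: continuous_on_id)

lemma Ck_on_add:
  assumes "open S" "Ck_on k S f" "Ck_on k S g"
  shows "Ck_on k S (\<lambda>x. f x + g x)"
  using assms
proof (induction k arbitrary: f g)
  case 0
  then show ?case by (auto intro: continuous_on_add)
next
  case (Suc k)
  have D: "((\<lambda>x. f x + g x) has_derivative
      (\<lambda>v. frechet_derivative f (at x) v + frechet_derivative g (at x) v)) (at x)"
    if "x \<in> S" for x
    using Suc.prems that by (intro has_derivative_add frechet_derivative_worksI) auto
  have "Ck_on k S (\<lambda>x. frechet_derivative (\<lambda>x. f x + g x) (at x) v)" for v
  proof (rule Ck_on_cong[OF Suc.prems(1)])
    show "Ck_on k S (\<lambda>x. frechet_derivative f (at x) v + frechet_derivative g (at x) v)"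
      using Suc by simp
  qed (simp add: frechet_derivative_eqI[OF D])
  then show ?case
    using D by (auto simp: differentiable_def)
qed

text \<open>In the product rule each summand keeps one factor undifferentiated, and this factor must
  be C^k as well; \<open>Ck_on_Suc_imp\<close> lowers its order. The scalar-times-vector form is the
  one that the chain rule below requires.\<close>

lemma Ck_on_scaleR:
  assumes "open S" "Ck_on k S f" "Ck_on k S g"
  shows "Ck_on k S (\<lambda>x. f x *\<^sub>R g x)"
  using assms
proof (induction k arbitrary: f g)
  case 0
  then show ?case by (auto intro: continuous_on_scaleR)
next
  case (Suc k)
  have D: "((\<lambda>x. f x *\<^sub>R g x) has_derivative
      (\<lambda>v. f x *\<^sub>R frechet_derivative g (at x) v + frechet_derivative f (at x) v *\<^sub>R g x)) (at x)"
    if "x \<in> S" for x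
    using Suc.prems that by (intro has_derivative_scaleR frechet_derivative_worksI) auto
  have "Ck_on k S (\<lambda>x. frechet_derivative (\<lambda>x. f x *\<^sub>R g x) (at x) v)" for v
  proof (rule Ck_on_cong[OF Suc.prems(1)])
    show "Ck_on k S (\<lambda>x. f x *\<^sub>R frechet_derivative g (at x) v + frechet_derivative f (at x) v *\<^sub>R g x)"
      using Suc.prems by (intro Ck_on_add Suc.IH) (auto dest: Ck_on_Suc_imp simp del: Ck_on.simps(2), auto)
  qed (simp add: frechet_derivative_eqI[OF D])
  then show ?case
    using D by (auto simp: differentiable_def)
qed

lemma Ck_on_sum:
  assumes "open S" "\<And>i. i \<in> I \<Longrightarrow> Ck_on k S (f i)"
  shows "Ck_on k S (\<lambda>x. \<Sum>i\<in>I. f i x)"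
  using assms(2) by (induction I rule: infinite_finite_induct) (auto intro: Ck_on_const Ck_on_add assms(1))

text \<open>\<open>Ck_on\<close> differentiates in a fixed direction, but the chain rule
  differentiates f in the direction of the derivative of g, which varies with the point. Expanding
  that direction in the basis leaves a finite sum of products to which the induction hypothesis
  applies.\<close>

lemma Ck_on_compose:
  assumes "open S" "g ` S \<subseteq> T" "Ck_on k S g" "Ck_on k T f"
  shows "Ck_on k S (\<lambda>x. f (g x))"
  using assms
proof (induction k arbitrary: f)
  case 0
  then show ?case by (auto intro: continuous_on_compose2)
next
  case (Suc k)
  let ?Df = "\<lambda>x. frechet_derivative f (at x)" and ?Dg = "\<lambda>x. frechet_derivative g (at x)"
  have D: "((\<lambda>x. f (g x)) has_derivative (\<lambda>v. \<Sum>b\<in>Basis. (?Dg x v \<bullet> b) *\<^sub>R ?Df (g x) b)) (at x)"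
    if "x \<in> S" for x
  proof -
    have f: "(f has_derivative ?Df (g x)) (at (g x))" and g: "(g has_derivative ?Dg x) (at x)"
      using Suc.prems that by (auto intro!: frechet_derivative_worksI)
    have Df: "?Df (g x) u = (\<Sum>b\<in>Basis. (u \<bullet> b) *\<^sub>R ?Df (g x) b)" for u
    proof -
      interpret linear "?Df (g x)" using has_derivative_linear[OF f] .
      show ?thesis
        by (subst euclidean_representation[of u, symmetric]) (simp only: sum scaleR)
    qed
    have "?Df (g x) \<circ> ?Dg x = (\<lambda>v. \<Sum>b\<in>Basis. (?Dg x v \<bullet> b) *\<^sub>R ?Df (g x) b)"
      by (intro ext, unfold o_apply, rule Df)
    then show ?thesis
      using diff_chain_at[OF g f] by (simp add: o_def)
  qed
  have "Ck_on k S (\<lambda>x. frechet_derivative (\<lambda>x. f (g x)) (at x) v)" for v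
  proof (rule Ck_on_cong[OF Suc.prems(1)])
    show "Ck_on k S (\<lambda>x. \<Sum>b\<in>Basis. (?Dg x v \<bullet> b) *\<^sub>R ?Df (g x) b)"
    proof (intro Ck_on_sum Ck_on_scaleR Suc.prems(1))
      fix b :: 'b
      show "Ck_on k S (\<lambda>x. ?Dg x v \<bullet> b)"
        using Suc.prems by (intro Ck_on_bounded_linear[OF bounded_linear_inner_left]) auto
      show "Ck_on k S (\<lambda>x. ?Df (g x) b)"
        using Suc.prems by (intro Suc.IH[of "\<lambda>y. ?Df y b"]) (auto dest: Ck_on_Suc_imp simp del: Ck_on.simps(2), auto)
    qed
  qed (simp add: frechet_derivative_eqI[OF D])
  then show ?case
    using D by (auto simp: differentiable_def)
qed

lemma smooth_on_imp_continuous_on: "smooth_on S f \<Longrightarrow> continuous_on S f"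
  unfolding smooth_on_def by (metis Ck_on.simps(1))

lemma smooth_on_imp_has_derivative:
  "smooth_on S f \<Longrightarrow> x \<in> S \<Longrightarrow> (f has_derivative frechet_derivative f (at x)) (at x)"
  unfolding smooth_on_def by (metis Ck_on.simps(2) frechet_derivative_works)

lemma smooth_on_frechet_derivative:
  "smooth_on S f \<Longrightarrow> smooth_on S (\<lambda>x. frechet_derivative f (at x) v)"
  unfolding smooth_on_def by (metis Ck_on.simps(2))

lemma smooth_on_cong:
  "open S \<Longrightarrow> (\<And>y. y \<in> S \<Longrightarrow> f y = g y) \<Longrightarrow> smooth_on S f \<Longrightarrow> smooth_on S g"
  unfolding smooth_on_def using Ck_on_cong by metis

lemma smooth_on_local:
  assumes "\<And>x. x \<in> S \<Longrightarrow> \<exists>W. open W \<and> x \<in> W \<and> smooth_on W f"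
  shows "smooth_on S f"
  using assms unfolding smooth_on_def by (meson Ck_on_local)

lemma smooth_on_const: "smooth_on S (\<lambda>x. c)"
  by (simp add: smooth_on_def Ck_on_const)

lemma smooth_on_ident: "smooth_on S (\<lambda>x. x)"
  by (simp add: smooth_on_def Ck_on_ident)

lemma smooth_on_add:
  "open S \<Longrightarrow> smooth_on S f \<Longrightarrow> smooth_on S g \<Longrightarrow> smooth_on S (\<lambda>x. f x + g x)"
  by (simp add: smooth_on_def Ck_on_add)

lemma smooth_on_mult:
  fixes f g :: "'a::euclidean_space \<Rightarrow> real"
  shows "open S \<Longrightarrow> smooth_on S f \<Longrightarrow> smooth_on S g \<Longrightarrow> smooth_on S (\<lambda>x. f x * g x)"
  using Ck_on_scaleR[of S _ f g] by (simp add: smooth_on_def)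

lemma smooth_on_sum:
  "open S \<Longrightarrow> (\<And>i. i \<in> I \<Longrightarrow> smooth_on S (f i)) \<Longrightarrow> smooth_on S (\<lambda>x. \<Sum>i\<in>I. f i x)"
  by (simp add: smooth_on_def Ck_on_sum)

lemma smooth_on_compose:
  "open S \<Longrightarrow> g ` S \<subseteq> T \<Longrightarrow> smooth_on S g \<Longrightarrow> smooth_on T f \<Longrightarrow> smooth_on S (\<lambda>x. f (g x))"
  unfolding smooth_on_def using Ck_on_compose by blast

lemma smooth_on_inner_left: "open S \<Longrightarrow> smooth_on S f \<Longrightarrow> smooth_on S (\<lambda>x. f x \<bullet> b)"
  by (simp add: smooth_on_def Ck_on_bounded_linear[OF bounded_linear_inner_left])

section \<open>Flat functions and bump functions\<close>

text \<open>For \<open>m = 0\<close> this is the classical smooth function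
  \<open>exp (- 1 / x)\<close> that vanishes to infinite order at 0. The powers in the denominator
  make the family stable under differentiation, up to linear combinations.\<close>

definition flat :: "nat \<Rightarrow> real \<Rightarrow> real"
  where "flat m x = (if 0 < x then exp (- 1 / x) / x ^ m else 0)"

lemma flat_nonneg: "0 \<le> flat m x"
  by (simp add: flat_def)

lemma flat_0_le_1: "flat 0 x \<le> 1"
  by (simp add: flat_def)

text \<open>The exponential series at \<open>1 / x\<close> dominates its term of order m + 1, hence
  \<open>exp (- 1 / x)\<close> is at most \<open>fact (Suc m) * x ^ Suc m\<close>.\<close>

lemma flat_le: "flat m x \<le> fact (Suc m) * \<bar>x\<bar>"
proof (cases "0 < x")
  case True
  have "(1 / x) ^ Suc m / fact (Suc m) \<le> exp (1 / x)"
    using True sum_le_suminf[OF summable_exp, of "{Suc m}" "1 / x"]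
    by (simp add: exp_def inverse_eq_divide summable_exp_generic del: fact_Suc power_Suc)
  then have "exp (- 1 / x) \<le> fact (Suc m) * x ^ Suc m"
    using True by (simp add: exp_minus field_simps del: fact_Suc power_Suc)
  then show ?thesis
    using True by (simp add: flat_def field_simps del: fact_Suc)
qed (simp add: flat_def mult_nonneg_nonpos)

lemma flat_has_derivative:
  "(flat m has_real_derivative flat (m + 2) x - real m * flat (m + 1) x) (at x)"
proof -
  consider "x < 0" | "x > 0" | "x = 0" by linarith
  then show ?thesis
  proof cases
    case 1
    have "((\<lambda>x. 0) has_real_derivative 0) (at x)" by simp
    then have "(flat m has_real_derivative 0) (at x)"
      by (rule DERIV_cong_ev[THEN iffD1, rotated -1])
         (use 1 eventually_nhds_in_open[of "{..<0}" x] in \<open>auto simp: flat_def elim!: eventually_mono\<close>)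
    then show ?thesis using 1 by (simp add: flat_def)
  next
    case 2
    have "((\<lambda>x. exp (- 1 / x) / x ^ m) has_real_derivative flat (m + 2) x - real m * flat (m + 1) x) (at x)"
      using 2 by (cases m) (auto intro!: derivative_eq_intros simp: flat_def field_simps power2_eq_square,
          metis Suc_pred neq0_conv power_Suc)
    then show ?thesis
      by (rule DERIV_cong_ev[THEN iffD1, rotated -1])
         (use 2 eventually_nhds_in_open[of "{0<..}" x] in \<open>auto simp: flat_def elim!: eventually_mono\<close>)
  next
    case 3
    \<comment> \<open>The difference quotient of \<open>flat m\<close> at 0 is
      \<open>flat (Suc m)\<close>, again a member of the family.\<close>
    have "((\<lambda>h. flat (Suc m) h) \<longlongrightarrow> 0) (at 0)"
    proof (rule Lim_null_comparison)
      show "\<forall>\<^sub>F h in at 0. norm (flat (Suc m) h) \<le> fact (Suc (Suc m)) * \<bar>h\<bar>"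
        using flat_nonneg flat_le by (simp add: abs_of_nonneg del: fact_Suc)
      show "((\<lambda>h::real. fact (Suc (Suc m)) * \<bar>h\<bar>) \<longlongrightarrow> 0) (at 0)"
        by (rule tendsto_eq_intros refl | simp)+
    qed
    moreover have "flat (Suc m) h = (flat m (0 + h) - flat m 0) / h" for h
      by (auto simp: flat_def field_simps)
    ultimately have "(flat m has_real_derivative 0) (at 0)"
      unfolding DERIV_def by simp
    then show ?thesis using 3 by (simp add: flat_def)
  qed
qed

lemma smooth_on_flat: "smooth_on UNIV (flat m)"
proof -
  have "Ck_on k UNIV (flat m)" for k
  proof (induction k arbitrary: m)
    case 0
    then show ?case
      using DERIV_continuous[OF flat_has_derivative] by (simp add: continuous_at_imp_continuous_on)
  next
    case (Suc k)
    have D: "(flat m has_derivative (\<lambda>v. (flat (m + 2) x - real m * flat (m + 1) x) * v)) (at x)" for x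
      using flat_has_derivative[of m x] by (simp add: has_field_derivative_def)
    have "frechet_derivative (flat m) (at x) v = v *\<^sub>R (flat (m + 2) x + (- real m) *\<^sub>R flat (m + 1) x)" for x v
      by (simp add: frechet_derivative_eqI[OF D] mult.commute)
    moreover have "Ck_on k UNIV (\<lambda>x. v *\<^sub>R (flat (m + 2) x + (- real m) *\<^sub>R flat (m + 1) x))" for v :: real
      by (intro Ck_on_scaleR Ck_on_add Ck_on_const Suc.IH) auto
    moreover have "flat m differentiable (at x)" for x
      using D by (rule differentiableI)
    ultimately show ?case by simp
  qed
  then show ?thesis by (simp add: smooth_on_def)
qed

text \<open>A value of at least 1/2 on C, instead of a plateau of height 1, is enough to stretch a
  curve and needs only one further composition with \<open>flat 0\<close>.\<close>

lemma smooth_bump: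
  fixes C V :: "'a::euclidean_space set"
  assumes "compact C" "open V" "C \<subseteq> V"
  obtains \<phi> :: "'a \<Rightarrow> real" and K where "smooth_on UNIV \<phi>" "compact K" "K \<subseteq> V"
    "\<And>x. 0 \<le> \<phi> x" "\<And>x. \<phi> x \<le> 1" "\<And>x. x \<in> C \<Longrightarrow> 1 / 2 \<le> \<phi> x" "\<And>x. x \<notin> K \<Longrightarrow> \<phi> x = 0"
proof -
  have "\<exists>r>0. cball x r \<subseteq> V" if "x \<in> C" for x
    using that assms open_contains_cball by blast
  then obtain r where r: "\<And>x. x \<in> C \<Longrightarrow> 0 < r x" "\<And>x. x \<in> C \<Longrightarrow> cball x (r x) \<subseteq> V"
    by metis
  have "C \<subseteq> (\<Union>x\<in>C. ball x (r x))" using r by force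
  then obtain F where F: "F \<subseteq> C" "finite F" "C \<subseteq> (\<Union>x\<in>F. ball x (r x))"
    using compactE_image[OF assms(1), of C "\<lambda>x. ball x (r x)"] by auto
  \<comment> \<open>Each summand is positive exactly on the open ball around a, so the sum is
    positive on C and vanishes off the union of the balls.\<close>
  define \<Phi> where "\<Phi> = (\<lambda>x. \<Sum>a\<in>F. flat 0 ((r a)\<^sup>2 + (- 1) * ((x + (- a)) \<bullet> (x + (- a)))))"
  have ball: "x \<in> ball a (r a) \<longleftrightarrow> 0 < (r a)\<^sup>2 + (- 1) * ((x + (- a)) \<bullet> (x + (- a)))" if "a \<in> F" for x a
  proof -
    have "0 < r a" using that F r by blast
    then have "x \<in> ball a (r a) \<longleftrightarrow> (norm (x - a))\<^sup>2 < (r a)\<^sup>2"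
      by (metis abs_norm_cancel abs_of_pos dist_commute dist_norm mem_ball real_sqrt_abs real_sqrt_less_iff)
    then show ?thesis by (simp add: power2_norm_eq_inner)
  qed
  have q: "smooth_on UNIV (\<lambda>x. c + (- 1) * ((x + (- a)) \<bullet> (x + (- a))))" for a :: 'a and c :: real
  proof -
    have "smooth_on UNIV (\<lambda>x::'a. \<Sum>b\<in>Basis. ((x + (- a)) \<bullet> b) * ((x + (- a)) \<bullet> b))"
      by (intro smooth_on_sum smooth_on_mult smooth_on_inner_left smooth_on_add smooth_on_ident smooth_on_const) auto
    then have "smooth_on UNIV (\<lambda>x::'a. (x + (- a)) \<bullet> (x + (- a)))"
      by (simp add: euclidean_inner[symmetric])
    then show ?thesis
      by (intro smooth_on_add smooth_on_mult smooth_on_const) auto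
  qed
  have \<Phi>: "smooth_on UNIV \<Phi>"
    unfolding \<Phi>_def by (intro smooth_on_sum smooth_on_compose[OF _ _ q smooth_on_flat]) auto
  have \<Phi>0: "0 \<le> \<Phi> x" for x
    unfolding \<Phi>_def by (intro sum_nonneg flat_nonneg)
  have \<Phi>pos: "0 < \<Phi> x" if x: "x \<in> C" for x
  proof -
    obtain a where a: "a \<in> F" "x \<in> ball a (r a)" using F(3) x by blast
    then have "0 < flat 0 ((r a)\<^sup>2 + (- 1) * ((x + (- a)) \<bullet> (x + (- a))))"
      unfolding ball[OF a(1)] by (simp add: flat_def)
    then show ?thesis
      unfolding \<Phi>_def using a(1) F(2) by (intro sum_pos2[of F a]) (auto simp: flat_nonneg)
  qed
  have "\<exists>c>0. \<forall>x\<in>C. c \<le> \<Phi> x"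
  proof (cases "C = {}")
    case False
    have "continuous_on C \<Phi>" using smooth_on_imp_continuous_on[OF \<Phi>] continuous_on_subset by blast
    then obtain z where "z \<in> C" "\<forall>x\<in>C. \<Phi> z \<le> \<Phi> x"
      using continuous_attains_inf[OF assms(1) False] by blast
    then show ?thesis using \<Phi>pos by blast
  qed (auto intro: exI[of _ 1])
  then obtain c where c: "c > 0" "\<And>x. x \<in> C \<Longrightarrow> c \<le> \<Phi> x" by blast
  \<comment> \<open>On C the argument is at least 2, where \<open>flat 0\<close> is at least
    \<open>exp (- 1 / 2)\<close>, hence at least 1/2; the bound 1 from above holds for
    \<open>flat 0\<close> everywhere.\<close>
  define \<phi> where "\<phi> = (\<lambda>x. flat 0 ((2 / c) * \<Phi> x))"
  have "smooth_on UNIV \<phi>"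
    unfolding \<phi>_def by (intro smooth_on_compose[OF _ _ _ smooth_on_flat] smooth_on_mult smooth_on_const \<Phi>) auto
  moreover have "1 / 2 \<le> \<phi> x" if "x \<in> C" for x
  proof -
    have *: "2 \<le> (2 / c) * \<Phi> x" using c(1) c(2)[OF that] by (simp add: field_simps)
    have "1 / 2 \<le> exp (- 1 / ((2 / c) * \<Phi> x))"
    proof -
      have "1 / ((2 / c) * \<Phi> x) \<le> 1 / 2" using * by (intro divide_left_mono) auto
      moreover have "1 + (- 1 / ((2 / c) * \<Phi> x)) \<le> exp (- 1 / ((2 / c) * \<Phi> x))"
        by (rule exp_ge_add_one_self)
      ultimately show ?thesis by simp
    qed
    then show ?thesis using * by (simp add: \<phi>_def flat_def)
  qed
  moreover have "compact (\<Union>a\<in>F. cball a (r a))" using F by auto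
  moreover have "(\<Union>a\<in>F. cball a (r a)) \<subseteq> V" using F r by blast
  moreover have "\<phi> x = 0" if "x \<notin> (\<Union>a\<in>F. cball a (r a))" for x
  proof -
    have "\<Phi> x = 0"
      unfolding \<Phi>_def
    proof (rule sum.neutral, rule)
      fix a assume "a \<in> F"
      then have "x \<notin> ball a (r a)" using that by auto
      then show "flat 0 ((r a)\<^sup>2 + (- 1) * ((x + (- a)) \<bullet> (x + (- a)))) = 0"
        unfolding ball[OF \<open>a \<in> F\<close>] by (simp add: flat_def)
    qed
    then show ?thesis by (simp add: \<phi>_def flat_def)
  qed
  ultimately show ?thesis
    by (intro that[of \<phi>]) (auto simp: \<phi>_def flat_nonneg flat_0_le_1)
qed

section \<open>Charts and smooth functions on manifolds\<close>

lemma smooth_manifold_chart: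
  assumes "smooth_manifold M" "c \<in> atlas M"
  shows "openin (mtop M) (fst c)" "open (snd c ` fst c)"
    "homeomorphic_map (subtopology (mtop M) (fst c)) (top_of_set (snd c ` fst c)) (snd c)"
  using assms by (auto simp: smooth_manifold_def case_prod_beta)

lemma chart_inj:
  assumes "smooth_manifold M" "c \<in> atlas M"
  shows "inj_on (snd c) (fst c)"
  using homeomorphic_imp_injective_map[OF smooth_manifold_chart(3)[OF assms]]
    openin_subset[OF smooth_manifold_chart(1)[OF assms]]
  by (simp add: Int_absorb1)

lemma chart_inv_chart:
  assumes "smooth_manifold M" "c \<in> atlas M" "p \<in> fst c"
  shows "chart_inv c (snd c p) = p"
  using chart_inj[OF assms(1,2)] assms(3) by (simp add: chart_inv_def)

lemma chart_chart_inv: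
  assumes "x \<in> snd c ` fst c"
  shows "snd c (chart_inv c x) = x" "chart_inv c x \<in> fst c"
  using assms by (auto simp: chart_inv_def f_inv_into_f inv_into_into)

lemma chart_at:
  assumes "smooth_manifold M" "p \<in> points M"
  obtains c where "c \<in> atlas M" "p \<in> fst c"
proof -
  have "p \<in> (\<Union>(U, \<phi>)\<in>atlas M. U)"
    using assms unfolding smooth_manifold_def by blast
  then show thesis using that by auto
qed

lemma chart_subset_points:
  assumes "smooth_manifold M" "c \<in> atlas M"
  shows "fst c \<subseteq> points M"
  using openin_subset[OF smooth_manifold_chart(1)[OF assms]] .

lemma open_chart_image:
  assumes "smooth_manifold M" "c \<in> atlas M" "openin (mtop M) W" "W \<subseteq> fst c"
  shows "open (snd c ` W)"
proof -
  note c = smooth_manifold_chart[OF assms(1,2)]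
  have "openin (subtopology (mtop M) (fst c)) W"
    using assms(3,4) c(1) by (simp add: openin_open_subtopology)
  then have "openin (top_of_set (snd c ` fst c)) (snd c ` W)"
    using homeomorphic_imp_open_map[OF c(3)] by (simp add: open_map_def)
  then show ?thesis using c(2) openin_open_trans by blast
qed

lemma continuous_map_chart:
  assumes "smooth_manifold M" "c \<in> atlas M"
  shows "continuous_map (subtopology (mtop M) (fst c)) euclidean (snd c)"
  using homeomorphic_imp_continuous_map[OF smooth_manifold_chart(3)[OF assms]]
    continuous_map_into_fulltopology by blast

lemma openin_chart_preimage:
  assumes "smooth_manifold M" "c \<in> atlas M" "open V"
  shows "openin (mtop M) {p \<in> fst c. snd c p \<in> V}"
proof -
  note c = smooth_manifold_chart[OF assms(1,2)]
  have "openin (subtopology (mtop M) (fst c)) {p \<in> topspace (subtopology (mtop M) (fst c)). snd c p \<in> V}"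
    by (rule openin_continuous_map_preimage[OF continuous_map_chart[OF assms(1,2)]])
      (use assms(3) in \<open>simp flip: open_openin\<close>)
  moreover have "{p \<in> topspace (subtopology (mtop M) (fst c)). snd c p \<in> V} = {p \<in> fst c. snd c p \<in> V}"
    using chart_subset_points[OF assms(1,2)] by auto
  ultimately show ?thesis
    using c(1) by (simp add: openin_open_subtopology)
qed

lemma continuous_map_chart_inv:
  assumes "smooth_manifold M" "c \<in> atlas M"
  shows "continuous_map (top_of_set (snd c ` fst c)) (mtop M) (chart_inv c)"
proof -
  have "openin (top_of_set (snd c ` fst c)) {x \<in> snd c ` fst c. chart_inv c x \<in> W}"
    if "openin (mtop M) W" for W
  proof -
    have eq: "{x \<in> snd c ` fst c. chart_inv c x \<in> W} = snd c ` (W \<inter> fst c)"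
      by (auto simp: chart_inv_chart[OF assms])
    have "open (snd c ` (W \<inter> fst c))"
      using that smooth_manifold_chart(1)[OF assms] by (intro open_chart_image[OF assms]) auto
    then show ?thesis
      unfolding eq by (intro open_subset) auto
  qed
  moreover have "chart_inv c x \<in> points M" if "x \<in> snd c ` fst c" for x
    using chart_chart_inv(2)[OF that] chart_subset_points[OF assms] by blast
  ultimately show ?thesis
    by (simp add: continuous_map_def Pi_iff)
qed

lemma open_chart_overlap:
  assumes "smooth_manifold M" "smooth_manifold N" "continuous_map (mtop M) (mtop N) f"
    "c \<in> atlas M" "d \<in> atlas N"
  shows "open (snd c ` (fst c \<inter> f -` fst d))"
proof -
  have eq: "fst c \<inter> f -` fst d = fst c \<inter> {p \<in> points M. f p \<in> fst d}"
    using chart_subset_points[OF assms(1,4)] by auto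
  have "openin (mtop M) (fst c \<inter> {p \<in> points M. f p \<in> fst d})"
    using smooth_manifold_chart(1)[OF assms(1,4)]
      openin_continuous_map_preimage[OF assms(3) smooth_manifold_chart(1)[OF assms(2,5)]] by auto
  then show ?thesis
    unfolding eq by (rule open_chart_image[OF assms(1,4)]) auto
qed

lemma smooth_map_continuous: "smooth_map M N f \<Longrightarrow> continuous_map (mtop M) (mtop N) f"
  by (simp add: smooth_map_def)

lemma smooth_map_coord_rep:
  "smooth_map M N f \<Longrightarrow> c \<in> atlas M \<Longrightarrow> d \<in> atlas N \<Longrightarrow>
    smooth_on (snd c ` (fst c \<inter> f -` fst d)) (coord_rep c d f)"
  by (simp add: smooth_map_def)

lemma coord_rep_has_derivative:
  assumes "smooth_map M N f" "c \<in> atlas M" "d \<in> atlas N" "p \<in> fst c" "f p \<in> fst d"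
  shows "(coord_rep c d f has_derivative tangent_map c d f p) (at (snd c p))"
  unfolding tangent_map_def
  by (rule smooth_on_imp_has_derivative[OF smooth_map_coord_rep[OF assms(1-3)]]) (use assms in auto)

text \<open>Real functions get a notion of their own because the target of \<open>smooth_map\<close>
  has to be a manifold with an atlas.\<close>

definition smooth_fun :: "('p, 'n::finite, 'z) manifold_scheme \<Rightarrow> ('p \<Rightarrow> real) \<Rightarrow> bool"
  where "smooth_fun M u \<longleftrightarrow> (\<forall>c\<in>atlas M. smooth_on (snd c ` fst c) (\<lambda>x. u (chart_inv c x)))"

text \<open>The image of one chart domain under f may spread over several charts of N, so smoothness
  is checked locally, on the part that f maps into a single chart.\<close>

lemma smooth_fun_comp:
  assumes M: "smooth_manifold M" and N: "smooth_manifold N" and f: "smooth_map M N f" and u: "smooth_fun N u"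
  shows "smooth_fun M (\<lambda>p. u (f p))"
  unfolding smooth_fun_def
proof (intro ballI smooth_on_local)
  fix c x assume c: "c \<in> atlas M" and x: "x \<in> snd c ` fst c"
  have cont: "continuous_map (mtop M) (mtop N) f"
    using f by (simp add: smooth_map_def)
  have "chart_inv c x \<in> points M"
    using chart_chart_inv[OF x] chart_subset_points[OF M c] by blast
  then have "f (chart_inv c x) \<in> points N"
    using continuous_map_image_subset_topspace[OF cont] by blast
  then obtain d where d: "d \<in> atlas N" "f (chart_inv c x) \<in> fst d"
    using chart_at[OF N] by blast
  let ?W = "snd c ` (fst c \<inter> f -` fst d)"
  have W: "open ?W" by (rule open_chart_overlap[OF M N cont c d(1)])
  have inv: "chart_inv c y \<in> fst c \<inter> f -` fst d" if "y \<in> ?W" for y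
    using that by (auto simp: chart_inv_chart[OF M c])
  have "smooth_on ?W (\<lambda>x. u (chart_inv d (coord_rep c d f x)))"
    using u d(1) inv
    by (intro smooth_on_compose[OF W _ smooth_map_coord_rep[OF f c d(1)], of "snd d ` fst d" "\<lambda>x. u (chart_inv d x)"])
      (auto simp: smooth_fun_def coord_rep_def)
  then have "smooth_on ?W (\<lambda>x. u (f (chart_inv c x)))"
    by (rule smooth_on_cong[OF W, rotated]) (use inv in \<open>auto simp: coord_rep_def chart_inv_chart[OF N d(1)]\<close>)
  moreover have "x \<in> ?W"
    using chart_chart_inv[OF x] d(2) by (intro image_eqI[of _ _ "chart_inv c x"]) auto
  ultimately show "\<exists>W. open W \<and> x \<in> W \<and> smooth_on W (\<lambda>x. u (f (chart_inv c x)))"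
    using W by blast
qed

text \<open>The support is compact in the manifold, hence closed by the Hausdorff property. A point
  outside the chart therefore has a neighbourhood on which the extension is 0.\<close>

lemma smooth_fun_extend_by_0:
  assumes M: "smooth_manifold M" and c: "c \<in> atlas M" and \<phi>: "smooth_on UNIV \<phi>"
    and K: "compact K" "K \<subseteq> snd c ` fst c" "\<And>x. x \<notin> K \<Longrightarrow> \<phi> x = 0"
  shows "smooth_fun M (\<lambda>p. if p \<in> fst c then \<phi> (snd c p) else 0)" (is "smooth_fun M ?u")
  unfolding smooth_fun_def
proof (intro ballI smooth_on_local)
  fix d x assume d: "d \<in> atlas M" and x: "x \<in> snd d ` fst d"
  define p where "p = chart_inv d x"
  have p: "p \<in> fst d" "snd d p = x"
    using chart_chart_inv[OF x] by (auto simp: p_def)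
  have id: "smooth_map M M id" using M by (simp add: smooth_manifold_def)
  have "compactin (mtop M) (chart_inv c ` K)"
    using K by (intro image_compactin[OF _ continuous_map_chart_inv[OF M c]]) (simp add: compactin_subtopology)
  then have closed: "closedin (mtop M) (chart_inv c ` K)"
    using M by (auto simp: smooth_manifold_def intro: compactin_imp_closedin)
  show "\<exists>W. open W \<and> x \<in> W \<and> smooth_on W (\<lambda>x. ?u (chart_inv d x))"
  proof (cases "p \<in> fst c")
    case True
    let ?W = "snd d ` (fst d \<inter> id -` fst c)"
    have W: "open ?W"
      by (rule open_chart_overlap[OF M M smooth_map_continuous[OF id] d c])
    have "smooth_on ?W (\<lambda>x. \<phi> (coord_rep d c id x))"
      by (rule smooth_on_compose[OF W _ smooth_map_coord_rep[OF id d c] \<phi>]) auto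
    then have "smooth_on ?W (\<lambda>x. ?u (chart_inv d x))"
      by (rule smooth_on_cong[OF W, rotated]) (auto simp: coord_rep_def chart_inv_chart[OF M d])
    moreover have "x \<in> ?W" using p True by auto
    ultimately show ?thesis using W by blast
  next
    case False
    let ?W = "snd d ` (fst d \<inter> (points M - chart_inv c ` K))"
    have W: "open ?W"
      using closed smooth_manifold_chart(1)[OF M d] by (intro open_chart_image[OF M d]) auto
    have u0: "?u q = 0" if "q \<notin> chart_inv c ` K" for q
    proof (cases "q \<in> fst c")
      case True
      then have "snd c q \<notin> K" using that chart_inv_chart[OF M c True] by force
      then show ?thesis using K(3) by simp
    qed simp
    have "smooth_on ?W (\<lambda>x. ?u (chart_inv d x))"
    proof (rule smooth_on_cong[OF W _ smooth_on_const[of _ 0]])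
      fix y assume "y \<in> ?W"
      then have "chart_inv d y \<notin> chart_inv c ` K" by (auto simp: chart_inv_chart[OF M d])
      then show "0 = ?u (chart_inv d y)" by (rule u0[symmetric])
    qed
    moreover have "chart_inv c ` K \<subseteq> fst c"
      using K(2) chart_chart_inv(2)[of _ c] by auto
    then have "x \<in> ?W"
      using p False chart_subset_points[OF M d] by (intro image_eqI[of _ _ p]) auto
    ultimately show ?thesis using W by blast
  qed
qed

lemma smooth_fun_affine:
  assumes "smooth_manifold M" "smooth_fun M u"
  shows "smooth_fun M (\<lambda>p. a * (1 + b * u p))"
  using assms smooth_manifold_chart(2)[OF assms(1)] unfolding smooth_fun_def
  by (intro ballI smooth_on_mult smooth_on_add smooth_on_const) auto

section \<open>Conformal changes of the metric\<close>

text \<open>\<Omega> multiplies the metric tensor, so lengths scale by its square root and volumes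
  by the n-th power of that root, where n is the dimension. The time orientation is kept.\<close>

definition conformal :: "('p \<Rightarrow> real) \<Rightarrow> ('p, 'n::finite) spacetime \<Rightarrow> ('p, 'n) spacetime"
  where "conformal \<Omega> M = M\<lparr>metric := \<lambda>c p. \<Omega> p *\<^sub>R metric M c p\<rparr>"

lemma conformal_simps [simp]:
  "mtop (conformal \<Omega> M) = mtop M" "atlas (conformal \<Omega> M) = atlas M" "tdir (conformal \<Omega> M) = tdir M"
  "metric (conformal \<Omega> M) c p = \<Omega> p *\<^sub>R metric M c p"
  by (simp_all add: conformal_def)

lemma ginner_conformal [simp]: "ginner (conformal \<Omega> M) c p v w = \<Omega> p * ginner M c p v w"
  by (simp add: ginner_def flip: scaleR_matrix_vector_assoc)

text \<open>Carries statements about the changed spacetime back to the original one; here, the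
  existence of a volume measure.\<close>

lemma conformal_conformal_inverse:
  assumes "\<And>p. 0 < \<Omega> p"
  shows "conformal (\<lambda>p. 1 / \<Omega> p) (conformal \<Omega> M) = M"
proof -
  have "\<Omega> p \<noteq> 0" for p using assms[of p] by simp
  then show ?thesis by (simp add: conformal_def)
qed

lemma lorentz_matrix_scaleR:
  fixes G :: "real ^ 'n::finite ^ 'n"
  assumes "lorentz_matrix G" "0 < a"
  shows "lorentz_matrix (a *\<^sub>R G)"
proof -
  obtain P :: "real ^ 'n ^ 'n" and i0 where P: "invertible P"
    "transpose P ** G ** P = (\<chi> i j. if i = j then (if i = i0 then - 1 else 1) else 0)"
    using assms(1) by (auto simp: lorentz_matrix_def)
  \<comment> \<open>The frame P is rescaled by this factor, which enters the congruence twice and so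
    cancels \<open>a\<close>.\<close>
  let ?k = "1 / sqrt a"
  have "transpose (?k *\<^sub>R P) ** (a *\<^sub>R G) ** (?k *\<^sub>R P) = (?k * a * ?k) *\<^sub>R (transpose P ** G ** P)"
    by (simp add: transpose_scalar matrix_scalar_ac flip: scalar_matrix_assoc)
  moreover have "?k * a * ?k = 1" using assms(2) by (simp add: field_simps)
  moreover have "invertible (?k *\<^sub>R P)"
    using P(1) assms(2) by (intro scalar_invertible) auto
  ultimately show ?thesis
    unfolding lorentz_matrix_def using P(2) by (intro exI[of _ "?k *\<^sub>R P"] exI[of _ i0]) simp
qed

lemma pw_curve_conformal: "pw_curve (conformal \<Omega> M) = pw_curve M"
  by (simp add: fun_eq_iff pw_curve_def C1_arc_def)

lemma curve_from_to_conformal: "curve_from_to (conformal \<Omega> M) = curve_from_to M"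
  by (simp add: fun_eq_iff curve_from_to_def pw_curve_conformal)

context
  fixes \<Omega> :: "'p \<Rightarrow> real"
  assumes pos: "\<And>p. 0 < \<Omega> p"
begin

lemma sign_mult: "\<Omega> p * x \<le> 0 \<longleftrightarrow> x \<le> 0" "\<Omega> p * x < 0 \<longleftrightarrow> x < 0" "0 < \<Omega> p * x \<longleftrightarrow> 0 < x"
  using pos[of p] by (simp_all add: mult_le_0_iff mult_less_0_iff zero_less_mult_iff)

lemma future_causal_conformal: "future_causal (conformal \<Omega> M) = future_causal M"
  by (simp add: fun_eq_iff future_causal_def sign_mult)

lemma future_timelike_conformal: "future_timelike (conformal \<Omega> M) = future_timelike M"
  by (simp add: fun_eq_iff future_timelike_def sign_mult)

lemma causal_le_conformal: "causal_le (conformal \<Omega> M) = causal_le M"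
  by (simp add: fun_eq_iff causal_le_def future_causal_conformal curve_from_to_conformal)

lemma chron_less_conformal: "chron_less (conformal \<Omega> M) = chron_less M"
  by (simp add: fun_eq_iff chron_less_def future_timelike_conformal curve_from_to_conformal)

lemma I_conformal: "I_plus (conformal \<Omega> M) = I_plus M" "I_minus (conformal \<Omega> M) = I_minus M"
  by (simp_all add: fun_eq_iff I_plus_def I_minus_def chron_less_conformal)

lemma J_conformal: "J_plus (conformal \<Omega> M) = J_plus M" "J_minus (conformal \<Omega> M) = J_minus M"
  by (simp_all add: fun_eq_iff J_plus_def J_minus_def causal_le_conformal)

lemma cauchy_hypersurface_conformal: "cauchy_hypersurface (conformal \<Omega> M) = cauchy_hypersurface M"
  by (simp add: fun_eq_iff cauchy_hypersurface_def inextendible_def pw_curve_conformal future_timelike_conformal)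

lemma spacelike_hypersurface_conformal: "spacelike_hypersurface (conformal \<Omega> M) = spacelike_hypersurface M"
  by (simp add: fun_eq_iff spacelike_hypersurface_def sign_mult)

lemma spacetime_conformal:
  assumes "spacetime M" "smooth_fun M \<Omega>"
  shows "spacetime (conformal \<Omega> M)"
proof -
  have M: "smooth_manifold M" using assms by (simp add: spacetime_def)
  have sm: "smooth_manifold (conformal \<Omega> M)"
    using M by (simp add: smooth_manifold_def smooth_map_def)
  have "smooth_on (snd c ` fst c) (\<lambda>x. \<Omega> (chart_inv c x) * metric M c (chart_inv c x) $ i $ j)"
    if "c \<in> atlas M" for c i j
    using assms that by (intro smooth_on_mult smooth_manifold_chart(2)[OF M]) (auto simp: spacetime_def smooth_fun_def)
  then show ?thesis
    using assms(1) sm pos unfolding spacetime_def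
    by (simp add: lorentz_matrix_scaleR preserves_metric_def sign_mult)
qed

lemma globally_hyperbolic_conformal:
  assumes "globally_hyperbolic M" "smooth_fun M \<Omega>"
  shows "globally_hyperbolic (conformal \<Omega> M)"
  using assms spacetime_conformal[of M]
  by (simp add: globally_hyperbolic_def strongly_causal_def J_conformal curve_from_to_conformal future_causal_conformal)

end

lemma isometric_embedding_conformal:
  assumes "isometric_embedding M N f" "\<And>p. 0 < \<Omega> p"
  shows "isometric_embedding (conformal (\<lambda>p. \<Omega> (f p)) M) (conformal \<Omega> N) f"
  using assms by (simp add: isometric_embedding_def smooth_map_def preserves_metric_def future_timelike_conformal)

text \<open>The factor has to be a function on N: the new slab must again lie in a globally
  hyperbolic spacetime with the same hypersurfaces, so the metric of N changes too, and f remains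
  isometric when X carries the pulled-back factor.\<close>

lemma is_slab_in_conformal:
  assumes "is_slab_in X N f Sm Sp" "smooth_fun N \<Omega>" "\<And>p. 0 < \<Omega> p"
  shows "is_slab_in (conformal (\<lambda>p. \<Omega> (f p)) X) (conformal \<Omega> N) f Sm Sp"
proof -
  have "smooth_fun X (\<lambda>p. \<Omega> (f p))"
    using assms by (intro smooth_fun_comp[of X N])
      (auto simp: is_slab_in_def spacetime_def globally_hyperbolic_def isometric_embedding_def)
  then show ?thesis
    using assms unfolding is_slab_in_def
    by (simp add: spacetime_conformal globally_hyperbolic_conformal isometric_embedding_conformal
        I_conformal cauchy_hypersurface_conformal spacelike_hypersurface_conformal)
qed

section \<open>Volume and order measures\<close>

lemma is_volume_measureD:
  assumes "is_volume_measure M \<mu>"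
  shows "space \<mu> = points M" "sets \<mu> = sigma_sets (points M) (Collect (openin (mtop M)))"
    "\<And>c A. c \<in> atlas M \<Longrightarrow> A \<in> sets \<mu> \<Longrightarrow> A \<subseteq> fst c \<Longrightarrow> emeasure \<mu> A =
      (\<integral>\<^sup>+x\<in>snd c ` A. ennreal (sqrt \<bar>det (metric M c (chart_inv c x))\<bar>) \<partial>lborel)"
  using assms by (auto simp: is_volume_measure_def)

lemma openin_sets_volume:
  assumes "is_volume_measure M \<mu>" "openin (mtop M) A"
  shows "A \<in> sets \<mu>"
  unfolding is_volume_measureD(2)[OF assms(1)] using assms(2) by (intro sigma_sets.Basic) simp

lemma closedin_sets_volume:
  assumes "is_volume_measure M \<mu>" "closedin (mtop M) A"
  shows "A \<in> sets \<mu>"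
proof -
  have "points M - (points M - A) = A"
    using closedin_subset[OF assms(2)] by blast
  moreover have "space \<mu> - (points M - A) \<in> sets \<mu>"
    using assms by (intro sets.compl_sets openin_sets_volume[OF assms(1)]) auto
  ultimately show ?thesis
    using is_volume_measureD(1)[OF assms(1)] by simp
qed

lemma continuous_map_borel_volume:
  fixes u :: "'p \<Rightarrow> real"
  assumes "is_volume_measure M \<mu>" "continuous_map (mtop M) euclidean u"
  shows "u \<in> borel_measurable \<mu>"
proof (rule borel_measurableI)
  fix S :: "real set" assume "open S"
  then have "openin (mtop M) {p \<in> points M. u p \<in> S}"
    using openin_continuous_map_preimage[OF assms(2)] by simp
  then show "u -` S \<inter> space \<mu> \<in> sets \<mu>"
    using openin_sets_volume[OF assms(1)] is_volume_measureD(1)[OF assms(1)]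
    by (simp add: vimage_def Int_def conj_commute)
qed

text \<open>The two measures agree on every measurable set inside one chart domain. By the Lindelof
  property countably many chart domains suffice; making them disjoint splits any measurable set into
  pieces on which the measures agree.\<close>

lemma volume_measure_unique:
  assumes M: "smooth_manifold M" and ne: "points M \<noteq> {}"
    and \<mu>: "is_volume_measure M \<mu>" and \<nu>: "is_volume_measure M \<nu>"
  shows "\<mu> = \<nu>"
proof (rule measure_eqI)
  show sets: "sets \<mu> = sets \<nu>"
    using is_volume_measureD(2)[OF \<mu>] is_volume_measureD(2)[OF \<nu>] by simp
  have "Lindelof_space (mtop M)"
    using M by (auto simp: smooth_manifold_def intro: second_countable_imp_Lindelof_space)
  moreover have "(\<Union>(fst ` atlas M)) = points M"
    using M unfolding smooth_manifold_def by (auto simp: case_prod_beta)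
  moreover have "openin (mtop M) U" if "U \<in> fst ` atlas M" for U
    using that smooth_manifold_chart(1)[OF M] by auto
  ultimately obtain \<V> where \<V>: "countable \<V>" "\<V> \<subseteq> fst ` atlas M" "\<Union>\<V> = points M"
    using Lindelof_spaceD by meson
  have ne': "\<V> \<noteq> {}" using \<V>(3) ne by blast
  define U where "U = from_nat_into \<V>"
  have rU: "range U = \<V>" unfolding U_def using range_from_nat_into[OF ne' \<V>(1)] .
  fix A assume A: "A \<in> sets \<mu>"
  let ?D = "disjointed (\<lambda>i. A \<inter> U i)"
  have U: "U i \<in> sets \<mu>" "\<exists>c\<in>atlas M. U i = fst c" for i
  proof -
    have "U i \<in> fst ` atlas M" using rU \<V>(2) by auto
    then show "\<exists>c\<in>atlas M. U i = fst c" by auto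
    then show "U i \<in> sets \<mu>"
      using openin_sets_volume[OF \<mu>] smooth_manifold_chart(1)[OF M] by auto
  qed
  have D: "?D i \<in> sets \<mu>" for i
    using sets.range_disjointed_sets[of "\<lambda>i. A \<inter> U i" \<mu>] A U by auto
  have "A \<subseteq> points M" using A sets.sets_into_space is_volume_measureD(1)[OF \<mu>] by metis
  then have un: "(\<Union>i. ?D i) = A"
    using rU \<V>(3) by (auto simp: UN_disjointed_eq)
  have "emeasure \<mu> (?D i) = emeasure \<nu> (?D i)" for i
  proof -
    obtain c where c: "c \<in> atlas M" "U i = fst c" using U(2) by blast
    have "?D i \<subseteq> fst c" using c(2) by (auto simp: disjointed_def)
    then show ?thesis
      using is_volume_measureD(3)[OF \<mu> c(1) D] is_volume_measureD(3)[OF \<nu> c(1)] D sets by simp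
  qed
  then have "(\<Sum>i. emeasure \<mu> (?D i)) = (\<Sum>i. emeasure \<nu> (?D i))" by simp
  moreover have "(\<Sum>i. emeasure \<mu> (?D i)) = emeasure \<mu> (\<Union>i. ?D i)"
    using D by (intro suminf_emeasure) (auto simp: disjoint_family_disjointed)
  moreover have "(\<Sum>i. emeasure \<nu> (?D i)) = emeasure \<nu> (\<Union>i. ?D i)"
    using D sets by (intro suminf_emeasure) (auto simp: disjoint_family_disjointed)
  ultimately show "emeasure \<mu> A = emeasure \<nu> A"
    using un by simp
qed

lemma volume_measure_eq:
  assumes "smooth_manifold M" "points M \<noteq> {}" "is_volume_measure M \<mu>"
  shows "volume_measure M = \<mu>"
  unfolding volume_measure_def
  using assms volume_measure_unique by (intro the_equality) blast+

lemma continuous_on_det: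
  fixes A :: "'a::topological_space \<Rightarrow> real ^ 'n::finite ^ 'n"
  assumes "\<And>i j. continuous_on S (\<lambda>x. A x $ i $ j)"
  shows "continuous_on S (\<lambda>x. det (A x))"
  unfolding det_def by (intro continuous_intros assms)

lemma det_scaleR:
  fixes A :: "real ^ 'n::finite ^ 'n"
  shows "det (k *\<^sub>R A) = k ^ CARD('n) * det A"
  by (simp add: det_def prod.distrib sum_distrib_left mult_ac)

text \<open>The defining property of a volume measure speaks of sets only; the density of a
  conformal metric requires integrals of functions.\<close>

lemma nn_integral_volume_chart:
  fixes M :: "('p, 'n::finite) spacetime"
  assumes M: "spacetime M" and \<mu>: "is_volume_measure M \<mu>" and c: "c \<in> atlas M"
    and A: "A \<in> sets \<mu>" "A \<subseteq> fst c" and u: "u \<in> borel_measurable \<mu>"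
  shows "(\<integral>\<^sup>+p\<in>A. u p \<partial>\<mu>) =
    (\<integral>\<^sup>+x\<in>snd c ` A. u (chart_inv c x) * ennreal (sqrt \<bar>det (metric M c (chart_inv c x))\<bar>) \<partial>lborel)"
proof -
  have sm: "smooth_manifold M" using M by (simp add: spacetime_def)
  define V where "V = snd c ` fst c"
  define \<rho> where "\<rho> = (\<lambda>x. ennreal (sqrt \<bar>det (metric M c (chart_inv c x))\<bar>))"
  define R where "R = restrict_space lborel V"
  have V: "open V" unfolding V_def by (rule smooth_manifold_chart(2)[OF sm c])
  have Us: "fst c \<in> sets \<mu>" by (rule openin_sets_volume[OF \<mu> smooth_manifold_chart(1)[OF sm c]])
  have sp: "space \<mu> = points M" by (rule is_volume_measureD(1)[OF \<mu>])
  have Usp: "fst c \<inter> space \<mu> = fst c" using sp chart_subset_points[OF sm c] by auto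
  have Vl: "V \<inter> space lborel \<in> sets lborel" using V by simp
  have spR: "space R = V" by (simp add: R_def space_restrict_space)
  have inv: "chart_inv c x \<in> fst c" if "x \<in> V" for x
    using that unfolding V_def by (rule chart_chart_inv(2))
  have "continuous_on V (\<lambda>x. metric M c (chart_inv c x) $ i $ j)" for i j
    using M c unfolding spacetime_def V_def by (intro smooth_on_imp_continuous_on) blast
  then have "continuous_on V (\<lambda>x. sqrt \<bar>det (metric M c (chart_inv c x))\<bar>)"
    by (intro continuous_on_real_sqrt continuous_on_rabs continuous_on_det)
  then have "(\<lambda>x. sqrt \<bar>det (metric M c (chart_inv c x))\<bar>) \<in> borel_measurable (restrict_space borel V)"
    by (rule borel_measurable_continuous_on_restrict)
  moreover have "sets R = sets (restrict_space borel V)"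
    unfolding R_def by (rule sets_restrict_space_cong) simp
  ultimately have \<rho>: "\<rho> \<in> borel_measurable R"
    unfolding \<rho>_def by (intro measurable_compose[OF _ measurable_ennreal]) (simp cong: measurable_cong_sets)
  have ci: "chart_inv c \<in> measurable R \<mu>"
  proof (rule measurable_sigma_sets[OF is_volume_measureD(2)[OF \<mu>]])
    show "Collect (openin (mtop M)) \<subseteq> Pow (points M)" using openin_subset by auto
    show "chart_inv c \<in> space R \<rightarrow> points M"
      using spR inv chart_subset_points[OF sm c] by auto
    fix W assume "W \<in> Collect (openin (mtop M))"
    then have "openin (mtop M) (W \<inter> fst c)"
      using smooth_manifold_chart(1)[OF sm c] by auto
    then have "open (snd c ` (W \<inter> fst c))" by (rule open_chart_image[OF sm c]) auto
    moreover have "chart_inv c -` W \<inter> space R = snd c ` (W \<inter> fst c)"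
      unfolding spR V_def by (auto simp: chart_inv_chart[OF sm c])
    ultimately show "chart_inv c -` W \<inter> space R \<in> sets R"
      unfolding R_def using V by (auto simp: sets_restrict_space_iff V_def)
  qed
  have ciU: "chart_inv c \<in> measurable (density R \<rho>) (restrict_space \<mu> (fst c))"
    using ci inv spR by (intro measurable_restrict_space2) auto
  have pre: "chart_inv c -` B \<inter> V = snd c ` B" if "B \<subseteq> fst c" for B
    using that unfolding V_def by (auto simp: chart_inv_chart[OF sm c] subset_iff)
  \<comment> \<open>On a chart domain the volume measure is the image, under the inverse chart, of
    Lebesgue measure with density \<rho>. Integrals then follow from the rules for
    \<open>distr\<close> and \<open>density\<close>.\<close>
  have eq: "distr (density R \<rho>) (restrict_space \<mu> (fst c)) (chart_inv c) = restrict_space \<mu> (fst c)"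
  proof (rule measure_eqI)
    fix B assume "B \<in> sets (distr (density R \<rho>) (restrict_space \<mu> (fst c)) (chart_inv c))"
    then have B': "B \<in> sets (restrict_space \<mu> (fst c))" by simp
    then have B: "B \<in> sets \<mu>" "B \<subseteq> fst c"
      using Us Usp by (auto simp: sets_restrict_space_iff)
    have "chart_inv c -` B \<inter> space R \<in> sets R"
      using measurable_sets[OF ci B(1)] .
    then have pB: "snd c ` B \<in> sets R" using pre[OF B(2)] spR by simp
    have sub: "snd c ` B \<subseteq> V" using B(2) by (auto simp: V_def)
    have "emeasure (distr (density R \<rho>) (restrict_space \<mu> (fst c)) (chart_inv c)) B
        = emeasure (density R \<rho>) (snd c ` B)"
      using emeasure_distr[OF ciU B'] pre[OF B(2)] spR by simp
    also have "\<dots> = (\<integral>\<^sup>+x. \<rho> x * indicator (snd c ` B) x \<partial>R)"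
      by (rule emeasure_density[OF \<rho> pB])
    also have "\<dots> = (\<integral>\<^sup>+x. \<rho> x * indicator (snd c ` B) x * indicator V x \<partial>lborel)"
      unfolding R_def by (rule nn_integral_restrict_space[OF Vl])
    also have "\<dots> = (\<integral>\<^sup>+x\<in>snd c ` B. \<rho> x \<partial>lborel)"
      by (intro nn_integral_cong) (use sub in \<open>auto simp: indicator_def\<close>)
    also have "\<dots> = emeasure \<mu> B"
      unfolding \<rho>_def using is_volume_measureD(3)[OF \<mu> c B] by simp
    also have "\<dots> = emeasure (restrict_space \<mu> (fst c)) B"
      using B Us Usp by (simp add: emeasure_restrict_space)
    finally show "emeasure (distr (density R \<rho>) (restrict_space \<mu> (fst c)) (chart_inv c)) B
        = emeasure (restrict_space \<mu> (fst c)) B" .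
  qed simp
  let ?uA = "\<lambda>p. u p * indicator A p"
  have uA: "?uA \<in> borel_measurable \<mu>" using u A(1) by simp
  have uAU: "?uA \<in> borel_measurable (restrict_space \<mu> (fst c))"
    using uA by (rule measurable_restrict_space1)
  have uci: "(\<lambda>x. ?uA (chart_inv c x)) \<in> borel_measurable R"
    by (rule measurable_compose[OF ci uA])
  have "(\<integral>\<^sup>+p\<in>A. u p \<partial>\<mu>) = (\<integral>\<^sup>+p. ?uA p * indicator (fst c) p \<partial>\<mu>)"
    by (intro nn_integral_cong) (use A(2) in \<open>auto simp: indicator_def\<close>)
  also have "\<dots> = (\<integral>\<^sup>+p. ?uA p \<partial>restrict_space \<mu> (fst c))"
    by (rule nn_integral_restrict_space[symmetric]) (simp add: Usp Us)
  also have "\<dots> = (\<integral>\<^sup>+x. ?uA (chart_inv c x) \<partial>density R \<rho>)"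
    by (subst eq[symmetric], rule nn_integral_distr[OF ciU]) (use uAU in simp)
  also have "\<dots> = (\<integral>\<^sup>+x. \<rho> x * ?uA (chart_inv c x) \<partial>R)"
    by (rule nn_integral_density[OF \<rho> uci])
  also have "\<dots> = (\<integral>\<^sup>+x. \<rho> x * ?uA (chart_inv c x) * indicator V x \<partial>lborel)"
    unfolding R_def by (rule nn_integral_restrict_space[OF Vl])
  also have "\<dots> = (\<integral>\<^sup>+x\<in>snd c ` A. u (chart_inv c x) * \<rho> x \<partial>lborel)"
  proof (intro nn_integral_cong)
    fix x
    have "x \<in> snd c ` A \<longleftrightarrow> x \<in> V \<and> chart_inv c x \<in> A"
      using pre[OF A(2)] by blast
    then show "\<rho> x * ?uA (chart_inv c x) * indicator V x = u (chart_inv c x) * \<rho> x * indicator (snd c ` A) x"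
      by (auto simp: indicator_def mult.commute)
  qed
  finally show ?thesis by (simp add: \<rho>_def)
qed

text \<open>The determinant of the Gram matrix is homogeneous of degree n, so its square root gains
  the factor \<open>sqrt (\<Omega> p) ^ CARD('n)\<close>.\<close>

lemma is_volume_measure_conformal:
  fixes M :: "('p, 'n::finite) spacetime"
  assumes M: "spacetime M" and \<mu>: "is_volume_measure M \<mu>"
    and \<Omega>: "\<Omega> \<in> borel_measurable \<mu>" "\<And>p. 0 < \<Omega> p"
  shows "is_volume_measure (conformal \<Omega> M) (density \<mu> (\<lambda>p. ennreal (sqrt (\<Omega> p) ^ CARD('n))))"
  unfolding is_volume_measure_def
proof (intro conjI ballI impI)
  fix c A assume c: "c \<in> atlas (conformal \<Omega> M)"
    and A: "A \<in> sets (density \<mu> (\<lambda>p. ennreal (sqrt (\<Omega> p) ^ CARD('n))))" "A \<subseteq> fst c"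
  have w: "(\<lambda>p. ennreal (sqrt (\<Omega> p) ^ CARD('n))) \<in> borel_measurable \<mu>"
    using \<Omega>(1) by measurable
  have "emeasure (density \<mu> (\<lambda>p. ennreal (sqrt (\<Omega> p) ^ CARD('n)))) A
      = (\<integral>\<^sup>+p\<in>A. ennreal (sqrt (\<Omega> p) ^ CARD('n)) \<partial>\<mu>)"
    using A(1) by (intro emeasure_density[OF w]) simp
  also have "\<dots> = (\<integral>\<^sup>+x\<in>snd c ` A. ennreal (sqrt (\<Omega> (chart_inv c x)) ^ CARD('n)) *
      ennreal (sqrt \<bar>det (metric M c (chart_inv c x))\<bar>) \<partial>lborel)"
    using A c by (intro nn_integral_volume_chart[OF M \<mu> _ _ _ w]) auto
  also have "\<dots> = (\<integral>\<^sup>+x\<in>snd c ` A. ennreal (sqrt \<bar>det (metric (conformal \<Omega> M) c (chart_inv c x))\<bar>) \<partial>lborel)"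
  proof (intro nn_integral_cong arg_cong2[where f = times] refl)
    fix x
    have "0 \<le> \<Omega> (chart_inv c x)" using \<Omega>(2) less_imp_le by blast
    then show "ennreal (sqrt (\<Omega> (chart_inv c x)) ^ CARD('n)) * ennreal (sqrt \<bar>det (metric M c (chart_inv c x))\<bar>)
      = ennreal (sqrt \<bar>det (metric (conformal \<Omega> M) c (chart_inv c x))\<bar>)"
      by (simp add: det_scaleR abs_mult real_sqrt_mult real_sqrt_power flip: ennreal_mult)
  qed
  finally show "emeasure (density \<mu> (\<lambda>p. ennreal (sqrt (\<Omega> p) ^ CARD('n)))) A =
    (\<integral>\<^sup>+x\<in>snd c ` A. ennreal (sqrt \<bar>det (metric (conformal \<Omega> M) c (chart_inv c x))\<bar>) \<partial>lborel)" .
qed (use is_volume_measureD[OF \<mu>] in auto)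

section \<open>Product measures with densities and the total variation of order measures\<close>

text \<open>A product measure is determined by its values on boxes, and there the integral of the
  product density factors.\<close>

lemma PiM_density:
  assumes "finite I" "prob_space M" "w \<in> borel_measurable M" "prob_space (density M w)"
  shows "PiM I (\<lambda>_. density M w) = density (PiM I (\<lambda>_. M)) (\<lambda>a. \<Prod>i\<in>I. w (a i :: 'a) :: ennreal)"
proof -
  interpret M: product_prob_space "\<lambda>_. M" I
    using assms(2) by (rule product_prob_spaceI)
  interpret D: product_prob_space "\<lambda>_. density M w" I
    using assms(4) by (rule product_prob_spaceI)
  have W: "(\<lambda>a. \<Prod>i\<in>I. w (a i)) \<in> borel_measurable (PiM I (\<lambda>_. M))"
    using assms(3) by (intro borel_measurable_prod_ennreal measurable_compose[OF measurable_component_singleton])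
  have "density (PiM I (\<lambda>_. M)) (\<lambda>a. \<Prod>i\<in>I. w (a i)) = PiM I (\<lambda>_. density M w)"
  proof (rule D.PiM_eqI[OF assms(1)])
    show "sets (density (PiM I (\<lambda>_. M)) (\<lambda>a. \<Prod>i\<in>I. w (a i))) = sets (PiM I (\<lambda>_. density M w))"
      by (simp, rule sets_PiM_cong) auto
    fix A assume "\<And>i. i \<in> I \<Longrightarrow> A i \<in> sets (density M w)"
    then have A: "A i \<in> sets M" if "i \<in> I" for i using that by simp
    have "emeasure (density (PiM I (\<lambda>_. M)) (\<lambda>a. \<Prod>i\<in>I. w (a i))) (Pi\<^sub>E I A)
        = (\<integral>\<^sup>+a. (\<Prod>i\<in>I. w (a i)) * indicator (Pi\<^sub>E I A) a \<partial>PiM I (\<lambda>_. M))"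
      using A assms(1) by (intro emeasure_density[OF W] sets_PiM_I_finite) auto
    also have "\<dots> = (\<integral>\<^sup>+a. (\<Prod>i\<in>I. w (a i) * indicator (A i) (a i)) \<partial>PiM I (\<lambda>_. M))"
    proof (intro nn_integral_cong)
      fix a assume "a \<in> space (PiM I (\<lambda>_. M))"
      then have "a \<in> Pi\<^sub>E I A \<longleftrightarrow> (\<forall>i\<in>I. a i \<in> A i)" by (auto simp: space_PiM PiE_iff)
      then have "(indicator (Pi\<^sub>E I A) a :: ennreal) = (\<Prod>i\<in>I. indicator (A i) (a i))"
        using assms(1) by (auto simp: indicator_def)
      then show "(\<Prod>i\<in>I. w (a i)) * indicator (Pi\<^sub>E I A) a = (\<Prod>i\<in>I. w (a i) * indicator (A i) (a i))"
        by (simp add: prod.distrib)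
    qed
    also have "\<dots> = (\<Prod>i\<in>I. \<integral>\<^sup>+x. w x * indicator (A i) x \<partial>M)"
      using A assms(3) by (intro M.product_nn_integral_prod[OF assms(1)]) auto
    also have "\<dots> = (\<Prod>i\<in>I. emeasure (density M w) (A i))"
      using A assms(3) by (intro prod.cong refl emeasure_density[symmetric]) auto
    finally show "emeasure (density (PiM I (\<lambda>_. M)) (\<lambda>a. \<Prod>i\<in>I. w (a i))) (Pi\<^sub>E I A)
      = (\<Prod>i\<in>I. emeasure (density M w) (A i))" .
  qed
  then show ?thesis by simp
qed

text \<open>The one-sided comparison is applied to E and to its complement; because both measures
  have total mass 1, the second application bounds Q from above.\<close>

lemma prob_diff_le:
  assumes P: "prob_space P" and Q: "prob_space Q" and sets: "sets Q = sets P"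
    and le: "\<And>E. E \<in> sets P \<Longrightarrow> c * measure P E \<le> measure Q E" and E: "E \<in> sets P" and c: "c \<le> 1"
  shows "\<bar>measure P E - measure Q E\<bar> \<le> 1 - c"
proof -
  interpret P: prob_space P by fact
  interpret Q: prob_space Q by fact
  have 1: "c * P.prob E \<le> Q.prob E" by (rule le[OF E])
  have sp: "space Q = space P" using sets by (rule sets_eq_imp_space_eq)
  have "c * P.prob (space P - E) \<le> Q.prob (space P - E)"
    using E by (intro le) auto
  then have 2: "c * (1 - P.prob E) \<le> 1 - Q.prob E"
    using P.prob_compl[OF E] Q.prob_compl[of E] E sets sp by simp
  have "(1 - c) * P.prob E \<le> (1 - c) * 1" "(1 - c) * (1 - P.prob E) \<le> (1 - c) * 1"
    using c by (intro mult_left_mono; simp)+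
  then show ?thesis using 1 2 by (simp add: algebra_simps abs_le_iff)
qed

lemma measure_PiM_density_ge:
  assumes fin: "finite I" and M: "prob_space M" and w: "w \<in> borel_measurable M"
    and D: "prob_space (density M w)" and c: "0 \<le> c" "\<And>x. ennreal c \<le> w x"
    and E: "E \<in> sets (PiM I (\<lambda>_. M))"
  shows "c ^ card I * measure (PiM I (\<lambda>_. M)) E \<le> measure (PiM I (\<lambda>_. density M w)) E"
proof -
  interpret P: prob_space "PiM I (\<lambda>_. M)" using M by (intro prob_space_PiM)
  interpret Q: prob_space "PiM I (\<lambda>_. density M w)" using D by (intro prob_space_PiM)
  have W: "(\<lambda>a. \<Prod>i\<in>I. w (a i)) \<in> borel_measurable (PiM I (\<lambda>_. M))"
    using w by (intro borel_measurable_prod_ennreal measurable_compose[OF measurable_component_singleton])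
  have "ennreal (c ^ card I * measure (PiM I (\<lambda>_. M)) E) = ennreal c ^ card I * emeasure (PiM I (\<lambda>_. M)) E"
    using c(1) by (simp add: ennreal_mult ennreal_power P.emeasure_eq_measure)
  also have "\<dots> = (\<integral>\<^sup>+a. ennreal c ^ card I * indicator E a \<partial>PiM I (\<lambda>_. M))"
    using E by (simp add: nn_integral_cmult_indicator)
  also have "\<dots> \<le> (\<integral>\<^sup>+a. (\<Prod>i\<in>I. w (a i)) * indicator E a \<partial>PiM I (\<lambda>_. M))"
  proof (intro nn_integral_mono mult_right_mono)
    fix a
    have "(\<Prod>i\<in>I. ennreal c) \<le> (\<Prod>i\<in>I. w (a i))"
      using c(2) by (intro prod_mono_ennreal)
    then show "ennreal c ^ card I \<le> (\<Prod>i\<in>I. w (a i))" by simp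
  qed simp
  also have "\<dots> = emeasure (PiM I (\<lambda>_. density M w)) E"
    unfolding PiM_density[OF fin M w D] by (rule emeasure_density[OF W E, symmetric])
  finally show ?thesis
    by (simp add: Q.emeasure_eq_measure)
qed

text \<open>The causal relation is not known to be measurable here, so some of the sets of points with
  a given pattern may fail to be measurable, in which case \<open>emeasure\<close> returns \<open>0\<close>; they are dropped from the union.\<close>

lemma measure_pattern_eq:
  fixes pat :: "'a \<Rightarrow> 'b"
  assumes "finite Q" "A \<subseteq> Q" "prob_space P"
  shows "measure (point_measure Q (\<lambda>q. emeasure P {a \<in> space P. pat a = q})) A =
    measure P (\<Union>q\<in>{q\<in>A. {a \<in> space P. pat a = q} \<in> sets P}. {a \<in> space P. pat a = q})"
proof -
  let ?E = "\<lambda>q. {a \<in> space P. pat a = q}"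
  have fin: "finite A" using assms finite_subset by blast
  have "emeasure (point_measure Q (\<lambda>q. emeasure P (?E q))) A = (\<Sum>q\<in>A. emeasure P (?E q))"
    by (rule emeasure_point_measure_finite[OF assms(1,2)])
  also have "\<dots> = (\<Sum>q\<in>{q\<in>A. ?E q \<in> sets P}. emeasure P (?E q))"
    using fin by (intro sum.mono_neutral_right) (auto simp: emeasure_notin_sets)
  also have "\<dots> = emeasure P (\<Union>q\<in>{q\<in>A. ?E q \<in> sets P}. ?E q)"
    using fin by (intro sum_emeasure) (auto simp: disjoint_family_on_def)
  finally show ?thesis by (simp add: measure_def)
qed

text \<open>With equal causal relations and equal sigma-algebras, a set of patterns corresponds to
  one and the same event for X and for Y, and the same events are discarded as nonmeasurable. Thus
  only the difference of the two product measures on one event has to be estimated.\<close>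

lemma total_variation_order_measure_le:
  fixes X Y :: "('p, 'n::finite) spacetime"
  assumes pX: "prob_space (volume_measure X)" and w: "w \<in> borel_measurable (volume_measure X)"
    and Y: "volume_measure Y = density (volume_measure X) w" and pY: "prob_space (volume_measure Y)"
    and c: "0 \<le> c" "c \<le> 1" "\<And>x. ennreal c \<le> w x" and le: "causal_le Y = causal_le X"
  shows "total_variation (order_measure K X) (order_measure K Y) \<le> 1 - c ^ K"
proof -
  let ?PX = "PiM {1..K} (\<lambda>_. volume_measure X)" and ?PY = "PiM {1..K} (\<lambda>_. volume_measure Y)"
  let ?Q = "Pow ({1..K} \<times> {1..K})"
  have pPX: "prob_space ?PX" and pPY: "prob_space ?PY"
    using pX pY by (auto intro: prob_space_PiM)
  have sets: "sets ?PY = sets ?PX"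
    by (intro sets_PiM_cong) (auto simp: Y)
  then have sp: "space ?PY = space ?PX" by (rule sets_eq_imp_space_eq)
  have pat: "order_pattern K Y = order_pattern K X"
    by (simp add: fun_eq_iff order_pattern_def le)
  have diff: "\<bar>measure ?PX E - measure ?PY E\<bar> \<le> 1 - c ^ K" if "E \<in> sets ?PX" for E
  proof (rule prob_diff_le[OF pPX pPY sets _ that])
    show "c ^ K * measure ?PX E \<le> measure ?PY E" if "E \<in> sets ?PX" for E
      using measure_PiM_density_ge[OF _ pX w _ c(1,3) that] pY by (simp add: Y)
    show "c ^ K \<le> 1" using c by (simp add: power_le_one)
  qed
  have *: "\<bar>measure (order_measure K X) A - measure (order_measure K Y) A\<bar> \<le> 1 - c ^ K"
    if "A \<in> sets (order_measure K X)" for A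
  proof -
    have A: "A \<subseteq> ?Q" using that by (simp add: order_measure_def Let_def sets_point_measure)
    have fin: "finite ?Q" by simp
    let ?E = "\<Union>q\<in>{q\<in>A. {a \<in> space ?PX. order_pattern K X a = q} \<in> sets ?PX}. {a \<in> space ?PX. order_pattern K X a = q}"
    have "measure (order_measure K X) A = measure ?PX ?E"
      unfolding order_measure_def Let_def by (rule measure_pattern_eq[OF fin A pPX])
    moreover have "measure (order_measure K Y) A = measure ?PY ?E"
      unfolding order_measure_def Let_def measure_pattern_eq[OF fin A pPY] by (simp only: sp sets pat)
    moreover have "?E \<in> sets ?PX"
      using finite_subset[OF A fin] by (intro sets.finite_UN) auto
    ultimately show ?thesis using diff by simp
  qed
  have "{} \<in> sets (order_measure K X)" by simp
  then show ?thesis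
    unfolding total_variation_def by (intro cSUP_least) (use * in auto)
qed

section \<open>Local isometries and causal curves\<close>

lemma ginner_zero_left: "ginner M c p 0 w = 0"
  by (simp add: ginner_def)

text \<open>\<tau> and \<pi> are the time and space parts of a vector in an orthonormal frame, the
  columns of P. The last property is reflection in time. Sign questions about the Lorentzian product
  reduce in this form to the Cauchy-Schwarz inequality.\<close>

lemma lorentz_matrix_splitting:
  fixes G :: "real ^ 'n::finite ^ 'n"
  assumes "lorentz_matrix G"
  obtains \<tau> :: "real ^ 'n \<Rightarrow> real" and \<pi> :: "real ^ 'n \<Rightarrow> real ^ 'n" where
    "\<And>v w. v \<bullet> (G *v w) = - (\<tau> v * \<tau> w) + \<pi> v \<bullet> \<pi> w"
    "\<And>v. \<tau> v = 0 \<Longrightarrow> \<pi> v = 0 \<Longrightarrow> v = 0"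
    "\<And>v. \<exists>w. \<tau> w = - \<tau> v \<and> \<pi> w = \<pi> v"
proof -
  define \<eta> :: "'n \<Rightarrow> real ^ 'n ^ 'n" where "\<eta> = (\<lambda>i0. \<chi> i j. if i = j then (if i = i0 then - 1 else 1) else 0)"
  obtain P :: "real ^ 'n ^ 'n" and i0 where P: "invertible P" "transpose P ** G ** P = \<eta> i0"
    using assms unfolding lorentz_matrix_def \<eta>_def by blast
  obtain R where R: "P ** R = mat 1" "R ** P = mat 1"
    using P(1) unfolding invertible_def by blast
  have PR: "P *v (R *v v) = v" "R *v (P *v v) = v" for v
    by (simp_all add: matrix_vector_mul_assoc R)
  define \<tau> where "\<tau> = (\<lambda>v. (R *v v) $ i0)"
  define \<pi> where "\<pi> = (\<lambda>v. \<chi> i. if i = i0 then 0 else (R *v v) $ i)"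
  have inner: "v \<bullet> (G *v w) = - (\<tau> v * \<tau> w) + \<pi> v \<bullet> \<pi> w" for v w
  proof -
    define a b where "a = R *v v" and "b = R *v w"
    have "v \<bullet> (G *v w) = (P *v a) \<bullet> (G *v (P *v b))"
      by (simp add: a_def b_def PR)
    also have "\<dots> = (a v* transpose P) \<bullet> (G *v (P *v b))"
      by simp
    also have "\<dots> = a \<bullet> (transpose P *v (G *v (P *v b)))"
      by (rule dot_lmul_matrix)
    also have "\<dots> = a \<bullet> (\<eta> i0 *v b)"
      by (simp only: matrix_vector_mul_assoc matrix_mul_assoc P(2))
    also have "\<eta> i0 *v b = (\<chi> i. if i = i0 then - b $ i else b $ i)"
      by (simp add: \<eta>_def matrix_vector_mult_def vec_eq_iff if_distrib[of "\<lambda>x. x * _"] sum.delta cong: if_cong)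
    also have "a \<bullet> \<dots> = - (a $ i0 * b $ i0) + (\<Sum>i\<in>UNIV - {i0}. a $ i * b $ i)"
      by (simp add: inner_vec_def sum.remove[of UNIV i0])
    also have "(\<Sum>i\<in>UNIV - {i0}. a $ i * b $ i) = \<pi> v \<bullet> \<pi> w"
      by (simp add: inner_vec_def \<pi>_def sum.remove[of UNIV i0] a_def b_def)
    finally show ?thesis by (simp add: \<tau>_def a_def b_def)
  qed
  have zero: "v = 0" if "\<tau> v = 0" "\<pi> v = 0" for v
  proof -
    have "(R *v v) $ i = 0" for i
    proof -
      have "\<pi> v $ i = 0" using that(2) by simp
      then show ?thesis using that(1) by (cases "i = i0") (simp_all add: \<tau>_def \<pi>_def)
    qed
    then have "R *v v = 0" by (simp add: vec_eq_iff)
    then show ?thesis using PR(1)[of v] by simp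
  qed
  have reflect: "\<exists>w. \<tau> w = - \<tau> v \<and> \<pi> w = \<pi> v" for v
  proof -
    let ?w = "P *v (\<chi> i. if i = i0 then - (R *v v) $ i else (R *v v) $ i)"
    have "\<tau> ?w = - \<tau> v" by (simp add: \<tau>_def PR)
    moreover have "\<pi> ?w = \<pi> v" by (simp add: \<pi>_def PR vec_eq_iff)
    ultimately show ?thesis by blast
  qed
  show ?thesis
  proof (rule that[of \<tau> \<pi>])
    show "v \<bullet> (G *v w) = - (\<tau> v * \<tau> w) + \<pi> v \<bullet> \<pi> w" for v w by (rule inner)
    show "v = 0" if "\<tau> v = 0" "\<pi> v = 0" for v using that by (rule zero)
    show "\<exists>w. \<tau> w = - \<tau> v \<and> \<pi> w = \<pi> v" for v by (rule reflect)
  qed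
qed

text \<open>Pairing v with its reflection in time turns the indefinite product into a sum of two
  squares.\<close>

lemma lorentz_matrix_nondegenerate:
  fixes G :: "real ^ 'n::finite ^ 'n"
  assumes "lorentz_matrix G" "v \<noteq> 0"
  obtains w where "v \<bullet> (G *v w) \<noteq> 0"
proof -
  obtain \<tau> and \<pi> :: "real ^ 'n \<Rightarrow> real ^ 'n" where *: "\<And>v w. v \<bullet> (G *v w) = - (\<tau> v * \<tau> w) + \<pi> v \<bullet> \<pi> w"
    "\<And>v. \<tau> v = 0 \<Longrightarrow> \<pi> v = 0 \<Longrightarrow> v = 0" "\<And>v. \<exists>w. \<tau> w = - \<tau> v \<and> \<pi> w = \<pi> v"
    by (rule lorentz_matrix_splitting[OF assms(1)]) (rule that)
  obtain w where w: "\<tau> w = - \<tau> v" "\<pi> w = \<pi> v" using *(3) by blast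
  have "v \<bullet> (G *v w) = (\<tau> v)\<^sup>2 + (norm (\<pi> v))\<^sup>2"
    by (simp add: *(1) w power2_eq_square power2_norm_eq_inner[symmetric])
  moreover have "\<tau> v \<noteq> 0 \<or> \<pi> v \<noteq> 0" using *(2) assms(2) by blast
  ultimately have "v \<bullet> (G *v w) \<noteq> 0"
    by (auto simp: sum_power2_eq_zero_iff)
  then show thesis by (rule that)
qed

text \<open>By the Cauchy--Schwarz inequality, the time part \<open>t * s\<close> of the Lorentzian product of a causal
  vector \<open>(t, x)\<close> and a timelike vector \<open>(s, y)\<close> dominates the space part.\<close>

lemma causal_timelike_sign:
  fixes t s :: real and x y :: "'a::real_inner"
  assumes "- (t * t) + x \<bullet> x \<le> 0" "t \<noteq> 0 \<or> x \<noteq> 0" "- (s * s) + y \<bullet> y < 0"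
  shows "t * s \<noteq> 0" "- (t * s) + x \<bullet> y < 0 \<longleftrightarrow> 0 < t * s" "- (t * s) + x \<bullet> y \<noteq> 0"
proof -
  have "(norm x)\<^sup>2 \<le> \<bar>t\<bar>\<^sup>2" using assms(1) by (simp only: power2_norm_eq_inner power2_abs) (simp add: power2_eq_square)
  then have x: "norm x \<le> \<bar>t\<bar>" by (rule power2_le_imp_le) simp
  have "(norm y)\<^sup>2 < \<bar>s\<bar>\<^sup>2" using assms(3) by (simp only: power2_norm_eq_inner power2_abs) (simp add: power2_eq_square)
  then have y: "norm y < \<bar>s\<bar>" by (rule power2_less_imp_less) simp
  have t: "0 < \<bar>t\<bar>" using x assms(2) by auto
  have "\<bar>x \<bullet> y\<bar> \<le> norm x * norm y" by (rule Cauchy_Schwarz_ineq2)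
  also have "\<dots> \<le> \<bar>t\<bar> * norm y" using x by (intro mult_right_mono) auto
  also have "\<dots> < \<bar>t\<bar> * \<bar>s\<bar>" using y t by (intro mult_strict_left_mono)
  finally have *: "\<bar>x \<bullet> y\<bar> < \<bar>t * s\<bar>" by (simp add: abs_mult)
  then show "t * s \<noteq> 0" by auto
  show "- (t * s) + x \<bullet> y < 0 \<longleftrightarrow> 0 < t * s" "- (t * s) + x \<bullet> y \<noteq> 0"
    using * by linarith+
qed

lemma causal_timelike_inner_nonzero:
  fixes G :: "real ^ 'n::finite ^ 'n"
  assumes "lorentz_matrix G" "v \<noteq> 0" "v \<bullet> (G *v v) \<le> 0" "T \<bullet> (G *v T) < 0"
  shows "v \<bullet> (G *v T) \<noteq> 0"
proof -
  obtain \<tau> and \<pi> :: "real ^ 'n \<Rightarrow> real ^ 'n" where *: "\<And>v w. v \<bullet> (G *v w) = - (\<tau> v * \<tau> w) + \<pi> v \<bullet> \<pi> w"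
    "\<And>v. \<tau> v = 0 \<Longrightarrow> \<pi> v = 0 \<Longrightarrow> v = 0" "\<And>v. \<exists>w. \<tau> w = - \<tau> v \<and> \<pi> w = \<pi> v"
    by (rule lorentz_matrix_splitting[OF assms(1)]) (rule that)
  show ?thesis
    using assms(2-) *(2)[of v] causal_timelike_sign(3)[of "\<tau> v" "\<pi> v" "\<tau> T" "\<pi> T"] unfolding *(1) by blast
qed

text \<open>Two causal vectors, one of them timelike, have negative product iff their time parts
  have the same sign, and agreement of signs is transitive.\<close>

lemma same_cone_trans:
  fixes G :: "real ^ 'n::finite ^ 'n"
  assumes "lorentz_matrix G" "v \<noteq> 0" "v \<bullet> (G *v v) \<le> 0" "T \<bullet> (G *v T) < 0" "T' \<bullet> (G *v T') < 0"
    "v \<bullet> (G *v T) < 0" "T \<bullet> (G *v T') < 0"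
  shows "v \<bullet> (G *v T') < 0"
proof -
  obtain \<tau> and \<pi> :: "real ^ 'n \<Rightarrow> real ^ 'n" where *: "\<And>v w. v \<bullet> (G *v w) = - (\<tau> v * \<tau> w) + \<pi> v \<bullet> \<pi> w"
    "\<And>v. \<tau> v = 0 \<Longrightarrow> \<pi> v = 0 \<Longrightarrow> v = 0" "\<And>v. \<exists>w. \<tau> w = - \<tau> v \<and> \<pi> w = \<pi> v"
    by (rule lorentz_matrix_splitting[OF assms(1)]) (rule that)
  have v0: "\<tau> v \<noteq> 0 \<or> \<pi> v \<noteq> 0" using *(2) assms(2) by blast
  have T0: "\<tau> T \<noteq> 0 \<or> \<pi> T \<noteq> 0" using assms(4) unfolding *(1) by auto
  have "0 < \<tau> v * \<tau> T"
    using causal_timelike_sign(2)[of "\<tau> v" "\<pi> v" "\<tau> T" "\<pi> T"] v0 assms unfolding *(1) by blast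
  moreover have "0 < \<tau> T * \<tau> T'"
    using causal_timelike_sign(2)[of "\<tau> T" "\<pi> T" "\<tau> T'" "\<pi> T'"] T0 assms unfolding *(1) by fastforce
  ultimately have "0 < \<tau> v * \<tau> T'"
    by (auto simp: zero_less_mult_iff)
  then show ?thesis
    using causal_timelike_sign(2)[of "\<tau> v" "\<pi> v" "\<tau> T'" "\<pi> T'"] v0 assms unfolding *(1) by blast
qed

section \<open>Causal curves under local isometries\<close>

text \<open>Bundles what is needed to transport causal curves and their speed. The identity
  qualifies as well as the embedding of the slab, so changes of chart are covered by the same
  lemmas.\<close>

definition local_isometry ::
    "('p, 'n::finite) spacetime \<Rightarrow> ('q, 'n) spacetime \<Rightarrow> ('p \<Rightarrow> 'q) \<Rightarrow> bool"
  where "local_isometry M N f \<longleftrightarrow> spacetime M \<and> spacetime N \<and> smooth_map M N f \<and> preserves_metric M N f \<and>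
    (\<forall>c\<in>atlas M. \<forall>d\<in>atlas N. \<forall>p \<in> fst c \<inter> f -` fst d.
       future_timelike N d (f p) (tangent_map c d f p (tdir M c p)))"

lemma local_isometry_id:
  assumes "spacetime M"
  shows "local_isometry M M id"
proof -
  have "future_timelike M d p (tangent_map c d id p (tdir M c p))"
    if "c \<in> atlas M" "d \<in> atlas M" "p \<in> fst c \<inter> fst d" for c d p
  proof -
    have eq: "tangent_map c d id p (tdir M c p) = tdir M d p"
      using assms that unfolding spacetime_def by blast
    have "ginner M d p (tdir M d p) (tdir M d p) < 0"
      using assms that unfolding spacetime_def by blast
    then show ?thesis by (simp add: eq future_timelike_def)
  qed
  then show ?thesis
    using assms by (auto simp: local_isometry_def spacetime_def smooth_manifold_def)
qed

lemma local_isometryD: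
  assumes "local_isometry M N f"
  shows "spacetime M" "spacetime N" "smooth_manifold M" "smooth_manifold N" "smooth_map M N f"
    "continuous_map (mtop M) (mtop N) f"
  using assms by (auto simp: local_isometry_def spacetime_def smooth_map_def)

lemma ginner_tangent_map:
  assumes "local_isometry M N f" "c \<in> atlas M" "d \<in> atlas N" "p \<in> fst c" "f p \<in> fst d"
  shows "ginner N d (f p) (tangent_map c d f p v) (tangent_map c d f p w) = ginner M c p v w"
  using assms by (auto simp: local_isometry_def preserves_metric_def)

lemma spacetime_chartD:
  assumes "spacetime M" "c \<in> atlas M" "p \<in> fst c"
  shows "lorentz_matrix (metric M c p)" "ginner M c p (tdir M c p) (tdir M c p) < 0"
  using assms unfolding spacetime_def by blast+

text \<open>The image of v is nonzero because a vector with a nonzero product cannot be mapped to 0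
  isometrically. It lies in the cone of the image of \<open>tdir M c p\<close>, which is future
  timelike in N, so \<open>same_cone_trans\<close> applies.\<close>

lemma future_causal_tangent_map:
  assumes f: "local_isometry M N f" and c: "c \<in> atlas M" "p \<in> fst c" and d: "d \<in> atlas N" "f p \<in> fst d"
    and v: "future_causal M c p v"
  shows "future_causal N d (f p) (tangent_map c d f p v)"
proof -
  let ?T = "tangent_map c d f p"
  note g = ginner_tangent_map[OF f c(1) d(1) c(2) d(2)]
  have v': "v \<noteq> 0" "ginner M c p v v \<le> 0" "ginner M c p v (tdir M c p) < 0"
    using v by (auto simp: future_causal_def)
  obtain w where "v \<bullet> (metric M c p *v w) \<noteq> 0"
    using lorentz_matrix_nondegenerate[OF spacetime_chartD(1)[OF local_isometryD(1)[OF f] c] v'(1)] by blast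
  then have "ginner N d (f p) (?T v) (?T w) \<noteq> 0" by (simp only: g) (simp add: ginner_def)
  then have nz: "?T v \<noteq> 0" by (auto simp: ginner_zero_left)
  have "future_timelike N d (f p) (?T (tdir M c p))"
    using f c d by (auto simp: local_isometry_def)
  then have T: "ginner N d (f p) (?T (tdir M c p)) (?T (tdir M c p)) < 0"
    "ginner N d (f p) (?T (tdir M c p)) (tdir N d (f p)) < 0"
    by (auto simp: future_timelike_def)
  have v'': "ginner N d (f p) (?T v) (?T v) \<le> 0" "ginner N d (f p) (?T v) (?T (tdir M c p)) < 0"
    using v' by (simp_all only: g)
  have "ginner N d (f p) (?T v) (tdir N d (f p)) < 0"
    using same_cone_trans[OF spacetime_chartD(1)[OF local_isometryD(2)[OF f] d] nz, of "?T (tdir M c p)" "tdir N d (f p)"]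
      T v'' spacetime_chartD(2)[OF local_isometryD(2)[OF f] d] unfolding ginner_def by blast
  then show ?thesis
    using nz v''(1) by (simp add: future_causal_def)
qed

lemma relatively_open_preimage:
  assumes "continuous_map (top_of_set S) X \<gamma>" "openin X U"
  obtains T where "open T" "{s\<in>S. \<gamma> s \<in> U} = S \<inter> T"
  using openin_continuous_map_preimage[OF assms] by (auto simp: openin_open)

lemma has_vector_derivative_coord_push:
  assumes f: "smooth_map M N f" and M: "smooth_manifold M"
    and c: "c \<in> atlas M" "\<gamma> t \<in> fst c" and d: "d \<in> atlas N" "f (\<gamma> t) \<in> fst d"
    and \<gamma>: "continuous_map (top_of_set S) (mtop M) \<gamma>" and t: "t \<in> S"
    and w: "((snd c \<circ> \<gamma>) has_vector_derivative w) (at t within S)"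
  shows "((snd d \<circ> (f \<circ> \<gamma>)) has_vector_derivative tangent_map c d f (\<gamma> t) w) (at t within S)"
proof -
  have "(coord_rep c d f has_derivative tangent_map c d f (\<gamma> t)) (at ((snd c \<circ> \<gamma>) t) within (snd c \<circ> \<gamma>) ` S)"
    using coord_rep_has_derivative[OF f c(1) d(1) c(2) d(2)] by (simp add: has_derivative_at_withinI)
  then have "((coord_rep c d f \<circ> (snd c \<circ> \<gamma>)) has_vector_derivative tangent_map c d f (\<gamma> t) w) (at t within S)"
    by (rule vector_derivative_diff_chain_within[OF w])
  moreover obtain T where T: "open T" "{s\<in>S. \<gamma> s \<in> fst c} = S \<inter> T"
    using relatively_open_preimage[OF \<gamma> smooth_manifold_chart(1)[OF M c(1)]] by blast
  have "t \<in> T" using T(2) t c(2) by auto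
  have eq: "(coord_rep c d f \<circ> (snd c \<circ> \<gamma>)) s = (snd d \<circ> (f \<circ> \<gamma>)) s" if "s \<in> S" "s \<in> T" for s
  proof -
    have "\<gamma> s \<in> fst c" using that T(2) by blast
    then show ?thesis by (simp add: coord_rep_def chart_inv_chart[OF M c(1)])
  qed
  have "\<forall>\<^sub>F s in at t within S. (coord_rep c d f \<circ> (snd c \<circ> \<gamma>)) s = (snd d \<circ> (f \<circ> \<gamma>)) s"
    unfolding eventually_at_topological using T(1) \<open>t \<in> T\<close> eq by blast
  ultimately show ?thesis
    unfolding has_vector_derivative_def
    by (rule has_derivative_transform_eventually) (use eq t \<open>t \<in> T\<close> in auto)
qed

text \<open>Smoothness gives continuity of the derivative in fixed directions only, hence the
  expansion of \<open>w t\<close> in the basis.\<close>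

lemma continuous_on_tangent_map:
  assumes f: "smooth_map M N f" and M: "smooth_manifold M" and N: "smooth_manifold N"
    and c: "c \<in> atlas M" and d: "d \<in> atlas N"
    and E: "\<And>t. t \<in> E \<Longrightarrow> \<gamma> t \<in> fst c" "\<And>t. t \<in> E \<Longrightarrow> f (\<gamma> t) \<in> fst d"
    and \<gamma>: "continuous_on E (snd c \<circ> \<gamma>)" and w: "continuous_on E w"
  shows "continuous_on E (\<lambda>t. tangent_map c d f (\<gamma> t) (w t))"
proof -
  let ?D = "snd c ` (fst c \<inter> f -` fst d)"
  let ?F = "\<lambda>t. frechet_derivative (coord_rep c d f) (at (snd c (\<gamma> t)))"
  have "tangent_map c d f (\<gamma> t) (w t) = (\<Sum>b\<in>Basis. (w t \<bullet> b) *\<^sub>R ?F t b)" if "t \<in> E" for t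
  proof -
    interpret linear "?F t"
      using coord_rep_has_derivative[OF f c d E(1)[OF that] E(2)[OF that]] unfolding tangent_map_def
      by (rule has_derivative_linear)
    have "?F t (w t) = ?F t (\<Sum>b\<in>Basis. (w t \<bullet> b) *\<^sub>R b)" by (simp only: euclidean_representation)
    then show ?thesis by (simp only: tangent_map_def sum scaleR)
  qed
  moreover have "continuous_on E (\<lambda>t. \<Sum>b\<in>Basis. (w t \<bullet> b) *\<^sub>R ?F t b)"
  proof (intro continuous_intros w)
    fix b :: "real ^ 'b"
    have "continuous_on ?D (\<lambda>x. frechet_derivative (coord_rep c d f) (at x) b)"
      by (rule smooth_on_imp_continuous_on[OF smooth_on_frechet_derivative[OF smooth_map_coord_rep[OF f c d]]])
    then have "continuous_on E (\<lambda>t. frechet_derivative (coord_rep c d f) (at ((snd c \<circ> \<gamma>) t)) b)"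
      by (rule continuous_on_compose2[OF _ \<gamma>]) (use E in auto)
    then show "continuous_on E (\<lambda>t. ?F t b)" by simp
  qed
  ultimately show ?thesis by (simp cong: continuous_on_cong)
qed

lemma continuous_on_chart_curve:
  assumes M: "smooth_manifold M" and c: "c \<in> atlas M"
    and \<gamma>: "continuous_map (top_of_set S) (mtop M) \<gamma>" and E: "E \<subseteq> S" "\<And>t. t \<in> E \<Longrightarrow> \<gamma> t \<in> fst c"
  shows "continuous_on E (snd c \<circ> \<gamma>)"
proof -
  have "continuous_map (top_of_set E) (mtop M) \<gamma>"
    by (rule continuous_map_from_subtopology_mono[OF \<gamma> E(1)])
  then have "continuous_map (top_of_set E) (subtopology (mtop M) (fst c)) \<gamma>"
    using E(2) by (auto simp: continuous_map_in_subtopology)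
  from continuous_map_compose[OF this continuous_map_chart[OF M c]] show ?thesis
    by simp
qed

text \<open>The premise asks for one suitable chart around each point, whereas \<open>C1_arc\<close>
  speaks of all charts. With \<open>f = id\<close> this reduces the verification of
  \<open>C1_arc\<close> to a single convenient chart.\<close>

lemma C1_arc_push:
  assumes f: "local_isometry M N f" and ab: "a < b"
    and \<gamma>: "continuous_map (top_of_set {a..b}) (mtop M) \<gamma>"
    and loc: "\<And>t. t \<in> {a..b} \<Longrightarrow> \<exists>c\<in>atlas M. \<gamma> t \<in> fst c \<and>
      (\<exists>w. continuous_on ({a..b} \<inter> \<gamma> -` fst c) w \<and>
        (\<forall>s\<in>{a..b} \<inter> \<gamma> -` fst c. ((snd c \<circ> \<gamma>) has_vector_derivative w s) (at s within {a..b}) \<and>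
          future_causal M c (\<gamma> s) (w s)))"
  shows "C1_arc N (future_causal N) a b (f \<circ> \<gamma>)"
  unfolding C1_arc_def
proof (intro ballI conjI)
  note M = local_isometryD(3)[OF f] and N = local_isometryD(4)[OF f] and sf = local_isometryD(5)[OF f]
  fix d assume d: "d \<in> atlas N"
  let ?v = "\<lambda>t. vector_derivative (snd d \<circ> (f \<circ> \<gamma>)) (at t within {a..b})"
  let ?E = "{a..b} \<inter> (f \<circ> \<gamma>) -` fst d"
  {
    fix t assume t: "t \<in> ?E"
    then obtain c w where c: "c \<in> atlas M" "\<gamma> t \<in> fst c" and w: "continuous_on ({a..b} \<inter> \<gamma> -` fst c) w"
      "\<And>s. s \<in> {a..b} \<inter> \<gamma> -` fst c \<Longrightarrow> ((snd c \<circ> \<gamma>) has_vector_derivative w s) (at s within {a..b})"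
      "\<And>s. s \<in> {a..b} \<inter> \<gamma> -` fst c \<Longrightarrow> future_causal M c (\<gamma> s) (w s)"
      using loc[of t] by blast
    have D: "((snd d \<circ> (f \<circ> \<gamma>)) has_vector_derivative tangent_map c d f (\<gamma> s) (w s)) (at s within {a..b})"
      "?v s = tangent_map c d f (\<gamma> s) (w s)" if "s \<in> ?E" "\<gamma> s \<in> fst c" for s
    proof -
      show *: "((snd d \<circ> (f \<circ> \<gamma>)) has_vector_derivative tangent_map c d f (\<gamma> s) (w s)) (at s within {a..b})"
        using that by (intro has_vector_derivative_coord_push[OF sf M c(1) _ d _ \<gamma>] w(2)) auto
      show "?v s = tangent_map c d f (\<gamma> s) (w s)"
        using that by (intro vector_derivative_within_closed_interval[OF ab _ *]) auto
    qed
    have "(snd d \<circ> (f \<circ> \<gamma>)) differentiable (at t within {a..b})"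
      using D(1)[OF t c(2)] by (rule differentiableI_vector)
    moreover have "future_causal N d ((f \<circ> \<gamma>) t) (?v t)"
      using future_causal_tangent_map[OF f c d, of "w t"] w(3)[of t] t c D(2)[OF t c(2)] by simp
    \<comment> \<open>The formula for the velocity in terms of c holds only while the curve is in
      the domain of c, that is on a relative neighbourhood of t; this is enough for continuity at
      t.\<close>
    moreover have "continuous (at t within ?E) ?v"
    proof -
      obtain T where T: "open T" "{s\<in>{a..b}. \<gamma> s \<in> fst c} = {a..b} \<inter> T"
        using relatively_open_preimage[OF \<gamma> smooth_manifold_chart(1)[OF M c(1)]] by blast
      have tT: "t \<in> T" using T(2) t c(2) by auto
      have Ec: "\<gamma> s \<in> fst c" if "s \<in> ?E \<inter> T" for s using T(2) that by blast
      have "continuous_on (?E \<inter> T) (\<lambda>t. tangent_map c d f (\<gamma> t) (w t))"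
      proof (rule continuous_on_tangent_map[OF sf M N c(1) d])
        show "continuous_on (?E \<inter> T) (snd c \<circ> \<gamma>)"
          by (rule continuous_on_chart_curve[OF M c(1) \<gamma>]) (use Ec in auto)
        show "continuous_on (?E \<inter> T) w"
          by (rule continuous_on_subset[OF w(1)]) (use Ec in auto)
      qed (use Ec in auto)
      then have "continuous_on (?E \<inter> T) ?v"
        by (rule continuous_on_eq) (use D(2) Ec in auto)
      then have "continuous (at t within (?E \<inter> T)) ?v"
        using t tT by (simp add: continuous_on_eq_continuous_within)
      moreover have "at t within ?E = at t within (?E \<inter> T)"
        by (rule at_within_nhd[OF tT T(1)]) auto
      ultimately show ?thesis by simp
    qed
    ultimately have "(snd d \<circ> (f \<circ> \<gamma>)) differentiable (at t within {a..b})"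
      "future_causal N d ((f \<circ> \<gamma>) t) (?v t)" "continuous (at t within ?E) ?v" by blast+
  }
  note * = this
  show "(snd d \<circ> (f \<circ> \<gamma>)) differentiable (at t within {a..b})" "future_causal N d ((f \<circ> \<gamma>) t) (?v t)"
    if "t \<in> ?E" for t using *[OF that] by blast+
  show "continuous_on ?E ?v"
    using *(3) by (simp add: continuous_on_eq_continuous_within)
qed

lemma C1_arc_imp_local:
  assumes "C1_arc M C a b \<gamma>" "c \<in> atlas M"
  shows "continuous_on ({a..b} \<inter> \<gamma> -` fst c) (\<lambda>t. vector_derivative (snd c \<circ> \<gamma>) (at t within {a..b}))"
    "\<And>s. s \<in> {a..b} \<inter> \<gamma> -` fst c \<Longrightarrow> ((snd c \<circ> \<gamma>) has_vector_derivative
      vector_derivative (snd c \<circ> \<gamma>) (at s within {a..b})) (at s within {a..b})"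
    "\<And>s. s \<in> {a..b} \<inter> \<gamma> -` fst c \<Longrightarrow> C c (\<gamma> s) (vector_derivative (snd c \<circ> \<gamma>) (at s within {a..b}))"
proof -
  have *: "(\<forall>t\<in>{a..b} \<inter> \<gamma> -` fst c. (snd c \<circ> \<gamma>) differentiable (at t within {a..b}) \<and>
      C c (\<gamma> t) (vector_derivative (snd c \<circ> \<gamma>) (at t within {a..b}))) \<and>
    continuous_on ({a..b} \<inter> \<gamma> -` fst c) (\<lambda>t. vector_derivative (snd c \<circ> \<gamma>) (at t within {a..b}))"
    using assms unfolding C1_arc_def by (rule bspec)
  then show "continuous_on ({a..b} \<inter> \<gamma> -` fst c) (\<lambda>t. vector_derivative (snd c \<circ> \<gamma>) (at t within {a..b}))"
    by (rule conjunct2)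
  fix s assume "s \<in> {a..b} \<inter> \<gamma> -` fst c"
  from bspec[OF conjunct1[OF *] this]
  show "((snd c \<circ> \<gamma>) has_vector_derivative
      vector_derivative (snd c \<circ> \<gamma>) (at s within {a..b})) (at s within {a..b})"
    "C c (\<gamma> s) (vector_derivative (snd c \<circ> \<gamma>) (at s within {a..b}))"
    unfolding vector_derivative_works[symmetric] by (rule conjunct1, rule conjunct2)
qed

lemma pw_curveE:
  assumes "pw_curve M C J \<gamma>"
  obtains B where "is_interval J" "continuous_map (top_of_set J) (mtop M) \<gamma>"
    "\<And>a b. a \<in> J \<Longrightarrow> b \<in> J \<Longrightarrow> finite (B \<inter> {a..b})"
    "\<And>a b. a \<in> J \<Longrightarrow> b \<in> J \<Longrightarrow> a < b \<Longrightarrow> B \<inter> {a<..<b} = {} \<Longrightarrow> C1_arc M C a b \<gamma>"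
proof -
  have J: "is_interval J" "continuous_map (top_of_set J) (mtop M) \<gamma>"
    and "\<exists>B. \<forall>a\<in>J. \<forall>b\<in>J. finite (B \<inter> {a..b}) \<and> (a < b \<and> B \<inter> {a<..<b} = {} \<longrightarrow> C1_arc M C a b \<gamma>)"
    using assms by (simp_all only: pw_curve_def)
  then obtain B where B: "\<forall>a\<in>J. \<forall>b\<in>J. finite (B \<inter> {a..b}) \<and> (a < b \<and> B \<inter> {a<..<b} = {} \<longrightarrow> C1_arc M C a b \<gamma>)"
    by (elim exE)
  show thesis
  proof (rule that[OF J, of B])
    fix a b assume "a \<in> J" "b \<in> J"
    note * = bspec[OF bspec[OF B this(1)] this(2)]
    show "finite (B \<inter> {a..b})" by (rule conjunct1[OF *])
    show "C1_arc M C a b \<gamma>" if "a < b" "B \<inter> {a<..<b} = {}"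
      by (rule mp[OF conjunct2[OF *]]) (rule conjI[OF that])
  qed
qed

lemma pw_curve_push:
  assumes f: "local_isometry M N f" and \<gamma>: "pw_curve M (future_causal M) J \<gamma>"
  shows "pw_curve N (future_causal N) J (f \<circ> \<gamma>)"
proof -
  note M = local_isometryD(3)[OF f]
  obtain B where J: "is_interval J" and c\<gamma>: "continuous_map (top_of_set J) (mtop M) \<gamma>"
    and B: "\<And>a b. a \<in> J \<Longrightarrow> b \<in> J \<Longrightarrow> finite (B \<inter> {a..b})"
      "\<And>a b. a \<in> J \<Longrightarrow> b \<in> J \<Longrightarrow> a < b \<Longrightarrow> B \<inter> {a<..<b} = {} \<Longrightarrow> C1_arc M (future_causal M) a b \<gamma>"
    by (rule pw_curveE[OF \<gamma>]) (rule that)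
  have "C1_arc N (future_causal N) a b (f \<circ> \<gamma>)"
    if ab: "a \<in> J" "b \<in> J" "a < b" "B \<inter> {a<..<b} = {}" for a b
  proof (rule C1_arc_push[OF f ab(3)])
    have sub: "{a..b} \<subseteq> J"
      using mem_is_interval_1_I[OF J ab(1,2)] by auto
    show c': "continuous_map (top_of_set {a..b}) (mtop M) \<gamma>"
      by (rule continuous_map_from_subtopology_mono[OF c\<gamma> sub])
    fix t assume t: "t \<in> {a..b}"
    then have "\<gamma> t \<in> points M"
      using continuous_map_image_subset_topspace[OF c'] by auto
    then obtain c where c: "c \<in> atlas M" "\<gamma> t \<in> fst c" using chart_at[OF M] by blast
    show "\<exists>c\<in>atlas M. \<gamma> t \<in> fst c \<and>
      (\<exists>w. continuous_on ({a..b} \<inter> \<gamma> -` fst c) w \<and>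
        (\<forall>s\<in>{a..b} \<inter> \<gamma> -` fst c. ((snd c \<circ> \<gamma>) has_vector_derivative w s) (at s within {a..b}) \<and>
          future_causal M c (\<gamma> s) (w s)))"
      by (intro bexI[OF _ c(1)] conjI c(2) exI ballI, rule C1_arc_imp_local(1)[OF B(2)[OF ab] c(1)])
        (fact C1_arc_imp_local[OF B(2)[OF ab] c(1)])+
  qed
  moreover have "continuous_map (top_of_set J) (mtop N) (f \<circ> \<gamma>)"
    by (rule continuous_map_compose[OF c\<gamma> local_isometryD(6)[OF f]])
  ultimately show ?thesis
    unfolding pw_curve_def using J B(1) by (intro conjI exI[of _ B] ballI impI) auto
qed

lemma pw_curve_subinterval:
  assumes "pw_curve M C J \<gamma>" "{s..t} \<subseteq> J"
  shows "pw_curve M C {s..t} \<gamma>"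
proof -
  obtain B where "is_interval J" and c\<gamma>: "continuous_map (top_of_set J) (mtop M) \<gamma>"
    and B: "\<And>a b. a \<in> J \<Longrightarrow> b \<in> J \<Longrightarrow> finite (B \<inter> {a..b})"
      "\<And>a b. a \<in> J \<Longrightarrow> b \<in> J \<Longrightarrow> a < b \<Longrightarrow> B \<inter> {a<..<b} = {} \<Longrightarrow> C1_arc M C a b \<gamma>"
    by (rule pw_curveE[OF assms(1)]) (rule that)
  show ?thesis
    unfolding pw_curve_def
    using continuous_map_from_subtopology_mono[OF c\<gamma> assms(2)] subsetD[OF assms(2)] B
    by (intro conjI exI[of _ B] ballI impI is_interval_cc) auto
qed

text \<open>Prepares the fundamental theorem of calculus with finitely many exceptional points: at
  every other interior point the two-sided derivative is available.\<close>

lemma pw_curve_arc_around: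
  assumes "pw_curve M C {a..b} \<gamma>"
  obtains F where "finite F"
    "\<And>t. t \<in> {a<..<b} - F \<Longrightarrow> \<exists>a' b'. a \<le> a' \<and> a' < t \<and> t < b' \<and> b' \<le> b \<and> C1_arc M C a' b' \<gamma>"
proof (cases "a \<le> b")
  case True
  obtain B where B: "\<And>a' b'. a' \<in> {a..b} \<Longrightarrow> b' \<in> {a..b} \<Longrightarrow> finite (B \<inter> {a'..b'})"
      "\<And>a' b'. a' \<in> {a..b} \<Longrightarrow> b' \<in> {a..b} \<Longrightarrow> a' < b' \<Longrightarrow> B \<inter> {a'<..<b'} = {} \<Longrightarrow> C1_arc M C a' b' \<gamma>"
    by (rule pw_curveE[OF assms]) (rule that)
  have fin: "finite (B \<inter> {a..b})" using B(1) True by simp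
  show thesis
  proof (rule that[OF fin])
    fix t assume t: "t \<in> {a<..<b} - B \<inter> {a..b}"
    obtain \<delta> where \<delta>: "0 < \<delta>" "\<And>x. x \<in> B \<inter> {a..b} \<Longrightarrow> x \<noteq> t \<Longrightarrow> \<delta> \<le> dist t x"
      using finite_set_avoid[OF fin] by blast
    define a' b' where "a' = max a (t - \<delta>)" and "b' = min b (t + \<delta>)"
    have le: "a \<le> a'" "a' < t" "t < b'" "b' \<le> b"
      using t \<delta>(1) by (auto simp: a'_def b'_def)
    have "x \<notin> B" if "x \<in> {a'<..<b'}" for x
    proof
      assume "x \<in> B"
      then have "x \<in> B \<inter> {a..b}" using that le by auto
      moreover have "x \<noteq> t" using calculation t by auto
      ultimately have "\<delta> \<le> dist t x" by (rule \<delta>(2))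
      then show False using that by (auto simp: a'_def b'_def dist_real_def)
    qed
    then have "C1_arc M C a' b' \<gamma>"
      using le by (intro B(2)) auto
    then show "\<exists>a' b'. a \<le> a' \<and> a' < t \<and> t < b' \<and> b' \<le> b \<and> C1_arc M C a' b' \<gamma>"
      using le by blast
  qed
qed (use that[of "{}"] in auto)

text \<open>\<open>speed\<close> refers to an unspecified chart of M; the lemma trades it for a
  prescribed chart of N. Interior points are required because \<open>speed\<close> uses the
  two-sided derivative.\<close>

lemma speed_push:
  assumes f: "local_isometry M N f" and \<gamma>: "continuous_map (top_of_set {a..b}) (mtop M) \<gamma>"
    and arc: "C1_arc M (future_causal M) a b \<gamma>" and t: "a < t" "t < b"
    and d: "d \<in> atlas N" "f (\<gamma> t) \<in> fst d"
  obtains u where "((snd d \<circ> (f \<circ> \<gamma>)) has_vector_derivative u) (at t)" "future_causal N d (f (\<gamma> t)) u"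
    "speed M \<gamma> t = sqrt (- ginner N d (f (\<gamma> t)) u u)"
proof -
  note M = local_isometryD(3)[OF f]
  have tin: "t \<in> {a..b}" using t by simp
  have at: "at t within {a..b} = at t" using t by (simp add: at_within_Icc_at)
  have "\<gamma> t \<in> points M" using continuous_map_image_subset_topspace[OF \<gamma>] tin by auto
  then have "\<exists>c. c \<in> atlas M \<and> \<gamma> t \<in> fst c" using chart_at[OF M] by metis
  define c where "c = (SOME c. c \<in> atlas M \<and> \<gamma> t \<in> fst c)"
  have c: "c \<in> atlas M" "\<gamma> t \<in> fst c"
    using someI_ex[OF \<open>\<exists>c. c \<in> atlas M \<and> \<gamma> t \<in> fst c\<close>] by (auto simp: c_def)
  define v where "v = vector_derivative (snd c \<circ> \<gamma>) (at t)"
  have v: "((snd c \<circ> \<gamma>) has_vector_derivative v) (at t within {a..b})" "future_causal M c (\<gamma> t) v"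
    using C1_arc_imp_local(2,3)[OF arc c(1), of t] tin c(2) unfolding v_def at by auto
  show thesis
  proof (rule that)
    show "((snd d \<circ> (f \<circ> \<gamma>)) has_vector_derivative tangent_map c d f (\<gamma> t) v) (at t)"
      using has_vector_derivative_coord_push[OF local_isometryD(5)[OF f] M c d \<gamma> tin v(1)] by (simp only: at)
    show "future_causal N d (f (\<gamma> t)) (tangent_map c d f (\<gamma> t) v)"
      by (rule future_causal_tangent_map[OF f c d v(2)])
    show "speed M \<gamma> t = sqrt (- ginner N d (f (\<gamma> t)) (tangent_map c d f (\<gamma> t) v) (tangent_map c d f (\<gamma> t) v))"
      unfolding ginner_tangent_map[OF f c(1) d(1) c(2) d(2)]
      by (simp add: speed_def Let_def c_def[symmetric] v_def)
  qed
qed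

section \<open>Boundedness of the Lorentzian distance\<close>

text \<open>The sets \<open>W i\<close> are arbitrary: the proof cuts \<open>{a..b}\<close> at the last time at which the set
  containing \<open>a\<close> is visited, after which that set is no longer needed.\<close>

lemma integral_cover_bound:
  fixes g :: "real \<Rightarrow> real"
  assumes "finite I" "a \<le> b" "g integrable_on {a..b}"
    "\<And>x. x \<in> {a..b} \<Longrightarrow> \<exists>i\<in>I. x \<in> W i"
    "\<And>i s t. i \<in> I \<Longrightarrow> s \<in> W i \<Longrightarrow> t \<in> W i \<Longrightarrow> a \<le> s \<Longrightarrow> s < t \<Longrightarrow> t \<le> b \<Longrightarrow> integral {s..t} g \<le> m i"
    "\<And>i. i \<in> I \<Longrightarrow> 0 \<le> m i"
  shows "integral {a..b} g \<le> (\<Sum>i\<in>I. m i)"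
  using assms
proof (induction I arbitrary: a rule: finite_psubset_induct)
  case (psubset I)
  obtain j where j: "j \<in> I" "a \<in> W j" using psubset.prems(1,3) by force
  define S where "S = W j \<inter> {a..b}"
  define t where "t = Sup S"
  have S: "S \<noteq> {}" "bdd_above S" "a \<in> S" "S \<subseteq> {a..b}"
    using j psubset.prems(1) by (auto simp: S_def)
  have clS: "closure S \<subseteq> {a..b}" using S(4) by (intro closure_minimal) auto
  have tcl: "t \<in> closure S" unfolding t_def by (rule closure_contains_Sup[OF S(1,2)])
  have t: "a \<le> t" "t \<le> b" using tcl clS by auto
  have up: "x \<le> t" if "x \<in> S" for x unfolding t_def by (rule cSup_upper[OF that S(2)])
  let ?G = "\<lambda>x. integral {a..x} g"
  have cont: "continuous_on {a..b} ?G"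
    by (rule indefinite_integral_continuous_1[OF psubset.prems(2)])
  \<comment> \<open>\<open>W j\<close> need not be closed, so t may fail to belong to it. The bound
    holds on S and passes to its closure by continuity of the indefinite integral.\<close>
  have 1: "?G t \<le> m j"
  proof (rule continuous_le_on_closure[OF continuous_on_subset[OF cont clS] tcl])
    fix x assume x: "x \<in> S"
    show "?G x \<le> m j"
    proof (cases "a = x")
      case True
      then show ?thesis using psubset.prems(5)[OF j(1)] by simp
    next
      case False
      then show ?thesis using x by (intro psubset.prems(4)[OF j]) (auto simp: S_def)
    qed
  qed
  have combine: "?G x + integral {x..b} g = ?G b" if "a \<le> x" "x \<le> b" for x
    using Henstock_Kurzweil_Integration.integral_combine[OF that psubset.prems(2)] .
  let ?s = "\<Sum>i\<in>I - {j}. m i"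
  have s0: "0 \<le> ?s" using psubset.prems(5) by (intro sum_nonneg) auto
  \<comment> \<open>\<open>W j\<close> may still be visited at t itself, so the induction hypothesis
    is used on intervals that begin strictly after t, and the start then tends to t.\<close>
  have 2: "?G b - ?s \<le> ?G t"
  proof (cases "t = b")
    case False
    then have tb: "t < b" using t by simp
    have cl: "closure {t<..b} = {t..b}" using tb by (rule closure_greaterThanAtMost)
    show ?thesis
    proof (rule continuous_ge_on_closure[of "{t<..b}" ?G])
      show "continuous_on (closure {t<..b}) ?G"
        unfolding cl using t by (intro continuous_on_subset[OF cont]) auto
      show "t \<in> closure {t<..b}" unfolding cl using tb by simp
      fix x assume x: "x \<in> {t<..b}"
      have "integral {x..b} g \<le> ?s"
      proof (rule psubset.IH)
        show "I - {j} \<subset> I" using j by blast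
        show "x \<le> b" using x by simp
        show "g integrable_on {x..b}"
          using psubset.prems(2) by (rule integrable_on_subinterval) (use x t in auto)
        fix y assume y: "y \<in> {x..b}"
        then have yab: "y \<in> {a..b}" using x t by auto
        then obtain i where i: "i \<in> I" "y \<in> W i" using psubset.prems(3) by blast
        have "y \<notin> S" using up[of y] y x by auto
        then have "i \<noteq> j" using i yab by (auto simp: S_def)
        then show "\<exists>i\<in>I - {j}. y \<in> W i" using i by blast
      next
        fix i p q assume "i \<in> I - {j}" "p \<in> W i" "q \<in> W i" "x \<le> p" "p < q" "q \<le> b"
        then show "integral {p..q} g \<le> m i"
          using x t by (intro psubset.prems(4)) auto
      next
        fix i assume "i \<in> I - {j}"
        then show "0 \<le> m i" using psubset.prems(5) by blast
      qed
      then show "?G b - ?s \<le> ?G x"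
        using combine[of x] x t by auto
    qed
  qed (use s0 in simp)
  have "(\<Sum>i\<in>I. m i) = m j + ?s"
    by (rule sum.remove[OF psubset.hyps j(1)])
  then show ?case using 1 2 by simp
qed

lemma continuous_on_metric:
  assumes "spacetime M" "c \<in> atlas M"
  shows "continuous_on (snd c ` fst c) (\<lambda>x. metric M c (chart_inv c x) $ i $ j)"
proof (rule smooth_on_imp_continuous_on)
  show "smooth_on (snd c ` fst c) (\<lambda>x. metric M c (chart_inv c x) $ i $ j)"
    using assms unfolding spacetime_def by blast
qed

lemma continuous_on_tdir:
  assumes "spacetime M" "c \<in> atlas M"
  shows "continuous_on (snd c ` fst c) (\<lambda>x. tdir M c (chart_inv c x))"
  using assms unfolding spacetime_def by blast

lemma continuous_on_inner_matrix:
  fixes A :: "'a::topological_space \<Rightarrow> real ^ 'n::finite ^ 'n"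
  assumes A: "\<And>i j. continuous_on S (\<lambda>x. A x $ i $ j)" and u: "continuous_on S u" and w: "continuous_on S w"
  shows "continuous_on S (\<lambda>x. u x \<bullet> (A x *v w x))"
  unfolding inner_vec_def matrix_vector_mult_def
  by (simp, intro continuous_on_sum continuous_on_mult A continuous_on_component[OF u] continuous_on_component[OF w])

text \<open>At q the covector dual to minus \<open>tdir\<close> is positive on all future causal
  vectors. By compactness of the set of causal unit vectors it stays positive on those over a small
  ball, and the quotient of Lorentzian speed by it stays bounded there. A multiple k with constant
  coefficients therefore dominates the speed, and k is the derivative of a linear function of the
  coordinates.\<close>

lemma local_speed_bound:
  fixes N :: "('p, 'n::finite) spacetime"
  assumes N: "spacetime N" and q: "q \<in> points N"
  obtains d U k B where "d \<in> atlas N" "openin (mtop N) U" "q \<in> U" "U \<subseteq> fst d"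
    "\<And>p w. p \<in> U \<Longrightarrow> future_causal N d p w \<Longrightarrow> sqrt (- ginner N d p w w) \<le> k \<bullet> w"
    "\<And>p. p \<in> U \<Longrightarrow> \<bar>k \<bullet> snd d p\<bar> \<le> B"
proof -
  have sm: "smooth_manifold N" using N by (simp add: spacetime_def)
  obtain d where d: "d \<in> atlas N" "q \<in> fst d" using chart_at[OF sm q] by blast
  define V where "V = snd d ` fst d"
  define G where "G = (\<lambda>x. metric N d (chart_inv d x))"
  define T where "T = (\<lambda>x. tdir N d (chart_inv d x))"
  define z where "z = snd d q"
  have V: "open V" "z \<in> V" using smooth_manifold_chart(2)[OF sm d(1)] d(2) by (auto simp: V_def z_def)
  then obtain r where r: "0 < r" "cball z r \<subseteq> V" using open_contains_cball by blast
  have G: "continuous_on (cball z r) (\<lambda>x. G x $ i $ j)" for i j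
    using continuous_on_subset[OF continuous_on_metric[OF N d(1)] r(2)[unfolded V_def]] by (simp only: G_def)
  have T: "continuous_on (cball z r) T"
    using continuous_on_subset[OF continuous_on_tdir[OF N d(1)] r(2)[unfolded V_def]] by (simp only: T_def)
  have inv: "chart_inv d x \<in> fst d" "lorentz_matrix (G x)" "T x \<bullet> (G x *v T x) < 0" if "x \<in> cball z r" for x
  proof -
    have "x \<in> snd d ` fst d" using that r(2) unfolding V_def by blast
    then show *: "chart_inv d x \<in> fst d" by (rule chart_chart_inv(2))
    show "lorentz_matrix (G x)" "T x \<bullet> (G x *v T x) < 0"
      using spacetime_chartD[OF N d(1) *] by (simp_all add: G_def T_def ginner_def)
  qed
  \<comment> \<open>The last condition is not strict, so that A is closed;
    \<open>causal_timelike_inner_nonzero\<close> restores strictness at z.\<close>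
  define A where "A = {(x, w). x \<in> cball z r \<and> w \<in> sphere 0 1 \<and> w \<bullet> (G x *v w) \<le> 0 \<and> w \<bullet> (G x *v T x) \<le> 0}"
  define k0 where "k0 = - (G z *v T z)"
  let ?P = "cball z r \<times> sphere (0 :: real ^ 'n) 1"
  have cP: "compact ?P" by (intro compact_Times) auto
  have Gf: "continuous_on ?P (\<lambda>y. G (fst y) $ i $ j)" for i j
    by (rule continuous_on_compose2[OF G continuous_on_fst[OF continuous_on_id]]) auto
  have Tf: "continuous_on ?P (\<lambda>y. T (fst y))"
    by (rule continuous_on_compose2[OF T continuous_on_fst[OF continuous_on_id]]) auto
  have Gv: "continuous_on ?P (\<lambda>y. snd y \<bullet> (G (fst y) *v u y))" if u: "continuous_on ?P u" for u
    by (intro continuous_on_inner_matrix Gf continuous_on_snd continuous_on_id u)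
  have c1: "continuous_on ?P (\<lambda>y. snd y \<bullet> (G (fst y) *v snd y))"
    by (intro Gv continuous_on_snd continuous_on_id)
  have c2: "continuous_on ?P (\<lambda>y. snd y \<bullet> (G (fst y) *v T (fst y)))"
    by (rule Gv[OF Tf])
  let ?S1 = "?P \<inter> (\<lambda>y. snd y \<bullet> (G (fst y) *v snd y)) -` {..0}"
  let ?S2 = "?P \<inter> (\<lambda>y. snd y \<bullet> (G (fst y) *v T (fst y))) -` {..0}"
  have A_eq: "A = ?P \<inter> (?S1 \<inter> ?S2)"
    unfolding A_def by (auto simp: case_prod_beta)
  have S: "closed ?S1" "closed ?S2"
    by (intro continuous_closed_preimage c1 c2 compact_imp_closed[OF cP] closed_atMost)+
  have cA: "compact A"
    unfolding A_eq by (rule compact_Int_closed[OF cP closed_Int[OF S]])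
  have zpos: "0 < k0 \<bullet> w" if "(z, w) \<in> A" for w
  proof -
    have zr: "z \<in> cball z r" using r by simp
    have w: "w \<noteq> 0" "w \<bullet> (G z *v w) \<le> 0" "w \<bullet> (G z *v T z) \<le> 0"
      using that by (auto simp: A_def)
    have "w \<bullet> (G z *v T z) \<noteq> 0"
      by (rule causal_timelike_inner_nonzero[OF inv(2)[OF zr] w(1,2) inv(3)[OF zr]])
    then show ?thesis using w(3) by (simp add: k0_def inner_commute)
  qed
  \<comment> \<open>The vectors on which \<open>k0\<close> fails to be positive form a compact set.
    The base points of its elements form a closed set that misses z, which leaves a whole ball
    around z.\<close>
  define A0 where "A0 = A \<inter> {y. k0 \<bullet> snd y \<le> 0}"
  have "closed {y :: (real ^ 'n) \<times> (real ^ 'n). k0 \<bullet> snd y \<le> 0}"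
    by (intro closed_Collect_le continuous_intros)
  then have "compact A0" unfolding A0_def by (intro compact_Int_closed cA)
  then have "compact (fst ` A0)" by (intro compact_continuous_image continuous_intros)
  then have "closed (fst ` A0)" by (rule compact_imp_closed)
  moreover have "z \<notin> fst ` A0" using zpos by (force simp: A0_def)
  ultimately obtain e where e: "0 < e" "cball z e \<subseteq> - (fst ` A0)"
    using bspec[OF open_contains_cball[THEN iffD1, OF open_Compl], of "fst ` A0" z] by blast
  define s where "s = min r e"
  have s: "0 < s" "cball z s \<subseteq> cball z r" "cball z s \<subseteq> cball z e" using r e by (auto simp: s_def)
  define A1 where "A1 = A \<inter> (cball z s \<times> UNIV)"
  have cA1: "compact A1" unfolding A1_def by (intro compact_Int_closed cA closed_Times) auto
  have A1pos: "0 < k0 \<bullet> w" if "(x, w) \<in> A1" for x w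
  proof (rule ccontr)
    assume "\<not> 0 < k0 \<bullet> w"
    then have "(x, w) \<in> A0" using that by (auto simp: A0_def A1_def)
    then have "x \<in> fst ` A0" by force
    moreover have "x \<in> cball z s" using that by (auto simp: A1_def)
    ultimately show False using s(3) e(2) by blast
  qed
  have "A1 \<subseteq> ?P" by (auto simp: A1_def A_def)
  then have "continuous_on A1 (\<lambda>y. sqrt (- (snd y \<bullet> (G (fst y) *v snd y))) / (k0 \<bullet> snd y))"
    by (intro continuous_on_divide continuous_on_real_sqrt continuous_on_minus continuous_on_subset[OF c1]
        continuous_on_inner continuous_on_const continuous_on_snd continuous_on_id)
      (use A1pos in fastforce)+
  then have "compact ((\<lambda>y. sqrt (- (snd y \<bullet> (G (fst y) *v snd y))) / (k0 \<bullet> snd y)) ` A1)"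
    by (rule compact_continuous_image[OF _ cA1])
  then have "bdd_above ((\<lambda>y. sqrt (- (snd y \<bullet> (G (fst y) *v snd y))) / (k0 \<bullet> snd y)) ` A1)"
    by (intro bounded_imp_bdd_above compact_imp_bounded)
  then obtain C where C: "\<And>y. y \<in> A1 \<Longrightarrow> sqrt (- (snd y \<bullet> (G (fst y) *v snd y))) / (k0 \<bullet> snd y) \<le> C"
    by (auto simp: bdd_above_def)
  define U where "U = {p \<in> fst d. snd d p \<in> ball z s}"
  show thesis
  proof (rule that[OF d(1)])
    show "openin (mtop N) U" unfolding U_def by (rule openin_chart_preimage[OF sm d(1)]) simp
    show "q \<in> U" using d(2) s(1) by (simp add: U_def z_def)
    show "U \<subseteq> fst d" by (auto simp: U_def)
  next
    fix p w assume p: "p \<in> U" and w: "future_causal N d p w"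
    define x where "x = snd d p"
    have pd: "p \<in> fst d" and x: "x \<in> cball z s" using p by (auto simp: U_def x_def)
    have px: "chart_inv d x = p" unfolding x_def by (rule chart_inv_chart[OF sm d(1) pd])
    have w': "w \<noteq> 0" "w \<bullet> (G x *v w) \<le> 0" "w \<bullet> (G x *v T x) < 0"
      using w by (auto simp: future_causal_def ginner_def G_def T_def px)
    \<comment> \<open>Both sides of the claim are homogeneous of degree 1 in w, so the unit vector
      in the direction of w decides.\<close>
    define n where "n = norm w"
    have n: "0 < n" using w'(1) by (simp add: n_def)
    define v where "v = (1 / n) *\<^sub>R w"
    have wv: "w = n *\<^sub>R v" using n by (simp add: v_def)
    have g: "w \<bullet> (G x *v w) = n\<^sup>2 * (v \<bullet> (G x *v v))" "w \<bullet> (G x *v T x) = n * (v \<bullet> (G x *v T x))"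
      unfolding wv by (simp_all add: matrix_vector_mult_scaleR power2_eq_square)
    have "norm v = 1" using n by (simp add: v_def n_def)
    moreover have "v \<bullet> (G x *v v) \<le> 0" "v \<bullet> (G x *v T x) \<le> 0"
      using w'(2,3) n unfolding g by (simp_all add: mult_le_0_iff mult_less_0_iff)
    ultimately have vA: "(x, v) \<in> A1"
      using x subsetD[OF s(2) x] by (simp add: A1_def A_def)
    then have "sqrt (- (v \<bullet> (G x *v v))) \<le> C * (k0 \<bullet> v)"
      using C[OF vA] pos_divide_le_eq[OF A1pos[OF vA]] by simp
    then have "n * sqrt (- (v \<bullet> (G x *v v))) \<le> n * (C * (k0 \<bullet> v))"
      using n by (intro mult_left_mono) auto
    moreover have "sqrt (- (w \<bullet> (G x *v w))) = n * sqrt (- (v \<bullet> (G x *v v)))"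
      unfolding g(1) using n by (simp add: real_sqrt_mult real_sqrt_minus)
    moreover have "(C *\<^sub>R k0) \<bullet> w = n * (C * (k0 \<bullet> v))" by (simp add: wv)
    moreover have "ginner N d p w w = w \<bullet> (G x *v w)" by (simp add: ginner_def G_def px)
    ultimately show "sqrt (- ginner N d p w w) \<le> (C *\<^sub>R k0) \<bullet> w" by (simp only:)
  next
    fix p assume "p \<in> U"
    then have "norm (snd d p) \<le> norm z + s"
      using norm_triangle_ineq2[of "snd d p" z] by (auto simp: U_def dist_norm norm_minus_commute)
    then have "norm (C *\<^sub>R k0) * norm (snd d p) \<le> norm (C *\<^sub>R k0) * (norm z + s)"
      by (intro mult_left_mono) auto
    then show "\<bar>(C *\<^sub>R k0) \<bullet> snd d p\<bar> \<le> norm (C *\<^sub>R k0) * (norm z + s)"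
      using Cauchy_Schwarz_ineq2[of "C *\<^sub>R k0" "snd d p"] by linarith
  qed
qed

text \<open>The speed is at most the derivative of \<open>k \<bullet> snd d\<close> along the curve,
  so the length is at most the increment of this function, whose values lie between -B and
  B.\<close>

lemma lorentz_length_piece_bound:
  assumes f: "local_isometry X N f" and \<gamma>: "pw_curve X (future_causal X) {a..b} \<gamma>" and ab: "a \<le> b"
    and d: "d \<in> atlas N" and U: "\<And>t. t \<in> {a..b} \<Longrightarrow> f (\<gamma> t) \<in> U" "U \<subseteq> fst d"
    and k: "\<And>p w. p \<in> U \<Longrightarrow> future_causal N d p w \<Longrightarrow> sqrt (- ginner N d p w w) \<le> k \<bullet> w"
    and B: "\<And>p. p \<in> U \<Longrightarrow> \<bar>k \<bullet> snd d p\<bar> \<le> B"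
    and int: "speed X \<gamma> integrable_on {a..b}"
  shows "integral {a..b} (speed X \<gamma>) \<le> 2 * B"
proof -
  have c\<gamma>: "continuous_map (top_of_set {a..b}) (mtop X) \<gamma>"
    using \<gamma> by (simp add: pw_curve_def)
  obtain F where F: "finite F"
    "\<And>t. t \<in> {a<..<b} - F \<Longrightarrow> \<exists>a' b'. a \<le> a' \<and> a' < t \<and> t < b' \<and> b' \<le> b \<and> C1_arc X (future_causal X) a' b' \<gamma>"
    by (rule pw_curve_arc_around[OF \<gamma>]) (rule that)
  let ?\<delta> = "snd d \<circ> (f \<circ> \<gamma>)"
  have "\<exists>u. (?\<delta> has_vector_derivative u) (at t) \<and> speed X \<gamma> t \<le> k \<bullet> u" if t: "t \<in> {a<..<b} - F" for t
  proof -
    obtain a' b' where ab': "a \<le> a'" "a' < t" "t < b'" "b' \<le> b" "C1_arc X (future_causal X) a' b' \<gamma>"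
      using F(2)[OF t] by metis
    have "{a'..b'} \<subseteq> {a..b}" using ab' by auto
    then have c': "continuous_map (top_of_set {a'..b'}) (mtop X) \<gamma>"
      by (rule continuous_map_from_subtopology_mono[OF c\<gamma>])
    have ft: "f (\<gamma> t) \<in> U" using U(1) t by auto
    obtain u where u: "(?\<delta> has_vector_derivative u) (at t)" "future_causal N d (f (\<gamma> t)) u"
      "speed X \<gamma> t = sqrt (- ginner N d (f (\<gamma> t)) u u)"
      by (rule speed_push[OF f c' ab'(5,2,3) d subsetD[OF U(2) ft]]) (rule that)
    show ?thesis using u(1,3) k[OF ft u(2)] by auto
  qed
  then obtain \<delta>' where \<delta>': "\<And>t. t \<in> {a<..<b} - F \<Longrightarrow> (?\<delta> has_vector_derivative \<delta>' t) (at t)"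
    "\<And>t. t \<in> {a<..<b} - F \<Longrightarrow> speed X \<gamma> t \<le> k \<bullet> \<delta>' t"
    by metis
  have "continuous_map (top_of_set {a..b}) (mtop N) (f \<circ> \<gamma>)"
    by (rule continuous_map_compose[OF c\<gamma> local_isometryD(6)[OF f]])
  then have "continuous_on {a..b} ?\<delta>"
    by (rule continuous_on_chart_curve[OF local_isometryD(4)[OF f] d]) (use U in auto)
  then have "continuous_on {a..b} (\<lambda>t. k \<bullet> ?\<delta> t)"
    by (intro continuous_intros)
  then have "((\<lambda>t. k \<bullet> \<delta>' t) has_integral (k \<bullet> ?\<delta> b - k \<bullet> ?\<delta> a)) {a..b}"
    by (intro fundamental_theorem_of_calculus_interior_strong[OF F(1) ab]
        bounded_linear.has_vector_derivative[OF bounded_linear_inner_right] \<delta>'(1))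
  \<comment> \<open>The comparison of integrals requires the inequality at every point; at the
    finitely many exceptional ones h is set equal to the speed.\<close>
  moreover define h where "h = (\<lambda>t. if t \<in> F \<union> {a, b} then speed X \<gamma> t else k \<bullet> \<delta>' t)"
  ultimately have h: "(h has_integral (k \<bullet> ?\<delta> b - k \<bullet> ?\<delta> a)) {a..b}"
    using F(1) by (intro has_integral_spike_finite[of "F \<union> {a, b}" "{a..b}" h "\<lambda>t. k \<bullet> \<delta>' t"]) (auto simp: h_def)
  have "integral {a..b} (speed X \<gamma>) \<le> k \<bullet> ?\<delta> b - k \<bullet> ?\<delta> a"
    by (rule has_integral_le[OF integrable_integral[OF int] h]) (use \<delta>'(2) in \<open>auto simp: h_def\<close>)
  moreover have "\<bar>k \<bullet> ?\<delta> a\<bar> \<le> B" "\<bar>k \<bullet> ?\<delta> b\<bar> \<le> B"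
    using B U(1) ab by auto
  ultimately show ?thesis by linarith
qed

lemma isometric_embedding_imp_local_isometry:
  assumes "isometric_embedding X N f" "spacetime X" "spacetime N"
  shows "local_isometry X N f"
  using assms by (simp add: isometric_embedding_def local_isometry_def)

text \<open>A curve may return to V arbitrarily often, but by strong causality all of it between two
  visits stays in U, where the length is bounded. Finitely many sets V cover K, and
  \<open>integral_cover_bound\<close> adds up their bounds. Compactness and strong causality belong
  to N, so curves of X are followed through f.\<close>

lemma lorentz_dist_bounded:
  assumes f: "local_isometry X N f" and N: "strongly_causal N"
    and cpt: "compactin (mtop N) K" and K: "f ` points X \<subseteq> K"
  obtains m where "0 \<le> m" "\<And>x y. lorentz_dist X x y \<le> ennreal m"
proof -
  note stN = local_isometryD(2)[OF f]
  have "\<exists>V B. openin (mtop N) V \<and> q \<in> V \<and> 0 \<le> B \<and> (\<forall>\<gamma> s t. s < t \<longrightarrow> pw_curve X (future_causal X) {s..t} \<gamma> \<longrightarrow>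
      f (\<gamma> s) \<in> V \<longrightarrow> f (\<gamma> t) \<in> V \<longrightarrow> speed X \<gamma> integrable_on {s..t} \<longrightarrow> integral {s..t} (speed X \<gamma>) \<le> B)"
    if q: "q \<in> points N" for q
  proof -
    obtain d U k B where d: "d \<in> atlas N" and U: "openin (mtop N) U" "q \<in> U" "U \<subseteq> fst d"
      and k: "\<And>p w. p \<in> U \<Longrightarrow> future_causal N d p w \<Longrightarrow> sqrt (- ginner N d p w w) \<le> k \<bullet> w"
      and B: "\<And>p. p \<in> U \<Longrightarrow> \<bar>k \<bullet> snd d p\<bar> \<le> B"
      by (rule local_speed_bound[OF stN q]) (rule that)
    obtain V where V: "openin (mtop N) V" "q \<in> V" "V \<subseteq> U"
      "\<And>x y a b \<gamma>. x \<in> V \<Longrightarrow> y \<in> V \<Longrightarrow> curve_from_to N (future_causal N) x y a b \<gamma> \<Longrightarrow> \<gamma> ` {a..b} \<subseteq> U"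
      using N U(1,2) unfolding strongly_causal_def by metis
    have B0: "0 \<le> B" using B[OF U(2)] by linarith
    have "integral {s..t} (speed X \<gamma>) \<le> 2 * B"
      if st: "s < t" and \<gamma>: "pw_curve X (future_causal X) {s..t} \<gamma>" and fs: "f (\<gamma> s) \<in> V" "f (\<gamma> t) \<in> V"
        and int: "speed X \<gamma> integrable_on {s..t}" for \<gamma> s t
    proof (rule lorentz_length_piece_bound[OF f \<gamma> less_imp_le[OF st] d _ U(3) k B int])
      fix t' assume t': "t' \<in> {s..t}"
      have "curve_from_to N (future_causal N) (f (\<gamma> s)) (f (\<gamma> t)) s t (f \<circ> \<gamma>)"
        using st pw_curve_push[OF f \<gamma>] by (simp add: curve_from_to_def)
      then have "(f \<circ> \<gamma>) ` {s..t} \<subseteq> U" by (rule V(4)[OF fs])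
      then show "f (\<gamma> t') \<in> U" using t' by auto
    qed
    then show ?thesis
      using V(1,2) B0 by (intro exI[of _ V] exI[of _ "2 * B"]) auto
  qed
  then obtain V B where V: "\<And>q. q \<in> points N \<Longrightarrow> openin (mtop N) (V q)" "\<And>q. q \<in> points N \<Longrightarrow> q \<in> V q"
    "\<And>q. q \<in> points N \<Longrightarrow> 0 \<le> B q"
    and bd: "\<And>q \<gamma> s t. q \<in> points N \<Longrightarrow> s < t \<Longrightarrow> pw_curve X (future_causal X) {s..t} \<gamma> \<Longrightarrow> f (\<gamma> s) \<in> V q \<Longrightarrow>
      f (\<gamma> t) \<in> V q \<Longrightarrow> speed X \<gamma> integrable_on {s..t} \<Longrightarrow> integral {s..t} (speed X \<gamma>) \<le> (B q :: real)"
    by metis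
  have KN: "K \<subseteq> points N" using cpt by (simp add: compactin_def)
  have "\<exists>\<F>. finite \<F> \<and> \<F> \<subseteq> V ` K \<and> K \<subseteq> \<Union>\<F>"
    by (rule compactinD[OF cpt]) (use V(1,2) KN in auto)
  then obtain I where I: "finite I" "I \<subseteq> K" "K \<subseteq> (\<Union>q\<in>I. V q)"
    by (metis finite_subset_image)
  define m where "m = (\<Sum>q\<in>I. B q)"
  have m0: "0 \<le> m" unfolding m_def using V(3) I(2) KN by (intro sum_nonneg) auto
  have "lorentz_length X a b \<gamma> \<le> m" if \<gamma>: "curve_from_to X (future_causal X) x y a b \<gamma>" for x y a b \<gamma>
  \<comment> \<open>If the speed is not integrable, \<open>integral\<close> has the default value 0
    and the bound is trivial.\<close>
  proof (cases "speed X \<gamma> integrable_on {a..b}")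
    case True
    have ab: "a < b" and pw: "pw_curve X (future_causal X) {a..b} \<gamma>"
      using \<gamma> by (auto simp: curve_from_to_def)
    have "\<gamma> ` {a..b} \<subseteq> points X"
      using pw continuous_map_image_subset_topspace[of "top_of_set {a..b}" "mtop X" \<gamma>] by (simp add: pw_curve_def)
    then have cov: "\<exists>q\<in>I. t \<in> {t. f (\<gamma> t) \<in> V q}" if "t \<in> {a..b}" for t
      using that I(3) K by blast
    show ?thesis
      unfolding lorentz_length_def m_def
    proof (rule integral_cover_bound[OF I(1) less_imp_le[OF ab] True cov])
      fix q s t assume q: "q \<in> I" "s \<in> {t. f (\<gamma> t) \<in> V q}" "t \<in> {t. f (\<gamma> t) \<in> V q}" and st: "a \<le> s" "s < t" "t \<le> b"
      have sub: "{s..t} \<subseteq> {a..b}" using st by auto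
      show "integral {s..t} (speed X \<gamma>) \<le> B q"
        using q I(2) KN sub True
        by (intro bd[OF _ st(2) pw_curve_subinterval[OF pw sub]]) (auto intro: integrable_on_subinterval)
    next
      fix q assume "q \<in> I"
      then show "0 \<le> B q" using V(3) I(2) KN by blast
    qed
  qed (use m0 in \<open>simp add: lorentz_length_def not_integrable_integral\<close>)
  then have "lorentz_dist X x y \<le> ennreal m" for x y
    unfolding lorentz_dist_def by (auto intro!: Sup_least ennreal_leI)
  then show thesis using that m0 by blast
qed

section \<open>Concentrated conformal factors\<close>

lemma smooth_fun_imp_continuous_map:
  assumes M: "smooth_manifold M" and u: "smooth_fun M u"
  shows "continuous_map (mtop M) euclidean u"
proof -
  have "openin (mtop M) {p \<in> points M. u p \<in> S}" if S: "open S" for S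
    unfolding openin_subopen[of _ "{p \<in> points M. u p \<in> S}"]
  proof
    fix p assume p: "p \<in> {p \<in> points M. u p \<in> S}"
    then obtain c where c: "c \<in> atlas M" "p \<in> fst c" using chart_at[OF M] by blast
    have cont: "continuous_on (snd c ` fst c) (\<lambda>x. u (chart_inv c x))"
      using u c(1) by (auto simp: smooth_fun_def intro: smooth_on_imp_continuous_on)
    have V: "open ((\<lambda>x. u (chart_inv c x)) -` S \<inter> snd c ` fst c)"
      using continuous_on_open_vimage[OF smooth_manifold_chart(2)[OF M c(1)], THEN iffD1, OF cont] S by simp
    let ?T = "{q \<in> fst c. snd c q \<in> (\<lambda>x. u (chart_inv c x)) -` S \<inter> snd c ` fst c}"
    have "openin (mtop M) ?T" by (rule openin_chart_preimage[OF M c(1) V])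
    moreover have "p \<in> ?T" using p c(2) by (simp add: chart_inv_chart[OF M c(1)])
    moreover have "?T \<subseteq> {p \<in> points M. u p \<in> S}"
    proof
      fix q assume "q \<in> ?T"
      then have "q \<in> fst c" "u (chart_inv c (snd c q)) \<in> S" by auto
      then show "q \<in> {p \<in> points M. u p \<in> S}"
        using chart_subset_points[OF M c(1)] by (auto simp: chart_inv_chart[OF M c(1)])
    qed
    ultimately show "\<exists>T. openin (mtop M) T \<and> p \<in> T \<and> T \<subseteq> {p \<in> points M. u p \<in> S}" by blast
  qed
  then show ?thesis by (simp add: continuous_map_def)
qed

text \<open>In dimension at least 2 some nonzero y is orthogonal to v, and the segment lies in a
  hyperplane with normal y. Compactness makes it a Borel set.\<close>

lemma segment_null_sets:
  fixes x v :: "'a::euclidean_space"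
  assumes "2 \<le> DIM('a)"
  shows "(\<lambda>t. x + t *\<^sub>R v) ` {a..b} \<in> null_sets lborel"
proof -
  obtain y where y: "y \<noteq> 0" "orthogonal v y"
    using orthogonal_to_vector_exists[OF assms] by blast
  have "(\<lambda>t. x + t *\<^sub>R v) ` {a..b} \<subseteq> {z. y \<bullet> z = y \<bullet> x}"
    using y(2) by (auto simp: inner_add_right orthogonal_def inner_commute)
  then have "negligible ((\<lambda>t. x + t *\<^sub>R v) ` {a..b})"
    using y(1) by (intro negligible_subset[OF negligible_hyperplane]) auto
  moreover have "compact ((\<lambda>t. x + t *\<^sub>R v) ` {a..b})"
    by (intro compact_continuous_image continuous_intros) auto
  then have "(\<lambda>t. x + t *\<^sub>R v) ` {a..b} \<in> sets lborel"
    using borel_compact by simp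
  ultimately show ?thesis
    by (simp add: negligible_iff_null_sets null_sets_completion_iff)
qed

text \<open>A straight coordinate segment in the fixed direction \<open>tdir X c p\<close> is future
  timelike at p and, by continuity of the metric and of the time orientation, all along if it is
  short.\<close>

lemma timelike_segment:
  fixes X :: "('p, 'n::finite) spacetime"
  assumes X: "spacetime X" and W: "openin (mtop X) W" "p \<in> W"
  obtains \<gamma> \<sigma> \<tau> where "0 < \<tau>" "\<gamma> ` {0..\<tau>} \<subseteq> W" "continuous_map (top_of_set {0..\<tau>}) (mtop X) \<gamma>"
    "curve_from_to X (future_causal X) (\<gamma> 0) (\<gamma> \<tau>) 0 \<tau> \<gamma>"
    "continuous_on {0..\<tau>} \<sigma>" "\<And>t. t \<in> {0..\<tau>} \<Longrightarrow> 0 < \<sigma> t" "\<And>t. t \<in> {0<..<\<tau>} \<Longrightarrow> speed X \<gamma> t = \<sigma> t"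
    "\<And>\<mu>. is_volume_measure X \<mu> \<Longrightarrow> \<gamma> ` {0..\<tau>} \<in> null_sets \<mu>"
proof -
  have sm: "smooth_manifold X" and dim: "2 \<le> CARD('n)" using X by (auto simp: spacetime_def)
  have "p \<in> points X" using openin_subset[OF W(1)] W(2) by blast
  then obtain c where c: "c \<in> atlas X" "p \<in> fst c" using chart_at[OF sm] by blast
  define V where "V = snd c ` fst c"
  define G where "G = (\<lambda>x. metric X c (chart_inv c x))"
  define T where "T = (\<lambda>x. tdir X c (chart_inv c x))"
  define x where "x = snd c p"
  define v where "v = tdir X c p"
  have V: "open V" "x \<in> V" using smooth_manifold_chart(2)[OF sm c(1)] c(2) by (auto simp: V_def x_def)
  have G: "continuous_on V (\<lambda>x. G x $ i $ j)" for i j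
    using continuous_on_metric[OF X c(1)] by (simp only: G_def V_def)
  have T: "continuous_on V T"
    using continuous_on_tdir[OF X c(1)] by (simp only: T_def V_def)
  have c1: "continuous_on V (\<lambda>x. v \<bullet> (G x *v v))"
    by (intro continuous_on_inner_matrix G continuous_on_const)
  have c2: "continuous_on V (\<lambda>x. v \<bullet> (G x *v T x))"
    by (intro continuous_on_inner_matrix G T continuous_on_const)
  have o1: "open ((\<lambda>x. v \<bullet> (G x *v v)) -` {..<0} \<inter> V)"
    using continuous_on_open_vimage[OF V(1), THEN iffD1, OF c1] by simp
  have o2: "open ((\<lambda>x. v \<bullet> (G x *v T x)) -` {..<0} \<inter> V)"
    using continuous_on_open_vimage[OF V(1), THEN iffD1, OF c2] by simp
  have o3: "open (snd c ` (W \<inter> fst c))"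
    using W(1) smooth_manifold_chart(1)[OF sm c(1)] by (intro open_chart_image[OF sm c(1)]) auto
  have px: "chart_inv c x = p" unfolding x_def by (rule chart_inv_chart[OF sm c])
  have "v \<bullet> (G x *v v) < 0" "v \<bullet> (G x *v T x) < 0"
    using spacetime_chartD(2)[OF X c] by (simp_all add: G_def T_def px v_def ginner_def)
  moreover have "x \<in> snd c ` (W \<inter> fst c)" using W(2) c(2) by (auto simp: x_def)
  ultimately have "x \<in> ((\<lambda>x. v \<bullet> (G x *v v)) -` {..<0} \<inter> V) \<inter> ((\<lambda>x. v \<bullet> (G x *v T x)) -` {..<0} \<inter> V) \<inter> snd c ` (W \<inter> fst c)"
    using V(2) by simp
  then obtain r where r: "0 < r"
    "ball x r \<subseteq> ((\<lambda>x. v \<bullet> (G x *v v)) -` {..<0} \<inter> V) \<inter> ((\<lambda>x. v \<bullet> (G x *v T x)) -` {..<0} \<inter> V) \<inter> snd c ` (W \<inter> fst c)"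
    by (rule openE[OF open_Int[OF open_Int[OF o1 o2] o3]]) (rule that)
  have v0: "v \<noteq> 0" using spacetime_chartD(2)[OF X c] by (auto simp: v_def ginner_def)
  \<comment> \<open>Half the radius, measured in multiples of v, keeps the closed segment inside the
    open ball.\<close>
  define \<tau> where "\<tau> = r / (2 * norm v)"
  have \<tau>: "0 < \<tau>" using r(1) v0 by (simp add: \<tau>_def)
  let ?l = "\<lambda>t. x + t *\<^sub>R v"
  have l: "?l t \<in> ball x r" if "t \<in> {0..\<tau>}" for t
  proof -
    have "\<bar>t\<bar> * norm v \<le> \<tau> * norm v" using that by (intro mult_right_mono) auto
    also have "\<dots> < r" using v0 r(1) by (simp add: \<tau>_def)
    finally show ?thesis by (simp add: dist_norm)
  qed
  define \<gamma> where "\<gamma> = (\<lambda>t. chart_inv c (?l t))"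
  \<comment> \<open>A continuous function that equals the speed at interior times; it has a positive
    minimum on the closed interval.\<close>
  define \<sigma> where "\<sigma> = (\<lambda>t. sqrt (- (v \<bullet> (G (?l t) *v v))))"
  have lV: "?l t \<in> snd c ` fst c" "v \<bullet> (G (?l t) *v v) < 0" "v \<bullet> (G (?l t) *v T (?l t)) < 0"
    "?l t \<in> snd c ` (W \<inter> fst c)" if "t \<in> {0..\<tau>}" for t
    using l[OF that] r(2) unfolding V_def by blast+
  have \<gamma>c: "\<gamma> t \<in> fst c" "snd c (\<gamma> t) = ?l t" if "t \<in> {0..\<tau>}" for t
    using chart_chart_inv[OF lV(1)[OF that]] by (auto simp: \<gamma>_def)
  have \<gamma>W: "\<gamma> ` {0..\<tau>} \<subseteq> W"
  proof
    fix q assume "q \<in> \<gamma> ` {0..\<tau>}"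
    then obtain t where t: "t \<in> {0..\<tau>}" "q = \<gamma> t" by blast
    obtain q' where "q' \<in> W \<inter> fst c" "?l t = snd c q'" using lV(4)[OF t(1)] by blast
    then show "q \<in> W" using t(2) chart_inv_chart[OF sm c(1)] by (auto simp: \<gamma>_def)
  qed
  have "continuous_on {0..\<tau>} ?l" by (intro continuous_intros)
  then have "continuous_map (top_of_set {0..\<tau>}) (top_of_set (snd c ` fst c)) ?l"
    using lV(1) by (auto simp: continuous_map_in_subtopology)
  from continuous_map_compose[OF this continuous_map_chart_inv[OF sm c(1)]]
  have cont: "continuous_map (top_of_set {0..\<tau>}) (mtop X) \<gamma>"
    by (simp add: \<gamma>_def o_def)
  have der: "((snd c \<circ> \<gamma>) has_vector_derivative v) (at s within {a..b})"
    if "s \<in> {a..b}" "{a..b} \<subseteq> {0..\<tau>}" for s a b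
  proof (rule has_vector_derivative_transform[OF that(1)])
    show "(?l has_vector_derivative v) (at s within {a..b})"
      by (auto intro!: derivative_eq_intros)
    show "(snd c \<circ> \<gamma>) y = ?l y" if "y \<in> {a..b}" for y
      using \<gamma>c(2) that \<open>{a..b} \<subseteq> {0..\<tau>}\<close> by auto
  qed
  have fc: "future_causal X c (\<gamma> t) v" if "t \<in> {0..\<tau>}" for t
    using lV(2,3)[OF that] v0 by (simp add: future_causal_def ginner_def G_def T_def \<gamma>_def)
  have arc: "C1_arc X (future_causal X) a b \<gamma>" if ab: "a < b" "{a..b} \<subseteq> {0..\<tau>}" for a b
  proof -
    \<comment> \<open>The velocity is the constant v in the chart c; composing with the identity
      transfers this to all other charts.\<close>
    have "C1_arc X (future_causal X) a b (id \<circ> \<gamma>)"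
    proof (rule C1_arc_push[OF local_isometry_id[OF X] ab(1)])
      show "continuous_map (top_of_set {a..b}) (mtop X) \<gamma>"
        by (rule continuous_map_from_subtopology_mono[OF cont ab(2)])
      fix t assume "t \<in> {a..b}"
      then have t: "\<gamma> t \<in> fst c" using \<gamma>c(1) ab(2) by blast
      show "\<exists>c\<in>atlas X. \<gamma> t \<in> fst c \<and>
        (\<exists>w. continuous_on ({a..b} \<inter> \<gamma> -` fst c) w \<and>
          (\<forall>s\<in>{a..b} \<inter> \<gamma> -` fst c. ((snd c \<circ> \<gamma>) has_vector_derivative w s) (at s within {a..b}) \<and>
            future_causal X c (\<gamma> s) (w s)))"
      proof (intro bexI[OF _ c(1)] conjI exI[of _ "\<lambda>_. v"] ballI t continuous_on_const)
        fix s assume "s \<in> {a..b} \<inter> \<gamma> -` fst c"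
        then have s: "s \<in> {a..b}" "s \<in> {0..\<tau>}" using ab(2) by auto
        show "((snd c \<circ> \<gamma>) has_vector_derivative v) (at s within {a..b})" by (rule der[OF s(1) ab(2)])
        show "future_causal X c (\<gamma> s) v" by (rule fc[OF s(2)])
      qed
    qed
    then show ?thesis by simp
  qed
  have pw: "pw_curve X (future_causal X) {0..\<tau>} \<gamma>"
    unfolding pw_curve_def
    using arc by (intro conjI is_interval_cc cont exI[of _ "{}"] ballI impI) auto
  have cont\<sigma>: "continuous_on {0..\<tau>} \<sigma>"
    unfolding \<sigma>_def
    by (intro continuous_on_real_sqrt continuous_on_minus continuous_on_compose2[OF c1 \<open>continuous_on {0..\<tau>} ?l\<close>])
      (use lV(1) in \<open>auto simp: V_def\<close>)
  have sp: "speed X \<gamma> t = \<sigma> t" if t: "t \<in> {0<..<\<tau>}" for t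
  proof -
    have tt: "t \<in> {0..\<tau>}" "0 < t" "t < \<tau>" using t by auto
    have idc: "id (\<gamma> t) \<in> fst c" using \<gamma>c(1)[OF tt(1)] by simp
    obtain u where u: "((snd c \<circ> (id \<circ> \<gamma>)) has_vector_derivative u) (at t)"
      "speed X \<gamma> t = sqrt (- ginner X c (id (\<gamma> t)) u u)"
      by (rule speed_push[OF local_isometry_id[OF X] cont arc[OF \<tau> order_refl] tt(2,3) c(1) idc]) (rule that)
    have "((snd c \<circ> \<gamma>) has_vector_derivative v) (at t)"
      using der[OF tt(1) order_refl] at_within_Icc_at[OF tt(2,3)] by simp
    then have "u = v"
      using u(1) vector_derivative_unique_at[of "snd c \<circ> \<gamma>" u t v] by simp
    then show ?thesis using u(2) by (simp add: \<sigma>_def G_def \<gamma>_def ginner_def)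
  qed
  have null: "\<gamma> ` {0..\<tau>} \<in> null_sets \<mu>" if \<mu>: "is_volume_measure X \<mu>" for \<mu>
  proof -
    have "compactin (mtop X) (\<gamma> ` {0..\<tau>})"
      by (rule image_compactin[OF _ cont]) (simp add: compactin_subtopology)
    then have "closedin (mtop X) (\<gamma> ` {0..\<tau>})"
      using sm by (auto simp: smooth_manifold_def intro: compactin_imp_closedin)
    then have S: "\<gamma> ` {0..\<tau>} \<in> sets \<mu>" by (rule closedin_sets_volume[OF \<mu>])
    have "\<gamma> ` {0..\<tau>} \<subseteq> fst c" using \<gamma>c(1) by auto
    from is_volume_measureD(3)[OF \<mu> c(1) S this]
    have "emeasure \<mu> (\<gamma> ` {0..\<tau>}) =
      (\<integral>\<^sup>+x\<in>snd c ` \<gamma> ` {0..\<tau>}. ennreal (sqrt \<bar>det (metric X c (chart_inv c x))\<bar>) \<partial>lborel)" .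
    also have "snd c ` \<gamma> ` {0..\<tau>} = ?l ` {0..\<tau>}"
      unfolding image_image using \<gamma>c(2) by (intro image_cong) auto
    also have "(\<integral>\<^sup>+x\<in>?l ` {0..\<tau>}. ennreal (sqrt \<bar>det (metric X c (chart_inv c x))\<bar>) \<partial>lborel) = 0"
      using dim by (intro nn_integral_null_set segment_null_sets) simp
    finally show ?thesis using S by auto
  qed
  show thesis
  proof (rule that[OF \<tau> \<gamma>W cont _ cont\<sigma> _ sp null])
    show "curve_from_to X (future_causal X) (\<gamma> 0) (\<gamma> \<tau>) 0 \<tau> \<gamma>"
      using \<tau> pw by (simp add: curve_from_to_def)
    show "0 < \<sigma> t" if "t \<in> {0..\<tau>}" for t using lV(2)[OF that] by (simp add: \<sigma>_def)
  qed
qed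

section \<open>Long curves of small volume\<close>

lemma speed_conformal:
  "speed (conformal \<Omega> M) \<gamma> t = sqrt (\<Omega> (\<gamma> t)) * speed M \<gamma> t"
  by (simp add: speed_def Let_def real_sqrt_mult real_sqrt_minus)

lemma lorentz_dist_conformal_ge:
  assumes \<Omega>: "\<And>p. 0 < \<Omega> p" and cont: "continuous_map (mtop X) euclidean \<Omega>"
    and \<tau>: "0 < \<tau>" and \<gamma>: "continuous_map (top_of_set {0..\<tau>}) (mtop X) \<gamma>"
    "curve_from_to X (future_causal X) (\<gamma> 0) (\<gamma> \<tau>) 0 \<tau> \<gamma>"
    and \<sigma>: "continuous_on {0..\<tau>} \<sigma>" "\<And>t. t \<in> {0<..<\<tau>} \<Longrightarrow> speed X \<gamma> t = \<sigma> t"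
    and low: "0 \<le> l" "\<And>t. t \<in> {0..\<tau>} \<Longrightarrow> l \<le> \<sigma> t" "0 \<le> \<omega>" "\<And>t. t \<in> {0..\<tau>} \<Longrightarrow> \<omega> \<le> \<Omega> (\<gamma> t)"
  shows "ennreal (\<tau> * (sqrt \<omega> * l)) \<le> lorentz_dist (conformal \<Omega> X) (\<gamma> 0) (\<gamma> \<tau>)"
proof -
  let ?Y = "conformal \<Omega> X" and ?h = "\<lambda>t. sqrt (\<Omega> (\<gamma> t)) * \<sigma> t"
  have curve: "curve_from_to ?Y (future_causal ?Y) (\<gamma> 0) (\<gamma> \<tau>) 0 \<tau> \<gamma>"
    using \<gamma>(2) by (simp add: curve_from_to_conformal future_causal_conformal[OF \<Omega>])
  have "\<gamma> ` {0..\<tau>} \<subseteq> points X"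
    using continuous_map_image_subset_topspace[OF \<gamma>(1)] by simp
  then have "\<gamma> 0 \<in> points X" "\<gamma> \<tau> \<in> points X" using \<tau> by auto
  then have le: "causal_le ?Y (\<gamma> 0) (\<gamma> \<tau>)"
    unfolding causal_le_def using curve by auto
  have "continuous_map (top_of_set {0..\<tau>}) euclidean (\<Omega> \<circ> \<gamma>)"
    by (rule continuous_map_compose[OF \<gamma>(1) cont])
  then have "continuous_on {0..\<tau>} (\<lambda>t. \<Omega> (\<gamma> t))" by (simp add: o_def)
  then have "continuous_on {0..\<tau>} ?h"
    by (intro continuous_on_mult continuous_on_real_sqrt \<sigma>(1))
  then have int: "?h integrable_on {0..\<tau>}" by (rule integrable_continuous_real)
  have "((\<lambda>t. sqrt \<omega> * l) has_integral \<tau> * (sqrt \<omega> * l)) {0..\<tau>}"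
    using has_integral_const_real[of "sqrt \<omega> * l" 0 \<tau>] \<tau> by simp
  then have "\<tau> * (sqrt \<omega> * l) \<le> integral {0..\<tau>} ?h"
  proof (rule has_integral_le[OF _ integrable_integral[OF int]])
    fix t assume t: "t \<in> {0..\<tau>}"
    have "sqrt \<omega> \<le> sqrt (\<Omega> (\<gamma> t))" using low(4)[OF t] by simp
    then show "sqrt \<omega> * l \<le> ?h t"
      using low(1) low(2)[OF t] low(3) \<Omega>[of "\<gamma> t"] by (intro mult_mono) auto
  qed
  also have "integral {0..\<tau>} ?h = integral {0..\<tau>} (speed ?Y \<gamma>)"
    by (rule integral_spike[of "{0, \<tau>}"]) (auto simp: speed_conformal \<sigma>(2))
  finally have "ennreal (\<tau> * (sqrt \<omega> * l)) \<le> ennreal (lorentz_length ?Y 0 \<tau> \<gamma>)"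
    unfolding lorentz_length_def by (rule ennreal_leI)
  also have "\<dots> \<le> lorentz_dist ?Y (\<gamma> 0) (\<gamma> \<tau>)"
    unfolding lorentz_dist_def using le curve by (auto intro!: Sup_upper)
  finally show ?thesis .
qed

text \<open>Every correspondence pairs x and y with points of X, whose distance is at most m; the
  distortion is therefore at least D + 1. The extra 1 keeps the inequality strict after passing to
  the infimum.\<close>

lemma d_minus_gt:
  assumes m: "0 \<le> m" "\<And>x y. lorentz_dist X x y \<le> ennreal m" and D: "0 < D"
    and xy: "x \<in> points Y" "y \<in> points Y" "ennreal (m + D + 1) \<le> lorentz_dist Y x y"
  shows "ereal D < d_minus X Y"
proof -
  have "ereal (D + 1) \<le> distortion X Y \<rho>" if \<rho>: "\<rho> \<in> Corr (points X) (points Y)" for \<rho>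
  proof -
    have "x \<in> snd ` \<rho>" "y \<in> snd ` \<rho>" using \<rho> xy(1,2) by (auto simp: Corr_def)
    then obtain x' y' where *: "(x', x) \<in> \<rho>" "(y', y) \<in> \<rho>" by auto
    have "enn2ereal (lorentz_dist X x' y') \<le> ereal m"
      using m(2)[of x' y'] m(1) by (simp add: less_eq_ennreal.rep_eq enn2ereal_ennreal)
    moreover have "ereal (m + D + 1) \<le> enn2ereal (lorentz_dist Y x y)"
    proof -
      have "enn2ereal (ennreal (m + D + 1)) = ereal (m + D + 1)"
        using m(1) D by (intro enn2ereal_ennreal) simp
      then show ?thesis using xy(3) unfolding less_eq_ennreal.rep_eq by (simp only:)
    qed
    moreover have "0 \<le> enn2ereal (lorentz_dist X x' y')" by simp
    ultimately have "ereal (D + 1) \<le> \<bar>enn2ereal (lorentz_dist X x' y') - enn2ereal (lorentz_dist Y x y)\<bar>"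
      by (cases "enn2ereal (lorentz_dist X x' y')"; cases "enn2ereal (lorentz_dist Y x y)") auto
    also have "\<dots> \<le> distortion X Y \<rho>"
      unfolding distortion_def using *
      by (intro SUP_upper2[of "((x', x), (y', y))"]) auto
    finally show ?thesis .
  qed
  then have "ereal (D + 1) \<le> d_minus X Y"
    unfolding d_minus_def by (intro INF_greatest)
  moreover have "ereal D < ereal (D + 1)" by simp
  ultimately show ?thesis by (rule less_le_trans[rotated])
qed

text \<open>Preimages under the chart and f of shrinking neighbourhoods of the compact set C
  decrease to S, since C is closed and both maps are injective. As S is null and the measure finite,
  their measures tend to 0. The volume property is a premise of the measure clauses only, so that
  the same construction serves both cases of the final proof.\<close>

lemma concentrated_bump:
  fixes f :: "'p \<Rightarrow> 'q" and X :: "('p, 'n::finite) spacetime" and N :: "('q, 'n) spacetime"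
  assumes f: "local_isometry X N f" "inj_on f (points X)" and d: "d \<in> atlas N"
    and \<mu>: "is_volume_measure X \<mu> \<Longrightarrow> finite_measure \<mu>" and \<eta>: "0 < \<eta>"
    and Sne: "S \<noteq> {}" and S: "compactin (mtop X) S" "f ` S \<subseteq> fst d" "is_volume_measure X \<mu> \<Longrightarrow> S \<in> null_sets \<mu>"
  obtains u E where "smooth_fun N u" "\<And>p. 0 \<le> u p" "\<And>p. u p \<le> 1" "\<And>p. p \<in> S \<Longrightarrow> 1 / 2 \<le> u (f p)"
    "openin (mtop X) E" "\<And>p. p \<in> points X \<Longrightarrow> p \<notin> E \<Longrightarrow> u (f p) = 0"
    "is_volume_measure X \<mu> \<Longrightarrow> measure \<mu> E \<le> \<eta>"
proof -
  note smX = local_isometryD(3)[OF f(1)] and smN = local_isometryD(4)[OF f(1)] and cf = local_isometryD(6)[OF f(1)]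
  define C where "C = snd d ` f ` S"
  define V where "V = snd d ` fst d"
  have V: "open V" unfolding V_def by (rule smooth_manifold_chart(2)[OF smN d])
  have SX: "S \<subseteq> points X" using S(1) by (simp add: compactin_def)
  have CV: "C \<subseteq> V" using S(2) by (auto simp: C_def V_def)
  have "compactin (mtop N) (f ` S)" by (rule image_compactin[OF S(1) cf])
  then have "compactin (subtopology (mtop N) (fst d)) (f ` S)"
    using S(2) by (simp add: compactin_subtopology)
  then have "compactin euclidean C"
    unfolding C_def by (rule image_compactin[OF _ continuous_map_chart[OF smN d]])
  then have C: "compact C" by simp
  define W where "W = (\<lambda>k::nat. V \<inter> {x. infdist x C < 1 / (real k + 1)})"
  define E where "E = (\<lambda>k. {p \<in> points X. f p \<in> {q \<in> fst d. snd d q \<in> W k}})"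
  have W: "open (W k)" "C \<subseteq> W k" for k
  proof -
    show "open (W k)" unfolding W_def by (intro open_Int V open_Collect_less continuous_intros)
    show "C \<subseteq> W k" using CV by (auto simp: W_def)
  qed
  have E: "openin (mtop X) (E k)" for k
    unfolding E_def by (rule openin_continuous_map_preimage[OF cf openin_chart_preimage[OF smN d W(1)]])
  have "\<exists>k. is_volume_measure X \<mu> \<longrightarrow> measure \<mu> (E k) \<le> \<eta>"
  proof (cases "is_volume_measure X \<mu>")
    case vol: True
    have ne: "C \<noteq> {}" using Sne by (simp add: C_def)
    interpret finite_measure \<mu> by (rule \<mu>[OF vol])
    have "1 / (real n + 1) \<le> 1 / (real m + 1)" if "m \<le> n" for m n
      using that by (simp add: frac_le)
    then have dec: "decseq E"
      unfolding decseq_def E_def W_def by (fastforce intro: less_le_trans)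
    have "(\<Inter>k. E k) = S"
    proof (intro equalityI subsetI)
      fix p assume p: "p \<in> (\<Inter>k. E k)"
      let ?x = "snd d (f p)"
      have pX: "p \<in> points X" "f p \<in> fst d" and inf: "infdist ?x C < 1 / (real k + 1)" for k
        using p by (auto simp: E_def W_def)
      have "infdist ?x C = 0"
      proof (rule ccontr)
        assume "infdist ?x C \<noteq> 0"
        then have "0 < infdist ?x C" using infdist_nonneg[of ?x C] by linarith
        then obtain k where "1 / (real k + 1) < infdist ?x C"
          using nat_approx_posE[of "infdist ?x C"] by (auto simp: add.commute)
        then show False using inf[of k] by simp
      qed
      then have "?x \<in> C"
        using in_closed_iff_infdist_zero[OF compact_imp_closed[OF C] ne] by simp
      then obtain q where q: "q \<in> S" "?x = snd d (f q)" by (auto simp: C_def)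
      then have "f p = f q"
        using inj_onD[OF chart_inj[OF smN d] q(2)] pX S(2) by auto
      then show "p \<in> S" using inj_onD[OF f(2)] pX(1) q(1) SX by auto
    next
      fix p assume p: "p \<in> S"
      then have "snd d (f p) \<in> W k" for k using W(2)[of k] by (auto simp: C_def)
      then show "p \<in> (\<Inter>k. E k)" using p SX S(2) by (auto simp: E_def)
    qed
    then have "measure \<mu> (\<Inter>k. E k) = 0" using S(3)[OF vol] by (simp add: measure_eq_0_null_sets)
    moreover have "(\<lambda>k. measure \<mu> (E k)) \<longlonglongrightarrow> measure \<mu> (\<Inter>k. E k)"
      using openin_sets_volume[OF vol E] dec by (intro finite_Lim_measure_decseq) auto
    ultimately have "(\<lambda>k. measure \<mu> (E k)) \<longlonglongrightarrow> 0" by simp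
    then have "\<forall>\<^sub>F k in sequentially. measure \<mu> (E k) < \<eta>" using \<eta> by (rule order_tendstoD(2))
    then obtain k where "measure \<mu> (E k) < \<eta>" by (auto simp: eventually_sequentially)
    then show ?thesis by (intro exI[of _ k]) simp
  qed simp
  then obtain k where k: "is_volume_measure X \<mu> \<Longrightarrow> measure \<mu> (E k) \<le> \<eta>" by blast
  obtain \<phi> :: "real ^ 'n \<Rightarrow> real" and K where \<phi>: "smooth_on UNIV \<phi>" and K: "compact K" "K \<subseteq> W k"
    and \<phi>': "\<And>x. 0 \<le> \<phi> x" "\<And>x. \<phi> x \<le> 1" "\<And>x. x \<in> C \<Longrightarrow> 1 / 2 \<le> \<phi> x" and \<phi>0: "\<And>x. x \<notin> K \<Longrightarrow> \<phi> x = 0"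
    by (rule smooth_bump[OF C W[of k]]) (rule that)
  let ?u = "\<lambda>p. if p \<in> fst d then \<phi> (snd d p) else 0"
  have KV: "K \<subseteq> snd d ` fst d" using K(2) by (auto simp: W_def V_def)
  show thesis
  proof (rule that[of ?u "E k"])
    show "smooth_fun N ?u" by (rule smooth_fun_extend_by_0[OF smN d \<phi> K(1) KV \<phi>0])
    show "0 \<le> ?u p" "?u p \<le> 1" for p using \<phi>' by auto
    show "1 / 2 \<le> ?u (f p)" if "p \<in> S" for p
      using that S(2) \<phi>'(3)[of "snd d (f p)"] by (auto simp: C_def)
    show "openin (mtop X) (E k)" by (rule E)
    show "?u (f p) = 0" if "p \<in> points X" "p \<notin> E k" for p
      using that \<phi>0 K(2) by (auto simp: E_def)
    show "measure \<mu> (E k) \<le> \<eta>" if "is_volume_measure X \<mu>" by (rule k[OF that])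
  qed
qed

text \<open>The factor is \<open>\<alpha>\<^sup>2 (1 + L u)\<close>, where \<open>u\<close> is a bump along a short timelike curve. The number
  \<open>L\<close> makes the curve long; the support of \<open>u\<close> is then chosen so small that the
  normalization \<open>\<alpha>\<close> which restores the volume is close to \<open>1\<close>.\<close>

lemma exists_conformal_factor:
  fixes X N :: "('p, 'n::finite) spacetime"
  assumes f: "local_isometry X N f" "inj_on f (points X)" and ne: "points X \<noteq> {}"
    and \<mu>: "is_volume_measure X \<mu> \<Longrightarrow> prob_space \<mu>" and \<delta>: "0 < \<delta>" "\<delta> \<le> 1" and R: "0 < R"
  obtains \<Omega> x y where "smooth_fun N \<Omega>" "\<And>p. 0 < \<Omega> p" "x \<in> points X" "y \<in> points X"
    "ennreal R \<le> lorentz_dist (conformal (\<lambda>p. \<Omega> (f p)) X) x y"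
    "is_volume_measure X \<mu> \<Longrightarrow> (\<integral>\<^sup>+p. ennreal (sqrt (\<Omega> (f p)) ^ CARD('n)) \<partial>\<mu>) = 1"
    "\<And>p. 1 - \<delta> \<le> sqrt (\<Omega> (f p)) ^ CARD('n)"
proof -
  note smX = local_isometryD(3)[OF f(1)] and smN = local_isometryD(4)[OF f(1)] and cf = local_isometryD(6)[OF f(1)]
  obtain p0 where p0: "p0 \<in> points X" using ne by blast
  then have "f p0 \<in> points N" using continuous_map_image_subset_topspace[OF cf] by blast
  then obtain d where d: "d \<in> atlas N" "f p0 \<in> fst d" using chart_at[OF smN] by blast
  let ?W = "{p \<in> points X. f p \<in> fst d}"
  have W: "openin (mtop X) ?W" "p0 \<in> ?W"
    using openin_continuous_map_preimage[OF cf smooth_manifold_chart(1)[OF smN d(1)]] p0 d(2) by auto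
  obtain \<gamma> \<sigma> \<tau> where \<tau>: "0 < \<tau>" and \<gamma>W: "\<gamma> ` {0..\<tau>} \<subseteq> ?W"
    and \<gamma>: "continuous_map (top_of_set {0..\<tau>}) (mtop X) \<gamma>"
      "curve_from_to X (future_causal X) (\<gamma> 0) (\<gamma> \<tau>) 0 \<tau> \<gamma>"
    and \<sigma>: "continuous_on {0..\<tau>} \<sigma>" "\<And>t. t \<in> {0..\<tau>} \<Longrightarrow> 0 < \<sigma> t" "\<And>t. t \<in> {0<..<\<tau>} \<Longrightarrow> speed X \<gamma> t = \<sigma> t"
    and null: "\<And>\<mu>. is_volume_measure X \<mu> \<Longrightarrow> \<gamma> ` {0..\<tau>} \<in> null_sets \<mu>"
    by (rule timelike_segment[OF local_isometryD(1)[OF f(1)] W]) (rule that)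
  obtain t0 where t0: "t0 \<in> {0..\<tau>}" "\<And>t. t \<in> {0..\<tau>} \<Longrightarrow> \<sigma> t0 \<le> \<sigma> t"
    using continuous_attains_inf[OF _ _ \<sigma>(1)] \<tau> by auto
  define l where "l = \<sigma> t0"
  have l: "0 < l" using \<sigma>(2)[OF t0(1)] by (simp add: l_def)
  \<comment> \<open>On the curve the factor is at least \<open>(1 / 2)\<^sup>2 * (L / 2)\<close>,
    that is \<open>L / 8\<close>, from \<alpha> \<ge> 1/2 and \<open>u\<close> \<ge> 1/2. This L
    makes the resulting lower bound for the length equal to R.\<close>
  define L where "L = 8 * (R / (\<tau> * l))\<^sup>2"
  have L: "0 < L" using R \<tau> l by (simp add: L_def)
  \<comment> \<open>The largest density that the factor without \<alpha> can produce; a support of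
    measure at most \<open>\<delta> / b\<close> therefore adds at most \<delta> to the
    volume.\<close>
  define b where "b = sqrt (1 + L) ^ CARD('n)"
  have b: "1 \<le> b" unfolding b_def using L by (intro one_le_power) simp
  have cpt: "compactin (mtop X) (\<gamma> ` {0..\<tau>})"
    by (rule image_compactin[OF _ \<gamma>(1)]) (simp add: compactin_subtopology)
  have \<eta>: "0 < \<delta> / b" using \<delta>(1) b by simp
  have fin: "finite_measure \<mu>" if "is_volume_measure X \<mu>"
    using \<mu>[OF that] by (simp add: prob_space_def)
  have Sne: "\<gamma> ` {0..\<tau>} \<noteq> {}" using \<tau> by simp
  have sub: "f ` \<gamma> ` {0..\<tau>} \<subseteq> fst d" using \<gamma>W by auto
  obtain u E where u: "smooth_fun N u" "\<And>p. 0 \<le> u p" "\<And>p. u p \<le> 1" "\<And>p. p \<in> \<gamma> ` {0..\<tau>} \<Longrightarrow> 1 / 2 \<le> u (f p)"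
    and E: "openin (mtop X) E" "\<And>p. p \<in> points X \<Longrightarrow> p \<notin> E \<Longrightarrow> u (f p) = 0"
      "is_volume_measure X \<mu> \<Longrightarrow> measure \<mu> E \<le> \<delta> / b"
    by (rule concentrated_bump[OF f d(1) fin \<eta> Sne cpt sub null]; (assumption | rule that))
  define w where "w = (\<lambda>p. sqrt (1 + L * u (f p)) ^ CARD('n))"
  have w: "1 \<le> w p" "w p \<le> b" for p
  proof -
    show "1 \<le> w p" unfolding w_def using L u(2)[of "f p"] by (intro one_le_power) simp
    have "L * u (f p) \<le> L" using L u(3)[of "f p"] by (simp add: mult_left_le)
    then show "w p \<le> b" unfolding w_def b_def using L u(2)[of "f p"] by (intro power_mono) auto
  qed
  have cu: "continuous_map (mtop X) euclidean (\<lambda>p. u (f p))"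
    by (rule smooth_fun_imp_continuous_map[OF smX smooth_fun_comp[OF smX smN local_isometryD(5)[OF f(1)] u(1)]])
  \<comment> \<open>I is the volume before normalization. Without a volume measure it takes the
    value 1 by convention, so that one definition of \<alpha> covers both cases.\<close>
  have "\<exists>I\<ge>1. I \<le> 1 + \<delta> \<and> (is_volume_measure X \<mu> \<longrightarrow> (\<integral>\<^sup>+p. ennreal (w p) \<partial>\<mu>) = ennreal I)"
  proof (cases "is_volume_measure X \<mu>")
    case True
    interpret prob_space \<mu> by (rule \<mu>[OF True])
    have Es: "E \<in> sets \<mu>" by (rule openin_sets_volume[OF True E(1)])
    have "(\<integral>\<^sup>+p. ennreal (w p) \<partial>\<mu>) \<le> (\<integral>\<^sup>+p. ennreal 1 + ennreal b * indicator E p \<partial>\<mu>)"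
    proof (intro nn_integral_mono)
      fix p assume "p \<in> space \<mu>"
      then have "p \<notin> E \<Longrightarrow> w p = 1"
        using E(2) is_volume_measureD(1)[OF True] by (simp add: w_def)
      moreover have "ennreal (w p) \<le> ennreal (1 + b)" using w(2)[of p] by (intro ennreal_leI) simp
      moreover have "ennreal (1 + b) = ennreal 1 + ennreal b" using b by (intro ennreal_plus) auto
      ultimately show "ennreal (w p) \<le> ennreal 1 + ennreal b * indicator E p"
        by (auto simp: indicator_def)
    qed
    also have "\<dots> = ennreal 1 + ennreal b * emeasure \<mu> E"
      using Es by (simp add: nn_integral_add nn_integral_cmult emeasure_space_1)
    also have "\<dots> = ennreal (1 + b * measure \<mu> E)"
      using b by (simp add: emeasure_eq_measure ennreal_mult)
    also have "\<dots> \<le> ennreal (1 + \<delta>)"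
      using E(3)[OF True] b by (intro ennreal_leI) (simp add: field_simps)
    finally have up: "(\<integral>\<^sup>+p. ennreal (w p) \<partial>\<mu>) \<le> ennreal (1 + \<delta>)" .
    have "(\<integral>\<^sup>+p. ennreal 1 \<partial>\<mu>) \<le> (\<integral>\<^sup>+p. ennreal (w p) \<partial>\<mu>)"
      using w(1) by (intro nn_integral_mono ennreal_leI)
    then have low: "1 \<le> (\<integral>\<^sup>+p. ennreal (w p) \<partial>\<mu>)" by (simp add: emeasure_space_1)
    obtain I where I: "(\<integral>\<^sup>+p. ennreal (w p) \<partial>\<mu>) = ennreal I" "0 \<le> I"
      using up by (cases "\<integral>\<^sup>+p. ennreal (w p) \<partial>\<mu>") (auto simp: top_unique)
    have "I \<le> 1 + \<delta>" using up \<delta> unfolding I(1) by (subst (asm) ennreal_le_iff) auto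
    moreover have "1 \<le> I" using low I by simp
    ultimately show ?thesis using I(1) by (intro exI[of _ I]) auto
  qed (use \<delta> in \<open>auto intro!: exI[of _ 1]\<close>)
  then obtain I where I: "1 \<le> I" "I \<le> 1 + \<delta>"
    "is_volume_measure X \<mu> \<Longrightarrow> (\<integral>\<^sup>+p. ennreal (w p) \<partial>\<mu>) = ennreal I" by blast
  \<comment> \<open>The metric is multiplied by \<open>\<alpha>\<^sup>2\<close>, the volume by the
    n-th power of \<alpha>; the n-th root makes this power \<open>1 / I\<close>.\<close>
  define \<alpha> where "\<alpha> = root CARD('n) (1 / I)"
  have \<alpha>n: "\<alpha> ^ CARD('n) = 1 / I" using I(1) by (simp add: \<alpha>_def)
  have \<alpha>: "1 / 2 \<le> \<alpha>"
  proof (rule ccontr)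
    assume "\<not> 1 / 2 \<le> \<alpha>"
    then have "\<alpha> ^ CARD('n) < (1 / 2) ^ CARD('n)"
      using I(1) by (intro power_strict_mono) (auto simp: \<alpha>_def)
    also have "\<dots> \<le> (1 / 2) ^ 1" by (rule power_decreasing) (auto simp: Suc_leI)
    also have "\<dots> \<le> 1 / I" using I(1,2) \<delta>(2) by (simp add: field_simps)
    finally show False using \<alpha>n by simp
  qed
  define \<Omega> where "\<Omega> = (\<lambda>p. \<alpha>\<^sup>2 * (1 + L * u p))"
  have \<Omega>pos: "0 < \<Omega> p" for p
    unfolding \<Omega>_def using \<alpha> L u(2)[of p] by (intro mult_pos_pos add_pos_nonneg) auto
  have \<Omega>sm: "smooth_fun N \<Omega>"
    unfolding \<Omega>_def by (rule smooth_fun_affine[OF smN u(1)])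
  have sqrt\<Omega>: "sqrt (\<Omega> (f p)) ^ CARD('n) = w p / I" for p
    using \<alpha> by (simp add: \<Omega>_def w_def real_sqrt_mult power_mult_distrib \<alpha>n)
  have c\<Omega>: "continuous_map (mtop X) euclidean (\<lambda>p. \<Omega> (f p))"
    by (rule smooth_fun_imp_continuous_map[OF smX smooth_fun_comp[OF smX smN local_isometryD(5)[OF f(1)] \<Omega>sm]])
  have low: "L / 8 \<le> \<Omega> (f (\<gamma> t))" if "t \<in> {0..\<tau>}" for t
  proof -
    have "1 / 2 \<le> u (f (\<gamma> t))" using that by (intro u(4)) auto
    then have "L * (1 / 2) \<le> L * u (f (\<gamma> t))" using L by (intro mult_left_mono) auto
    then have "L / 2 \<le> 1 + L * u (f (\<gamma> t))" by simp
    moreover have "(1 / 2)\<^sup>2 \<le> \<alpha>\<^sup>2" using \<alpha> by (intro power_mono) auto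
    ultimately have "(1 / 2)\<^sup>2 * (L / 2) \<le> \<Omega> (f (\<gamma> t))"
      unfolding \<Omega>_def using L by (intro mult_mono) auto
    then show ?thesis by (simp add: power2_eq_square)
  qed
  have "ennreal (\<tau> * (sqrt (L / 8) * l)) \<le> lorentz_dist (conformal (\<lambda>p. \<Omega> (f p)) X) (\<gamma> 0) (\<gamma> \<tau>)"
    by (rule lorentz_dist_conformal_ge[OF \<Omega>pos c\<Omega> \<tau> \<gamma> \<sigma>(1,3)]) (use l t0(2) L low in \<open>auto simp: l_def\<close>)
  moreover have "\<tau> * (sqrt (L / 8) * l) = R"
    using R \<tau> l by (simp add: L_def)
  ultimately have dist: "ennreal R \<le> lorentz_dist (conformal (\<lambda>p. \<Omega> (f p)) X) (\<gamma> 0) (\<gamma> \<tau>)" by simp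
  have int: "(\<integral>\<^sup>+p. ennreal (sqrt (\<Omega> (f p)) ^ CARD('n)) \<partial>\<mu>) = 1" if vol: "is_volume_measure X \<mu>"
  proof -
    have "(\<lambda>p. u (f p)) \<in> borel_measurable \<mu>" by (rule continuous_map_borel_volume[OF vol cu])
    then have wm: "w \<in> borel_measurable \<mu>" unfolding w_def by measurable
    have "(\<integral>\<^sup>+p. ennreal (sqrt (\<Omega> (f p)) ^ CARD('n)) \<partial>\<mu>) = (\<integral>\<^sup>+p. ennreal (1 / I) * ennreal (w p) \<partial>\<mu>)"
    proof (intro nn_integral_cong)
      fix p
      have "0 \<le> w p" using w(1)[of p] by simp
      then show "ennreal (sqrt (\<Omega> (f p)) ^ CARD('n)) = ennreal (1 / I) * ennreal (w p)"
        using I(1) by (simp add: sqrt\<Omega> flip: ennreal_mult)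
    qed
    also have "\<dots> = ennreal (1 / I) * (\<integral>\<^sup>+p. ennreal (w p) \<partial>\<mu>)"
      using wm by (intro nn_integral_cmult) measurable
    also have "\<dots> = ennreal (1 / I * I)"
      unfolding I(3)[OF vol] using I(1) by (intro ennreal_mult[symmetric]) auto
    finally show ?thesis using I(1) by simp
  qed
  have wlow: "1 - \<delta> \<le> sqrt (\<Omega> (f p)) ^ CARD('n)" for p
  proof -
    \<comment> \<open>The density is \<open>w p / I\<close> with \<open>w p\<close> \<ge> 1, so
      \<open>(1 - \<delta>) * (1 + \<delta>)\<close> \<le> 1 gives the lower bound.\<close>
    have "(1 - \<delta>) * I \<le> (1 - \<delta>) * (1 + \<delta>)" using I(2) \<delta> by (intro mult_left_mono) auto
    also have "\<dots> \<le> 1" using \<delta> by (simp add: algebra_simps)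
    also have "\<dots> \<le> w p" by (rule w(1))
    finally show ?thesis using I(1) by (simp add: sqrt\<Omega> field_simps)
  qed
  have "\<gamma> 0 \<in> ?W" "\<gamma> \<tau> \<in> ?W" using \<tau> by (intro subsetD[OF \<gamma>W] imageI; simp)+
  then have "\<gamma> 0 \<in> points X" "\<gamma> \<tau> \<in> points X" by simp_all
  then show thesis by (rule that[OF \<Omega>sm \<Omega>pos _ _ dist int wlow])
qed

theorem theorem3:
  fixes K :: nat and \<epsilon> D :: real and X :: "('p, 'n::finite) spacetime"
  assumes "0 < \<epsilon>" and "\<epsilon> < 1 / 2" and "0 < D"
    and "spatially_compact_slab X" and "total_volume X = 1"
  shows "\<exists>Y \<in> (CS :: ('p, 'n) spacetime set).
    total_volume Y = 1 \<and> same_boundaries X Y \<and> d_minus X Y > ereal D \<and>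
    total_variation (order_measure K X) (order_measure K Y) < \<epsilon>"
proof -
  obtain N f Sm Sp where slab: "is_slab_in X N f Sm Sp"
    and cpt: "compactin (mtop N) (mtop N closure_of (f ` points X))"
    using assms(4) unfolding spatially_compact_slab_def by blast
  have X: "spacetime X" and N: "globally_hyperbolic N" and emb: "isometric_embedding X N f"
    using slab by (auto simp: is_slab_in_def)
  have stN: "spacetime N" and scN: "strongly_causal N" using N by (auto simp: globally_hyperbolic_def)
  have smX: "smooth_manifold X" and ne: "points X \<noteq> {}" using X unfolding spacetime_def by blast+
  have f: "local_isometry X N f" by (rule isometric_embedding_imp_local_isometry[OF emb X stN])
  have inj: "inj_on f (points X)"
    using emb by (auto simp: isometric_embedding_def embedding_map_def dest: homeomorphic_imp_injective_map)
  have "f ` points X \<subseteq> mtop N closure_of (f ` points X)"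
    using continuous_map_image_subset_topspace[OF local_isometryD(6)[OF f]] by (rule closure_of_subset)
  then obtain m where m: "0 \<le> m" "\<And>x y. lorentz_dist X x y \<le> ennreal m"
    using lorentz_dist_bounded[OF f scN cpt] by blast
  let ?\<mu> = "volume_measure X"
  \<comment> \<open>\<open>total_volume\<close> evaluates the measure on \<open>points X\<close>,
    which is known to be the whole space only if \<open>volume_measure X\<close> really is a volume
    measure.\<close>
  have prob: "prob_space ?\<mu>" if "is_volume_measure X ?\<mu>"
    using assms(5) is_volume_measureD(1)[OF that] by (intro prob_spaceI) (simp add: total_volume_def)
  \<comment> \<open>By Bernoulli's inequality \<open>1 - (1 - \<delta>) ^ K\<close> is at most
    \<open>real K * \<delta>\<close>; the denominator K + 1 makes this less than \<epsilon> and
    covers K = 0.\<close>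
  define \<delta> where "\<delta> = \<epsilon> / (real K + 1)"
  have \<delta>: "0 < \<delta>" "\<delta> \<le> 1" "real K * \<delta> < \<epsilon>"
    using assms(1,2) by (auto simp: \<delta>_def field_simps)
  have R: "0 < m + D + 1" using m(1) assms(3) by simp
  obtain \<Omega> x y where \<Omega>: "smooth_fun N \<Omega>" "\<And>p. 0 < \<Omega> p" and xy: "x \<in> points X" "y \<in> points X"
    "ennreal (m + D + 1) \<le> lorentz_dist (conformal (\<lambda>p. \<Omega> (f p)) X) x y"
    and int: "is_volume_measure X ?\<mu> \<Longrightarrow> (\<integral>\<^sup>+p. ennreal (sqrt (\<Omega> (f p)) ^ CARD('n)) \<partial>?\<mu>) = 1"
    and low: "\<And>p. 1 - \<delta> \<le> sqrt (\<Omega> (f p)) ^ CARD('n)"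
    by (rule exists_conformal_factor[OF f inj ne prob \<delta>(1,2) R]; (assumption | rule that))
  define \<Psi> where "\<Psi> = (\<lambda>p. \<Omega> (f p))"
  define Y where "Y = conformal \<Psi> X"
  have \<Psi>: "\<And>p. 0 < \<Psi> p" using \<Omega>(2) by (simp add: \<Psi>_def)
  have smY: "smooth_manifold Y"
    using smX by (simp add: Y_def smooth_manifold_def smooth_map_def)
  have ptsY: "points Y = points X" by (simp add: Y_def)
  have c\<Psi>: "continuous_map (mtop X) euclidean \<Psi>"
    unfolding \<Psi>_def
    by (rule smooth_fun_imp_continuous_map[OF smX smooth_fun_comp[OF smX local_isometryD(4,5)[OF f] \<Omega>(1)]])
  have slabY: "is_slab_in Y (conformal \<Omega> N) f Sm Sp"
    unfolding Y_def \<Psi>_def by (rule is_slab_in_conformal[OF slab \<Omega>])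
  have stY: "spacetime Y" using slabY by (simp add: is_slab_in_def)
  have scY: "spatially_compact_slab Y"
    unfolding spatially_compact_slab_def using slabY cpt
    by (intro exI[of _ "conformal \<Omega> N"] exI[of _ f] exI[of _ Sm] exI[of _ Sp]) (simp add: Y_def)
  have same: "same_boundaries X Y"
    unfolding same_boundaries_def using slab slabY
    by (intro exI[of _ N] exI[of _ "conformal \<Omega> N"] exI[of _ f] exI[of _ Sm] exI[of _ Sp]) simp
  have d: "d_minus X Y > ereal D"
    using xy by (intro d_minus_gt[OF m assms(3), of x _ y]) (auto simp: Y_def \<Psi>_def)
  have le: "causal_le Y = causal_le X" unfolding Y_def by (rule causal_le_conformal[OF \<Psi>])
  have "total_volume Y = 1 \<and> total_variation (order_measure K X) (order_measure K Y) < \<epsilon>"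
  proof (cases "\<exists>\<mu>. is_volume_measure X \<mu>")
    case True
    then have vol: "is_volume_measure X ?\<mu>"
      using volume_measure_eq[OF smX ne] by auto
    let ?w = "\<lambda>p. ennreal (sqrt (\<Psi> p) ^ CARD('n))"
    have \<Psi>m: "\<Psi> \<in> borel_measurable ?\<mu>" by (rule continuous_map_borel_volume[OF vol c\<Psi>])
    then have w: "?w \<in> borel_measurable ?\<mu>" by measurable
    have volY: "volume_measure Y = density ?\<mu> ?w"
      using is_volume_measure_conformal[OF X vol \<Psi>m \<Psi>] unfolding Y_def[symmetric]
      by (rule volume_measure_eq[OF smY ne[folded ptsY]])
    have "emeasure (density ?\<mu> ?w) (space ?\<mu>) = (\<integral>\<^sup>+p. ?w p * indicator (space ?\<mu>) p \<partial>?\<mu>)"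
      by (rule emeasure_density[OF w sets.top])
    also have "\<dots> = (\<integral>\<^sup>+p. ?w p \<partial>?\<mu>)" by (intro nn_integral_cong) simp
    finally have one: "emeasure (density ?\<mu> ?w) (space ?\<mu>) = 1" using int[OF vol] by (simp add: \<Psi>_def)
    then have tY: "total_volume Y = 1"
      by (simp add: total_volume_def volY ptsY is_volume_measureD(1)[OF vol])
    have pY: "prob_space (volume_measure Y)"
      using one by (intro prob_spaceI) (simp add: volY)
    have c: "ennreal (1 - \<delta>) \<le> ?w p" for p
      using low by (intro ennreal_leI) (simp add: \<Psi>_def)
    have "total_variation (order_measure K X) (order_measure K Y) \<le> 1 - (1 - \<delta>) ^ K"
      using \<delta>(1,2) c by (intro total_variation_order_measure_le[OF prob[OF vol] w volY pY _ _ _ le]) auto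
    moreover have "1 + real K * (- \<delta>) \<le> (1 + (- \<delta>)) ^ K"
      using \<delta>(2) by (intro Bernoulli_inequality) simp
    ultimately show ?thesis using \<delta>(3) tY by simp
  next
    text \<open>A volume measure always exists, but this need not be proved: otherwise \<open>volume_measure\<close>
      is the same arbitrary measure for \<open>X\<close> and for \<open>Y\<close>.\<close>
    case False
    \<comment> \<open>X arises from Y by the factor \<open>1 / \<Psi> p\<close>, so a volume measure
      of Y would yield one of X.\<close>
    have "\<not> is_volume_measure Y \<mu>" for \<mu>
    proof
      assume vol: "is_volume_measure Y \<mu>"
      have "\<Psi> \<in> borel_measurable \<mu>"
        using c\<Psi> by (intro continuous_map_borel_volume[OF vol]) (simp add: Y_def)
      then have "(\<lambda>p. 1 / \<Psi> p) \<in> borel_measurable \<mu>" by measurable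
      from is_volume_measure_conformal[OF stY vol this] \<Psi>
      have "\<exists>\<mu>. is_volume_measure (conformal (\<lambda>p. 1 / \<Psi> p) Y) \<mu>" by auto
      then show False using False conformal_conformal_inverse[of \<Psi> X, OF \<Psi>] by (simp add: Y_def)
    qed
    then have "is_volume_measure Y = is_volume_measure X" using False by (auto simp: fun_eq_iff)
    then have vol: "volume_measure Y = volume_measure X" by (simp add: volume_measure_def)
    have "order_measure K Y = order_measure K X"
      by (simp add: order_measure_def order_pattern_def vol le)
    moreover have "sets (order_measure K X) \<noteq> {}" using sets.empty_sets by blast
    ultimately have "total_variation (order_measure K X) (order_measure K Y) = 0"
      by (simp add: total_variation_def)
    moreover have "total_volume Y = 1"
      using assms(5) vol by (simp add: total_volume_def Y_def)
    ultimately show ?thesis using assms(1) by simp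
  qed
  then show ?thesis
    using scY same d by (intro bexI[of _ Y]) (auto simp: CS_def)
qed

end
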